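(* Let $\Sigma=(n,Q,\{(A_q,B_q,C_q)\mid q\in Q\})$ be an LSS (in continuous or discrete time) with a controllability grammian $\mathcal{P}>0$ and an observability grammian $\mathcal{R}>0$, let $r<n$, and let $\hat\Sigma$ be the LSS of dimension $r$ returned by the balanced truncation procedure applied to $\Sigma$ with $(\mathcal{P},\mathcal{R})$. With $\sigma_1\ge\cdots\ge\sigma_n>0$ the diagonal entries of the matrix $\Lambda$ of the procedure, $$\|Y^{\Sigma}-Y^{\hat\Sigma}\|_{\mathcal{L}_2}\le2\sum_{k=r+1}^{n}\sigma_k.$$
   Context: Let $Q=\{1,\ldots,D\}$, $D\ge1$. A linear switched system (LSS) is a tuple $\Sigma=(n,Q,\{(A_q,B_q,C_q)\mid q\in Q\})$ with $A_q\in\mathbb{R}^{n\times n}$, $B_q\in\mathbb{R}^{n\times m}$, $C_q\in\mathbb{R}^{p\times n}$; $n=\dim\Sigma$. In continuous time, with $T=[0,\infty)$, inputs are $u\in\mathcal{U}=L_2(T,\mathbb{R}^m)$, switching signals are $q\in\mathcal{Q}=PC(T,Q)$ (piecewise continuous: finitely many discontinuities on each compact interval, with one-sided limits), states are absolutely continuous functions. In discrete time, $\mathcal{U}=l_2(\mathbb{N},\mathbb{R}^m)$ and $\mathcal{Q}$ is the set of infinite sequences in $Q$. The input-output map $Y^\Sigma$ sends $(u,q)\in\mathcal{U}\times\mathcal{Q}$ to $y$, where $\delta x(t)=A_{q(t)}x(t)+B_{q(t)}u(t)$ (a.e. in continuous time), $x(0)=0$, $y(t)=C_{q(t)}x(t)$,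 with $\delta x=\dot x$ in continuous time and $\delta x(t)=x(t+1)$ in discrete time. $\mathcal{L}_2$ norm: for a map $f$ defined on $\mathcal{U}\times\mathcal{Q}$ with values in $\mathbb{R}^p$-valued signals, $\|f\|_{\mathcal{L}_2}$ is the infimum of all $\gamma>0$ such that $f(u,q)\in L_2(T,\mathbb{R}^p)$ (resp. $l_2(\mathbb{N},\mathbb{R}^p)$) for all $(u,q)$ and $\sup_{q\in\mathcal{Q}}\|f(u,q)\|_2\le\gamma\|u\|_2$ for all $u\in\mathcal{U}$; it is $+\infty$ if no such $\gamma$ exists. Here $\|\cdot\|_2$ is the $L_2$ norm (continuous time) or $l_2$ norm (discrete time). An observability grammian of $\Sigma$ is a positive definite $\mathcal{R}$ such that for all $q\in Q$: $A_q^T\mathcal{R}+\mathcal{R}A_q+C_q^TC_q\le0$ (cont.), resp. $A_q^T\mathcal{R}A_q+C_q^TC_q-\mathcal{R}\le0$ (disc.). A controllability grammian is a positive definite $\mathcal{P}$ such that for all $q\in Q$: $A_q\mathcal{P}+\mathcal{P}A_q^T+B_qB_q^T\le0$ (cont.), resp. $A_q\mathcal{P}A_q^T+B_qB_q^T-\mathcal{P}\le0$ (disc.). Balanced truncation procedure, applied to $\Sigma$ with $(\mathcal{P},\mathcal{R})$ and $r<n$: find $U$ with $\mathcal{P}=UU^T$ and an orthogonal $K$ with $U^T\mathcal{R}U=K\Lambda^2K^T$, where $\Lambda=\mathrm{diag}(\sigma_1,\ldots,\sigma_n)$, $\sigma_1\ge\cdots\ge\sigma_n>0$ (so $\sigma_i$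 are the square roots of the eigenvalues of $\mathcal{P}\mathcal{R}$). Put $\mathcal{S}=\Lambda^{1/2}K^TU^{-1}$ and $\bar A_q=\mathcal{S}A_q\mathcal{S}^{-1}$, $\bar B_q=\mathcal{S}B_q$, $\bar C_q=C_q\mathcal{S}^{-1}$. Let $\hat A_q$ be the upper left $r\times r$ block of $\bar A_q$, $\hat B_q$ the first $r$ rows of $\bar B_q$, and $\hat C_q$ the first $r$ columns of $\bar C_q$. Return $\hat\Sigma=(r,Q,\{(\hat A_q,\hat B_q,\hat C_q)\mid q\in Q\})$. *)

theory Defs
  imports "HOL-Analysis.Analysis" "Jordan_Normal_Form.Matrix"
begin

unbundle no vec_syntax
unbundle no inner_syntax

section \<open>Linear switched systems\<close>

text \<open>The set of modes is \<open>{1..num_modes}\<close>; the values of \<open>Amat\<close>, \<open>Bmat\<close>, \<open>Cmat\<close> at other indices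
  are irrelevant.\<close>

record lss =
  state_dim :: nat
  input_dim :: nat
  output_dim :: nat
  num_modes :: nat
  Amat :: "nat \<Rightarrow> real mat"
  Bmat :: "nat \<Rightarrow> real mat"
  Cmat :: "nat \<Rightarrow> real mat"

definition modes :: "lss \<Rightarrow> nat set" where
  "modes S = {1..num_modes S}"

definition is_lss :: "lss \<Rightarrow> bool" where
  "is_lss S \<longleftrightarrow> num_modes S \<ge> 1 \<and>
     (\<forall>q\<in>modes S. Amat S q \<in> carrier_mat (state_dim S) (state_dim S) \<and>
                  Bmat S q \<in> carrier_mat (state_dim S) (input_dim S) \<and>
                  Cmat S q \<in> carrier_mat (output_dim S) (state_dim S))"


section \<open>Signals\<close>

text \<open>Continuous-time signals are functions on the real line of which only the values on
  \<open>{0..}\<close> matter. Elements of \<open>L\<^sub>2\<close> are represented by functions rather than by classes modulo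
  null sets.\<close>

definition ct_L2 :: "nat \<Rightarrow> (real \<Rightarrow> real Matrix.vec) set" where
  "ct_L2 d = {u. (\<forall>t\<ge>0. u t \<in> carrier_vec d) \<and>
                 (\<forall>i<d. (\<lambda>t. u t $ i) \<in> borel_measurable (lebesgue_on {0..})) \<and>
                 integrable (lebesgue_on {0..}) (\<lambda>t. u t \<bullet> u t)}"

definition ct_norm2 :: "(real \<Rightarrow> real Matrix.vec) \<Rightarrow> real" where
  "ct_norm2 u = sqrt (LINT t|lebesgue_on {0..}. u t \<bullet> u t)"

definition dt_l2 :: "nat \<Rightarrow> (nat \<Rightarrow> real Matrix.vec) set" where
  "dt_l2 d = {u. (\<forall>t. u t \<in> carrier_vec d) \<and> summable (\<lambda>t. u t \<bullet> u t)}"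

definition dt_norm2 :: "(nat \<Rightarrow> real Matrix.vec) \<Rightarrow> real" where
  "dt_norm2 u = sqrt (\<Sum>t. u t \<bullet> u t)"

text \<open>Piecewise continuous switching signals; \<open>nat\<close> carries the discrete topology.\<close>

definition ct_switching :: "nat set \<Rightarrow> (real \<Rightarrow> nat) set" where
  "ct_switching Q = {q. (\<forall>t\<ge>0. q t \<in> Q) \<and>
     (\<forall>T. finite {t \<in> {0..T}. \<not> continuous (at t within {0..}) q}) \<and>
     (\<forall>t\<ge>0. \<exists>l. (q \<longlongrightarrow> l) (at_right t)) \<and>
     (\<forall>t>0. \<exists>l. (q \<longlongrightarrow> l) (at_left t))}"

definition dt_switching :: "nat set \<Rightarrow> (nat \<Rightarrow> nat) set" where
  "dt_switching Q = {q. \<forall>t. q t \<in> Q}"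


section \<open>Input-output maps\<close>

definition abs_continuous_on :: "real set \<Rightarrow> (real \<Rightarrow> real) \<Rightarrow> bool" where
  "abs_continuous_on I f \<longleftrightarrow>
     (\<forall>\<epsilon>>0. \<exists>\<delta>>0. \<forall>\<D> S. \<D> division_of S \<and> S \<subseteq> I \<and> (\<Sum>K\<in>\<D>. measure lborel K) < \<delta> \<longrightarrow>
        (\<Sum>K\<in>\<D>. \<bar>f (Sup K) - f (Inf K)\<bar>) < \<epsilon>)"

definition vector_field :: "lss \<Rightarrow> nat \<Rightarrow> real Matrix.vec \<Rightarrow> real Matrix.vec \<Rightarrow> real Matrix.vec" where
  "vector_field S q x u = Amat S q *\<^sub>v x + Bmat S q *\<^sub>v u"

text \<open>On the unbounded time axis, absolute continuity of a state trajectory means absolute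
  continuity on every compact interval.\<close>

definition ct_trajectory ::
  "lss \<Rightarrow> (real \<Rightarrow> real Matrix.vec) \<Rightarrow> (real \<Rightarrow> nat) \<Rightarrow> (real \<Rightarrow> real Matrix.vec) \<Rightarrow> bool" where
  "ct_trajectory S u q x \<longleftrightarrow>
     (\<forall>t\<ge>0. x t \<in> carrier_vec (state_dim S)) \<and>
     x 0 = 0\<^sub>v (state_dim S) \<and>
     (\<forall>i<state_dim S. \<forall>T\<ge>0. abs_continuous_on {0..T} (\<lambda>t. x t $ i)) \<and>
     (AE t in lebesgue_on {0..}. \<forall>i<state_dim S.
        ((\<lambda>s. x s $ i) has_real_derivative vector_field S (q t) (x t) (u t) $ i)
          (at t within {0..}))"

text \<open>For \<open>u\<close> in \<open>L\<^sub>2\<close> and piecewise continuous \<open>q\<close> the trajectory exists and is unique on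
  \<open>{0..}\<close>, so the choice below is immaterial there.\<close>

definition ct_state ::
  "lss \<Rightarrow> (real \<Rightarrow> real Matrix.vec) \<Rightarrow> (real \<Rightarrow> nat) \<Rightarrow> real \<Rightarrow> real Matrix.vec" where
  "ct_state S u q = (SOME x. ct_trajectory S u q x)"

definition ct_io_map ::
  "lss \<Rightarrow> (real \<Rightarrow> real Matrix.vec) \<Rightarrow> (real \<Rightarrow> nat) \<Rightarrow> real \<Rightarrow> real Matrix.vec" where
  "ct_io_map S u q t = Cmat S (q t) *\<^sub>v ct_state S u q t"

primrec dt_state ::
  "lss \<Rightarrow> (nat \<Rightarrow> real Matrix.vec) \<Rightarrow> (nat \<Rightarrow> nat) \<Rightarrow> nat \<Rightarrow> real Matrix.vec" where
  "dt_state S u q 0 = 0\<^sub>v (state_dim S)"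
| "dt_state S u q (Suc t) = vector_field S (q t) (dt_state S u q t) (u t)"

definition dt_io_map ::
  "lss \<Rightarrow> (nat \<Rightarrow> real Matrix.vec) \<Rightarrow> (nat \<Rightarrow> nat) \<Rightarrow> nat \<Rightarrow> real Matrix.vec" where
  "dt_io_map S u q t = Cmat S (q t) *\<^sub>v dt_state S u q t"


section \<open>The L2 norm of an input-output map\<close>

text \<open>\<open>\<U>\<close> is the input space with norm \<open>nu\<close>, \<open>\<Q>\<close> the set of switching signals, \<open>\<Y>\<close> the output
  space with norm \<open>ny\<close>. The infimum of the empty set is \<open>\<infinity>\<close>.\<close>

definition gain_norm ::
  "'u set \<Rightarrow> ('u \<Rightarrow> real) \<Rightarrow> 'q set \<Rightarrow> 'y set \<Rightarrow> ('y \<Rightarrow> real) \<Rightarrow> ('u \<Rightarrow> 'q \<Rightarrow> 'y) \<Rightarrow> ereal" where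
  "gain_norm \<U> nu \<Q> \<Y> ny f =
     Inf {ereal \<gamma> | \<gamma>. \<gamma> > 0 \<and> (\<forall>u\<in>\<U>. \<forall>q\<in>\<Q>. f u q \<in> \<Y>) \<and>
                       (\<forall>u\<in>\<U>. (SUP q\<in>\<Q>. ereal (ny (f u q))) \<le> ereal (\<gamma> * nu u))}"

definition ct_L2_norm :: "nat \<Rightarrow> nat set \<Rightarrow> nat \<Rightarrow>
    ((real \<Rightarrow> real Matrix.vec) \<Rightarrow> (real \<Rightarrow> nat) \<Rightarrow> real \<Rightarrow> real Matrix.vec) \<Rightarrow> ereal" where
  "ct_L2_norm m Q p = gain_norm (ct_L2 m) ct_norm2 (ct_switching Q) (ct_L2 p) ct_norm2"

definition dt_L2_norm :: "nat \<Rightarrow> nat set \<Rightarrow> nat \<Rightarrow>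
    ((nat \<Rightarrow> real Matrix.vec) \<Rightarrow> (nat \<Rightarrow> nat) \<Rightarrow> nat \<Rightarrow> real Matrix.vec) \<Rightarrow> ereal" where
  "dt_L2_norm m Q p = gain_norm (dt_l2 m) dt_norm2 (dt_switching Q) (dt_l2 p) dt_norm2"


section \<open>Grammians\<close>

definition pos_definite :: "nat \<Rightarrow> real mat \<Rightarrow> bool" where
  "pos_definite n M \<longleftrightarrow> M \<in> carrier_mat n n \<and> M\<^sup>T = M \<and>
     (\<forall>v\<in>carrier_vec n. v \<noteq> 0\<^sub>v n \<longrightarrow> v \<bullet> (M *\<^sub>v v) > 0)"

definition neg_semidefinite :: "nat \<Rightarrow> real mat \<Rightarrow> bool" where
  "neg_semidefinite n M \<longleftrightarrow> M \<in> carrier_mat n n \<and> M\<^sup>T = M \<and>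
     (\<forall>v\<in>carrier_vec n. v \<bullet> (M *\<^sub>v v) \<le> 0)"

definition ct_observability_grammian :: "lss \<Rightarrow> real mat \<Rightarrow> bool" where
  "ct_observability_grammian S R \<longleftrightarrow> pos_definite (state_dim S) R \<and>
     (\<forall>q\<in>modes S. neg_semidefinite (state_dim S)
        ((Amat S q)\<^sup>T * R + R * Amat S q + (Cmat S q)\<^sup>T * Cmat S q))"

definition dt_observability_grammian :: "lss \<Rightarrow> real mat \<Rightarrow> bool" where
  "dt_observability_grammian S R \<longleftrightarrow> pos_definite (state_dim S) R \<and>
     (\<forall>q\<in>modes S. neg_semidefinite (state_dim S)
        ((Amat S q)\<^sup>T * R * Amat S q + (Cmat S q)\<^sup>T * Cmat S q - R))"

definition ct_controllability_grammian :: "lss \<Rightarrow> real mat \<Rightarrow> bool" where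
  "ct_controllability_grammian S P \<longleftrightarrow> pos_definite (state_dim S) P \<and>
     (\<forall>q\<in>modes S. neg_semidefinite (state_dim S)
        (Amat S q * P + P * (Amat S q)\<^sup>T + Bmat S q * (Bmat S q)\<^sup>T))"

definition dt_controllability_grammian :: "lss \<Rightarrow> real mat \<Rightarrow> bool" where
  "dt_controllability_grammian S P \<longleftrightarrow> pos_definite (state_dim S) P \<and>
     (\<forall>q\<in>modes S. neg_semidefinite (state_dim S)
        (Amat S q * P * (Amat S q)\<^sup>T + Bmat S q * (Bmat S q)\<^sup>T - P))"


section \<open>Balanced truncation\<close>

definition upper_left_block :: "nat \<Rightarrow> nat \<Rightarrow> real mat \<Rightarrow> real mat" where
  "upper_left_block k l M = Matrix.mat k l (\<lambda>ij. M $$ ij)"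

definition transform_lss :: "real mat \<Rightarrow> real mat \<Rightarrow> lss \<Rightarrow> lss" where
  "transform_lss T Tinv S =
     S\<lparr>Amat := \<lambda>q. T * Amat S q * Tinv, Bmat := \<lambda>q. T * Bmat S q, Cmat := \<lambda>q. Cmat S q * Tinv\<rparr>"

definition truncate_lss :: "nat \<Rightarrow> lss \<Rightarrow> lss" where
  "truncate_lss r S =
     S\<lparr>state_dim := r,
       Amat := \<lambda>q. upper_left_block r r (Amat S q),
       Bmat := \<lambda>q. upper_left_block r (input_dim S) (Bmat S q),
       Cmat := \<lambda>q. upper_left_block (output_dim S) r (Cmat S q)\<rparr>"

text \<open>\<open>balanced_truncation S P R r \<sigma> S'\<close>: the procedure applied to \<open>S\<close> with \<open>(P, R)\<close> and \<open>r\<close> may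
  return \<open>S'\<close>, with \<open>\<sigma> 1, \<dots>, \<sigma> n\<close> on the diagonal of \<open>\<Lambda>\<close>. It is a relation because \<open>U\<close> and \<open>K\<close>
  are not unique. Matrix indices start at 0, hence \<open>\<sigma> (Suc i)\<close>.\<close>

definition balanced_truncation ::
  "lss \<Rightarrow> real mat \<Rightarrow> real mat \<Rightarrow> nat \<Rightarrow> (nat \<Rightarrow> real) \<Rightarrow> lss \<Rightarrow> bool" where
  "balanced_truncation S P R r \<sigma> S' \<longleftrightarrow>
     (let n = state_dim S; \<Lambda> = mat_diag n (\<lambda>i. \<sigma> (Suc i)) in
      r < n \<and>
      (\<forall>i\<in>{1..n}. \<sigma> i > 0) \<and> (\<forall>i\<in>{1..n}. \<forall>j\<in>{1..n}. i \<le> j \<longrightarrow> \<sigma> j \<le> \<sigma> i) \<and>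
      (\<exists>U Uinv K T Tinv.
         U \<in> carrier_mat n n \<and> P = U * U\<^sup>T \<and>
         K \<in> carrier_mat n n \<and> K\<^sup>T * K = 1\<^sub>m n \<and>
         U\<^sup>T * R * U = K * (\<Lambda> ^\<^sub>m 2) * K\<^sup>T \<and>
         inverts_mat U Uinv \<and> inverts_mat Uinv U \<and>
         T = mat_diag n (\<lambda>i. sqrt (\<sigma> (Suc i))) * K\<^sup>T * Uinv \<and>
         inverts_mat T Tinv \<and> inverts_mat Tinv T \<and>
         S' = truncate_lss r (transform_lss T Tinv S)))"

end

theory Submission
  imports Defs "Jordan_Normal_Form.Determinant"
begin

text \<open>Write \<open>s k\<close> for \<open>\<sigma> (Suc k)\<close>, \<open>\<Lambda>\<close> for the diagonal matrix with these entries, and \<open>\<Lambda>'\<close> for its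
  inverse. In the coordinates \<open>T x\<close> of the procedure both grammians become \<open>\<Lambda>\<close> (\<open>balanced_truncation_coordinates\<close>).
  The observability inequality then bounds the output of an undriven state by the decrease of
  \<open>x \<bullet> \<Lambda> x\<close>, and the controllability inequality, which is the observability inequality of the
  dual system, bounds the growth of \<open>x \<bullet> \<Lambda>' x\<close> by the energy of the input.

  Pad the states of the truncated systems of all dimensions \<open>k = r, \<dots>, n\<close> with zeros and drive all
  of them with the same input and switching signal. For consecutive levels, with states \<open>x\<close> (dimension
  \<open>k + 1\<close>) and \<open>y\<close> (dimension \<open>k\<close>), consider the energy
  \<open>(x - y) \<bullet> \<Lambda> (x - y) + (s k)\<^sup>2 * ((x + y) \<bullet> \<Lambda>' (x + y))\<close>. Up to component \<open>k\<close>, the difference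
  \<open>x - y\<close> evolves without input and the sum \<open>x + y\<close> with twice the input, so the two inequalities
  apply. In component \<open>k\<close> the truncation perturbs the difference and the sum by opposite amounts, and
  both terms of the energy have the weight \<open>s k\<close> there, so the perturbations cancel or help. Hence one
  truncation step has gain at most \<open>2 * s k\<close> (\<open>step_energy_deriv_le\<close> in continuous and
  \<open>step_energy_next_le\<close> in discrete time). Since one Lyapunov function serves all modes, this
  holds along every switching signal.

  The steps are combined at the level of energies: with weights proportional to \<open>1 / s k\<close>, the
  Cauchy-Schwarz inequality turns the dissipated energies of the single steps into the square of the
  whole error, with gain \<open>2 * (\<Sum>k=r..<n. s k)\<close> (\<open>weighted_sum_of_steps_le\<close>). Summing over time gives the
  bound in discrete time.

  In continuous time the energy has to be integrated along trajectories that are only absolutely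
  continuous. This rests on two facts of real analysis: the fundamental theorem of calculus for
  absolutely continuous functions (\<open>fundamental_theorem_of_calculus_abs_continuous\<close>), and the existence
  of solutions of linear differential equations with measurable coefficients
  (\<open>linear_ode_solution_exists\<close>), which makes the chosen states trajectories and provides those of the
  intermediate dimensions.\<close>

section \<open>Absolutely continuous functions\<close>

text \<open>Closure under scalar multiples, sums, differences and, on compact intervals, products are all
  instances of this domination principle.\<close>

lemma abs_continuous_on_dominated:
  assumes g: "abs_continuous_on I g" and h: "abs_continuous_on I h"
    and le: "\<And>u v. u \<in> I \<Longrightarrow> v \<in> I \<Longrightarrow> \<bar>f v - f u\<bar> \<le> M * (\<bar>g v - g u\<bar> + \<bar>h v - h u\<bar>)"
  shows "abs_continuous_on I f"
  unfolding abs_continuous_on_def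
proof (intro allI impI)
  fix \<epsilon> :: real assume "\<epsilon> > 0"
  define c where "c = \<bar>M\<bar> + 1"
  define e where "e = \<epsilon> / (2 * c)"
  have c: "c > 0" "\<bar>M\<bar> < c" by (auto simp: c_def)
  then have e: "e > 0" using \<open>\<epsilon> > 0\<close> by (simp add: e_def)
  from g e obtain d1 where d1: "d1 > 0" "\<And>\<D> S. \<D> division_of S \<Longrightarrow> S \<subseteq> I \<Longrightarrow>
      (\<Sum>K\<in>\<D>. measure lborel K) < d1 \<Longrightarrow> (\<Sum>K\<in>\<D>. \<bar>g (Sup K) - g (Inf K)\<bar>) < e"
    unfolding abs_continuous_on_def by metis
  from h e obtain d2 where d2: "d2 > 0" "\<And>\<D> S. \<D> division_of S \<Longrightarrow> S \<subseteq> I \<Longrightarrow>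
      (\<Sum>K\<in>\<D>. measure lborel K) < d2 \<Longrightarrow> (\<Sum>K\<in>\<D>. \<bar>h (Sup K) - h (Inf K)\<bar>) < e"
    unfolding abs_continuous_on_def by metis
  show "\<exists>\<delta>>0. \<forall>\<D> S. \<D> division_of S \<and> S \<subseteq> I \<and> (\<Sum>K\<in>\<D>. measure lborel K) < \<delta> \<longrightarrow>
        (\<Sum>K\<in>\<D>. \<bar>f (Sup K) - f (Inf K)\<bar>) < \<epsilon>"
  proof (intro exI conjI allI impI)
    show "min d1 d2 > 0" using d1 d2 by simp
    fix \<D> S assume "\<D> division_of S \<and> S \<subseteq> I \<and> (\<Sum>K\<in>\<D>. measure lborel K) < min d1 d2"
    then have D: "\<D> division_of S" and S: "S \<subseteq> I" and m: "(\<Sum>K\<in>\<D>. measure lborel K) < min d1 d2" by auto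
    have ends: "Sup K \<in> I \<and> Inf K \<in> I" if K: "K \<in> \<D>" for K
    proof -
      obtain a b where "K = cbox a b" "K \<noteq> {}" "K \<subseteq> S" using division_ofD(2-4)[OF D K] by metis
      then show ?thesis using S by (auto simp: interval_cbox[symmetric] subset_iff)
    qed
    have "(\<Sum>K\<in>\<D>. \<bar>f (Sup K) - f (Inf K)\<bar>)
        \<le> (\<Sum>K\<in>\<D>. \<bar>M\<bar> * (\<bar>g (Sup K) - g (Inf K)\<bar> + \<bar>h (Sup K) - h (Inf K)\<bar>))"
    proof (rule sum_mono)
      fix K assume "K \<in> \<D>"
      have "\<bar>f (Sup K) - f (Inf K)\<bar> \<le> M * (\<bar>g (Sup K) - g (Inf K)\<bar> + \<bar>h (Sup K) - h (Inf K)\<bar>)"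
        using le ends[OF \<open>K \<in> \<D>\<close>] by blast
      also have "\<dots> \<le> \<bar>M\<bar> * (\<bar>g (Sup K) - g (Inf K)\<bar> + \<bar>h (Sup K) - h (Inf K)\<bar>)"
        by (intro mult_right_mono) auto
      finally show "\<bar>f (Sup K) - f (Inf K)\<bar> \<le> \<dots>" .
    qed
    also have "\<dots> = \<bar>M\<bar> * ((\<Sum>K\<in>\<D>. \<bar>g (Sup K) - g (Inf K)\<bar>) + (\<Sum>K\<in>\<D>. \<bar>h (Sup K) - h (Inf K)\<bar>))"
      by (simp only: sum.distrib sum_distrib_left distrib_left)
    also have "\<dots> \<le> \<bar>M\<bar> * (e + e)"
      using d1(2)[OF D S] d2(2)[OF D S] m by (intro mult_left_mono add_mono) auto
    also have "\<dots> < c * (e + e)" using c e by (intro mult_strict_right_mono) auto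
    also have "\<dots> = \<epsilon>" using c by (simp add: e_def field_simps)
    finally show "(\<Sum>K\<in>\<D>. \<bar>f (Sup K) - f (Inf K)\<bar>) < \<epsilon>" .
  qed
qed

lemma abs_continuous_on_imp_continuous_on:
  assumes "abs_continuous_on {a..b} f"
  shows "continuous_on {a..b} f"
  unfolding continuous_on_iff
proof (intro ballI allI impI)
  fix x e :: real assume x: "x \<in> {a..b}" and "e > 0"
  from assms \<open>e > 0\<close> obtain d where d: "d > 0" "\<And>\<D> S. \<D> division_of S \<Longrightarrow> S \<subseteq> {a..b} \<Longrightarrow>
      (\<Sum>K\<in>\<D>. measure lborel K) < d \<Longrightarrow> (\<Sum>K\<in>\<D>. \<bar>f (Sup K) - f (Inf K)\<bar>) < e"
    unfolding abs_continuous_on_def by metis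
  have "dist (f y) (f x) < e" if y: "y \<in> {a..b}" "dist y x < d" for y
  proof -
    define u v where "u = min x y" and "v = max x y"
    have uv: "u \<le> v" "v - u < d" "a \<le> u" "v \<le> b" using x y by (auto simp: u_def v_def dist_real_def)
    have "{cbox u v} division_of cbox u v" by (rule division_of_self) (use uv in \<open>simp add: box_ne_empty\<close>)
    moreover have "cbox u v \<subseteq> {a..b}" using uv by simp
    moreover have "(\<Sum>K\<in>{cbox u v}. measure lborel K) < d" using uv by simp
    ultimately have "(\<Sum>K\<in>{cbox u v}. \<bar>f (Sup K) - f (Inf K)\<bar>) < e" by (rule d(2))
    then have "\<bar>f v - f u\<bar> < e" using uv by simp
    then show ?thesis by (cases "x \<le> y") (auto simp: dist_real_def u_def v_def abs_minus_commute)
  qed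
  then show "\<exists>d>0. \<forall>y\<in>{a..b}. dist y x < d \<longrightarrow> dist (f y) (f x) < e" using d(1) by blast
qed

lemma abs_continuous_on_const: "abs_continuous_on I (\<lambda>t. c)"
  unfolding abs_continuous_on_def by (auto intro!: exI[of _ 1])

lemma abs_continuous_on_cmult:
  "abs_continuous_on I f \<Longrightarrow> abs_continuous_on I (\<lambda>t. c * f t)"
  by (rule abs_continuous_on_dominated[of I f "\<lambda>t. 0" _ "\<bar>c\<bar>"])
     (auto intro: abs_continuous_on_const simp flip: right_diff_distrib simp: abs_mult)

lemma abs_continuous_on_add:
  "abs_continuous_on I f \<Longrightarrow> abs_continuous_on I g \<Longrightarrow> abs_continuous_on I (\<lambda>t. f t + g t)"
  by (rule abs_continuous_on_dominated[of I f g _ 1]) auto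

lemma abs_continuous_on_diff:
  "abs_continuous_on I f \<Longrightarrow> abs_continuous_on I g \<Longrightarrow> abs_continuous_on I (\<lambda>t. f t - g t)"
  by (rule abs_continuous_on_dominated[of I f g _ 1]) auto

lemma abs_continuous_on_sum:
  "(\<And>i. i \<in> J \<Longrightarrow> abs_continuous_on I (f i)) \<Longrightarrow> abs_continuous_on I (\<lambda>t. \<Sum>i\<in>J. f i t)"
  by (induction J rule: infinite_finite_induct)
     (auto intro: abs_continuous_on_const abs_continuous_on_add)

lemma abs_continuous_on_mult:
  assumes f: "abs_continuous_on {a..b} f" and g: "abs_continuous_on {a..b} g"
  shows "abs_continuous_on {a..b} (\<lambda>t. f t * g t)"
proof -
  have "bounded (f ` {a..b})" "bounded (g ` {a..b})"
    using f g by (auto intro!: compact_imp_bounded compact_continuous_image abs_continuous_on_imp_continuous_on)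
  then obtain A B where A: "\<And>t. t \<in> {a..b} \<Longrightarrow> \<bar>f t\<bar> \<le> A" and B: "\<And>t. t \<in> {a..b} \<Longrightarrow> \<bar>g t\<bar> \<le> B"
    unfolding bounded_iff by (metis image_eqI real_norm_def)
  show ?thesis
  proof (rule abs_continuous_on_dominated[OF f g, of _ "max A B"])
    fix u v assume uv: "u \<in> {a..b}" "v \<in> {a..b}"
    have "f v * g v - f u * g u = f v * (g v - g u) + g u * (f v - f u)" by (simp add: algebra_simps)
    then have "\<bar>f v * g v - f u * g u\<bar> \<le> \<bar>f v\<bar> * \<bar>g v - g u\<bar> + \<bar>g u\<bar> * \<bar>f v - f u\<bar>"
      by (metis abs_mult abs_triangle_ineq)
    also have "\<dots> \<le> max A B * \<bar>g v - g u\<bar> + max A B * \<bar>f v - f u\<bar>"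
      using A[OF uv(2)] B[OF uv(1)] by (intro add_mono mult_right_mono) auto
    finally show "\<bar>f v * g v - f u * g u\<bar> \<le> max A B * (\<bar>f v - f u\<bar> + \<bar>g v - g u\<bar>)"
      by (simp add: algebra_simps)
  qed
qed

lemma negligible_outer_open:
  fixes N :: "real set"
  assumes "negligible N" "e > 0"
  obtains U where "open U" "N \<subseteq> U" "U \<in> lmeasurable" "measure lebesgue U < e"
proof -
  have N: "N \<in> lmeasurable" "N \<in> sets lebesgue" "N \<in> null_sets lebesgue"
    using assms(1) negligible_iff_null_sets by (auto simp: negligible_iff_measure dest: negligible_imp_sets)
  obtain U where U: "open U" "N \<subseteq> U" "U - N \<in> lmeasurable" "emeasure lebesgue (U - N) < ennreal e"
    using sets_lebesgue_outer_open[OF N(2) assms(2)] by blast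
  have eq: "U = N \<union> (U - N)" using U(2) by blast
  have Ul: "U \<in> lmeasurable" using N(1) U(3) by (subst eq) (rule fmeasurable.Un)
  have "measure lebesgue U \<le> measure lebesgue N + measure lebesgue (U - N)"
    using N(1) U(3) by (subst eq) (intro measure_Un_le, auto)
  also have "measure lebesgue N = 0" using assms(1) by (simp add: negligible_iff_measure)
  also have "measure lebesgue (U - N) < e"
    using U(3,4) assms(2) by (metis emeasure_eq_measure2 ennreal_less_iff measure_nonneg)
  finally show ?thesis using that U Ul by simp
qed

text \<open>In a Riemann sum of a gauge integral, the terms with tags outside the null
  set \<open>N\<close> are controlled by differentiability as usual; the intervals with tags in \<open>N\<close> are forced by
  the gauge into an open set of small measure, where absolute continuity bounds the total variation.\<close>

lemma fundamental_theorem_of_calculus_abs_continuous: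
  fixes f g :: "real \<Rightarrow> real"
  assumes "a \<le> b" and ac: "abs_continuous_on {a..b} f" and N: "negligible N"
    and der: "\<And>x. x \<in> {a..b} - N \<Longrightarrow> (f has_real_derivative g x) (at x within {a..b})"
  shows "(g has_integral (f b - f a)) {a..b}"
proof -
  define g0 where "g0 = (\<lambda>x. if x \<in> N then 0 else g x)"
  have "(g0 has_integral (f b - f a)) {a..b}"
    unfolding has_integral_real
  proof (intro allI impI)
    fix e :: real assume "e > 0"
    \<comment> \<open>The tags outside \<open>N\<close> contribute at most \<open>2 * e' * (b - a) < e / 2\<close>.\<close>
    define e' where "e' = e / (4 * (b - a + 1))"
    have e': "e' > 0" using \<open>e > 0\<close> \<open>a \<le> b\<close> by (simp add: e'_def)
    have "e / 2 > 0" using \<open>e > 0\<close> by simp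
    with ac obtain \<delta> where \<delta>: "\<delta> > 0" "\<And>\<D> S. \<D> division_of S \<Longrightarrow> S \<subseteq> {a..b} \<Longrightarrow>
        (\<Sum>K\<in>\<D>. measure lborel K) < \<delta> \<Longrightarrow> (\<Sum>K\<in>\<D>. \<bar>f (Sup K) - f (Inf K)\<bar>) < e / 2"
      unfolding abs_continuous_on_def by metis
    obtain U where U: "open U" "N \<subseteq> U" "U \<in> lmeasurable" "measure lebesgue U < \<delta>"
      using negligible_outer_open[OF N \<delta>(1)] by blast
    have "\<exists>d>0. \<forall>y\<in>{a..b}. \<bar>y - x\<bar> < d \<longrightarrow> \<bar>f y - f x - g x * (y - x)\<bar> \<le> e' * \<bar>y - x\<bar>"
      if "x \<in> {a..b} - N" for x
    proof -
      have "(f has_derivative (*) (g x)) (at x within {a..b})"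
        using der[OF that] by (simp add: has_field_derivative_def)
      then show ?thesis using e' unfolding has_derivative_within_alt
        by (auto simp: real_norm_def)
    qed
    then obtain d where d: "\<And>x. x \<in> {a..b} - N \<Longrightarrow> d x > 0"
      "\<And>x y. x \<in> {a..b} - N \<Longrightarrow> y \<in> {a..b} \<Longrightarrow> \<bar>y - x\<bar> < d x \<Longrightarrow>
         \<bar>f y - f x - g x * (y - x)\<bar> \<le> e' * \<bar>y - x\<bar>"
      by metis
    define \<gamma> where "\<gamma> = (\<lambda>x. if x \<in> N then U else if x \<in> {a..b} then ball x (d x) else ball x 1)"
    show "\<exists>\<gamma>. gauge \<gamma> \<and> (\<forall>\<D>. \<D> tagged_division_of {a..b} \<and> \<gamma> fine \<D> \<longrightarrow>
        norm ((\<Sum>(x,K)\<in>\<D>. measure lborel K *\<^sub>R g0 x) - (f b - f a)) < e)"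
    proof (intro exI conjI allI impI)
      show "gauge \<gamma>" using U d(1) by (auto simp: gauge_def \<gamma>_def)
      fix \<D> assume "\<D> tagged_division_of {a..b} \<and> \<gamma> fine \<D>"
      then have D: "\<D> tagged_division_of {a..b}" and fine: "\<gamma> fine \<D>" by auto
      note fin = tagged_division_of_finite[OF D]
      define D1 where "D1 = {(x,K) \<in> \<D>. x \<notin> N}"
      define D2 where "D2 = {(x,K) \<in> \<D>. x \<in> N}"
      have split: "\<D> = D1 \<union> D2" "D1 \<inter> D2 = {}" and sub: "D1 \<subseteq> \<D>" "D2 \<subseteq> \<D>"
        by (auto simp: D1_def D2_def)
      have fin12: "finite D1" "finite D2" using fin sub finite_subset by blast+
      have "\<bar>measure lborel K * g0 x - (f (Sup K) - f (Inf K))\<bar> \<le> 2 * e' * measure lborel K" if "(x,K) \<in> D1" for x K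
      proof -
        have xK: "(x,K) \<in> \<D>" "x \<notin> N" using that by (auto simp: D1_def)
        obtain u v where K: "K = cbox u v" using tagged_division_ofD(4)[OF D xK(1)] by blast
        have x: "x \<in> K" "K \<subseteq> {a..b}" using tagged_division_ofD(2,3)[OF D xK(1)] by auto
        have K': "K = {u..v}" "u \<le> x" "x \<le> v" using x K by (auto simp: cbox_interval)
        have xN: "x \<in> {a..b} - N" using x xK by auto
        have "K \<subseteq> \<gamma> x" using fine xK by (auto simp: fine_def)
        then have "K \<subseteq> ball x (d x)" using xN by (auto simp: \<gamma>_def)
        moreover have "u \<in> K" "v \<in> K" using K' by auto
        ultimately have "u \<in> ball x (d x)" "v \<in> ball x (d x)" by blast+
        then have "\<bar>u - x\<bar> < d x" "\<bar>v - x\<bar> < d x" by (auto simp: dist_real_def)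
        moreover have "u \<in> {a..b}" "v \<in> {a..b}" using K' x by auto
        ultimately have "\<bar>f u - f x - g x * (u - x)\<bar> \<le> e' * \<bar>u - x\<bar>" "\<bar>f v - f x - g x * (v - x)\<bar> \<le> e' * \<bar>v - x\<bar>"
          using d(2)[OF xN] by blast+
        moreover have "e' * \<bar>u - x\<bar> \<le> e' * (v - u)" "e' * \<bar>v - x\<bar> \<le> e' * (v - u)"
          using K' e' by (auto intro!: mult_left_mono)
        moreover have "(v - u) * g x - (f v - f u)
            = (f u - f x - g x * (u - x)) - (f v - f x - g x * (v - x))" by (simp add: algebra_simps)
        ultimately have "\<bar>(v - u) * g x - (f v - f u)\<bar> \<le> e' * (v - u) + e' * (v - u)" by linarith
        then have "\<bar>(v - u) * g x - (f v - f u)\<bar> \<le> 2 * e' * (v - u)" by simp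
        then show ?thesis using K' xK by (auto simp: g0_def)
      qed
      then have "(\<Sum>(x,K)\<in>D1. \<bar>measure lborel K * g0 x - (f (Sup K) - f (Inf K))\<bar>) \<le> (\<Sum>(x,K)\<in>D1. 2 * e' * measure lborel K)"
        by (intro sum_mono) auto
      also have "\<dots> \<le> (\<Sum>(x,K)\<in>\<D>. 2 * e' * measure lborel K)"
        using fin sub e' by (intro sum_mono2) (auto intro!: mult_nonneg_nonneg)
      also have "\<dots> = 2 * e' * (\<Sum>(x,K)\<in>\<D>. measure lborel K)"
        by (simp add: sum_distrib_left case_prod_beta)
      also have "(\<Sum>(x,K)\<in>\<D>. measure lborel K) = b - a"
        using additive_content_tagged_division[of \<D> a b] D \<open>a \<le> b\<close> by (simp add: cbox_interval)
      also have "2 * e' * (b - a) < e / 2" using \<open>e > 0\<close> \<open>a \<le> b\<close> by (simp add: e'_def field_simps)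
      finally have S1: "(\<Sum>(x,K)\<in>D1. \<bar>measure lborel K * g0 x - (f (Sup K) - f (Inf K))\<bar>) < e / 2" .
      have "D2 tagged_partial_division_of {a..b}"
        using D sub unfolding tagged_division_of_def by (blast intro: tagged_partial_division_subset)
      then have D2: "D2 tagged_division_of \<Union>(snd ` D2)" by (rule tagged_partial_division_of_Union_self)
      note D2' = division_of_tagged_division[OF D2]
      have sub2: "\<Union>(snd ` D2) \<subseteq> {a..b} \<inter> U"
        using tagged_division_ofD(3)[OF D] fine by (fastforce simp: D2_def fine_def \<gamma>_def)
      have "(\<Sum>K\<in>snd ` D2. measure lborel K) = (\<Sum>K\<in>snd ` D2. measure lebesgue K)"
        by (rule sum.cong) (use division_ofD(4)[OF D2'] in \<open>fastforce simp: \<close>)+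
      also have "\<dots> = measure lebesgue (\<Union>(snd ` D2))" by (rule content_division[OF D2'])
      also have "\<dots> \<le> measure lebesgue U"
        using sub2 U(3) lmeasurable_division[OF D2'] by (intro measure_mono_fmeasurable) auto
      finally have "(\<Sum>K\<in>snd ` D2. measure lborel K) < \<delta>" using U(4) by simp
      then have "(\<Sum>K\<in>snd ` D2. \<bar>f (Sup K) - f (Inf K)\<bar>) < e / 2"
        using \<delta>(2)[OF D2'] sub2 by auto
      moreover have "(\<Sum>(x,K)\<in>D2. \<bar>f (Sup K) - f (Inf K)\<bar>) = (\<Sum>K\<in>snd ` D2. \<bar>f (Sup K) - f (Inf K)\<bar>)"
      proof -
        (* the cells are nonempty, but the summation rule also asks about the empty interval,
           whose Sup and Inf need not agree *)
        define var where "var = (\<lambda>K. if K = {} then 0 else \<bar>f (Sup K) - f (Inf K)\<bar>)"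
        have ne: "K \<noteq> {}" if "(x, K) \<in> D2" for x K using tagged_division_ofD(2)[OF D2 that] by auto
        have "(\<Sum>(x,K)\<in>D2. \<bar>f (Sup K) - f (Inf K)\<bar>) = (\<Sum>(x,K)\<in>D2. var K)"
          by (rule sum.cong) (auto simp: var_def dest: ne)
        also have "\<dots> = (\<Sum>K\<in>snd ` D2. var K)"
        proof (rule sum.over_tagged_division_lemma[OF D2])
          fix u v :: real assume "box u v = {}"
          then show "var (cbox u v) = 0" by (cases "u = v") (auto simp: var_def cbox_interval)
        qed
        also have "\<dots> = (\<Sum>K\<in>snd ` D2. \<bar>f (Sup K) - f (Inf K)\<bar>)"
          by (rule sum.cong) (auto simp: var_def dest: ne)
        finally show ?thesis .
      qed
      moreover have "(\<Sum>(x,K)\<in>D2. \<bar>measure lborel K * g0 x - (f (Sup K) - f (Inf K))\<bar>) = (\<Sum>(x,K)\<in>D2. \<bar>f (Sup K) - f (Inf K)\<bar>)"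
        by (rule sum.cong) (auto simp: D2_def g0_def)
      ultimately have S2: "(\<Sum>(x,K)\<in>D2. \<bar>measure lborel K * g0 x - (f (Sup K) - f (Inf K))\<bar>) < e / 2" by simp
      have "(\<Sum>(x,K)\<in>\<D>. measure lborel K *\<^sub>R g0 x) - (f b - f a) = (\<Sum>(x,K)\<in>\<D>. measure lborel K * g0 x - (f (Sup K) - f (Inf K)))"
        by (simp add: sum_subtractf case_prod_beta flip: additive_tagged_division_1[OF \<open>a \<le> b\<close> D, of f])
      then have "norm ((\<Sum>(x,K)\<in>\<D>. measure lborel K *\<^sub>R g0 x) - (f b - f a)) \<le> (\<Sum>(x,K)\<in>\<D>. \<bar>measure lborel K * g0 x - (f (Sup K) - f (Inf K))\<bar>)"
        by (simp add: case_prod_beta)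
      also have "\<dots> < e / 2 + e / 2"
        using S1 S2 fin12 split by (simp add: sum.union_disjoint)
      finally show "norm ((\<Sum>(x,K)\<in>\<D>. measure lborel K *\<^sub>R g0 x) - (f b - f a)) < e" by simp
    qed
  qed
  then show ?thesis
    by (rule has_integral_spike[OF N, rotated]) (auto simp: g0_def)
qed

text \<open>The form used for dissipation inequalities, where \<open>f\<close> is an energy and \<open>h\<close> a bound on its rate of
  change; the derivative \<open>g\<close> is integrable by the theorem itself.\<close>

lemma abs_continuous_increment_le:
  fixes f g h :: "real \<Rightarrow> real"
  assumes "a \<le> b" and "abs_continuous_on {a..b} f" and N: "negligible N"
    and "\<And>x. x \<in> {a..b} - N \<Longrightarrow> (f has_real_derivative g x) (at x within {a..b})"
    and le: "\<And>x. x \<in> {a..b} - N \<Longrightarrow> g x \<le> h x" and h: "h integrable_on {a..b}"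
  shows "f b - f a \<le> integral {a..b} h"
proof -
  have "(g has_integral (f b - f a)) {a..b}"
    using assms by (intro fundamental_theorem_of_calculus_abs_continuous)
  then have "((\<lambda>x. if x \<in> N then h x else g x) has_integral (f b - f a)) {a..b}"
    by (rule has_integral_spike[OF N, rotated]) auto
  then show ?thesis
    by (rule has_integral_le[OF _ integrable_integral[OF h]]) (use le in auto)
qed

lemma integral_diff_real:
  fixes h :: "real \<Rightarrow> real"
  assumes "h integrable_on {a..b}" "a \<le> x" "x \<le> y" "y \<le> b"
  shows "integral {a..y} h - integral {a..x} h = integral {x..y} h"
proof -
  have "h integrable_on {a..y}" using integrable_subinterval_real[OF assms(1)] assms by auto
  then show ?thesis using Henstock_Kurzweil_Integration.integral_combine[OF assms(2,3), of h] by simp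
qed

text \<open>Absolute continuity of an indefinite integral: up to an error that is small in \<open>L\<^sub>1\<close>, the
  integrand is bounded, and the integral of a bounded function over a set is controlled by the measure
  of the set.\<close>

lemma abs_continuous_on_integral:
  fixes h :: "real \<Rightarrow> real"
  assumes h: "h absolutely_integrable_on {a..b}"
  shows "abs_continuous_on {a..b} (\<lambda>t. integral {a..t} h)"
  unfolding abs_continuous_on_def
proof (intro allI impI)
  fix \<epsilon> :: real assume "\<epsilon> > 0"
  have hi: "h integrable_on {a..b}" using h set_lebesgue_integral_eq_integral(1) by blast
  have ha: "(\<lambda>x. \<bar>h x\<bar>) absolutely_integrable_on {a..b}"
    using absolutely_integrable_norm[OF h] by (simp add: comp_def)
  have ma: "(\<lambda>x. min \<bar>h x\<bar> (real k)) absolutely_integrable_on {a..b}" for k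
    by (intro absolutely_integrable_min_1 ha) (simp add: absolutely_integrable_on_const)
  have hi': "(\<lambda>x. \<bar>h x\<bar>) integrable_on {a..b}" using ha set_lebesgue_integral_eq_integral(1) by blast
  have mi: "(\<lambda>x. min \<bar>h x\<bar> (real k)) integrable_on {a..b}" for k
    using ma set_lebesgue_integral_eq_integral(1) by blast
  have "(\<lambda>k. integral {a..b} (\<lambda>x. min \<bar>h x\<bar> (real k))) \<longlonglongrightarrow> integral {a..b} (\<lambda>x. \<bar>h x\<bar>)"
  proof (rule dominated_convergence(2)[OF mi hi'])
    show "norm (min \<bar>h x\<bar> (real k)) \<le> \<bar>h x\<bar>" for k x by auto
    show "(\<lambda>k. min \<bar>h x\<bar> (real k)) \<longlonglongrightarrow> \<bar>h x\<bar>" for x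
    proof (rule tendsto_eventually)
      obtain k0 where "\<bar>h x\<bar> \<le> real k0" using real_arch_simple by blast
      then show "eventually (\<lambda>k. min \<bar>h x\<bar> (real k) = \<bar>h x\<bar>) sequentially"
        by (intro eventually_sequentiallyI[of k0]) (auto simp: min_def)
    qed
  qed
  then obtain k where k: "\<bar>integral {a..b} (\<lambda>x. min \<bar>h x\<bar> (real k)) - integral {a..b} (\<lambda>x. \<bar>h x\<bar>)\<bar> < \<epsilon> / 2"
    using \<open>\<epsilon> > 0\<close> unfolding LIMSEQ_iff by (metis half_gt_zero order_refl real_norm_def)
  define p where "p = (\<lambda>x. \<bar>h x\<bar> - min \<bar>h x\<bar> (real k))"
  have p: "p integrable_on {a..b}" "\<And>x. 0 \<le> p x" "\<And>x. \<bar>h x\<bar> \<le> p x + real k"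
    unfolding p_def using hi' mi by (auto intro: integrable_diff)
  have pk: "integral {a..b} p < \<epsilon> / 2"
    unfolding p_def Henstock_Kurzweil_Integration.integral_diff[OF hi' mi] using k by linarith
  define \<delta> where "\<delta> = \<epsilon> / (2 * (real k + 1))"
  show "\<exists>\<delta>>0. \<forall>\<D> S. \<D> division_of S \<and> S \<subseteq> {a..b} \<and> (\<Sum>K\<in>\<D>. measure lborel K) < \<delta> \<longrightarrow>
        (\<Sum>K\<in>\<D>. \<bar>integral {a..Sup K} h - integral {a..Inf K} h\<bar>) < \<epsilon>"
  proof (intro exI conjI allI impI)
    show "\<delta> > 0" using \<open>\<epsilon> > 0\<close> by (simp add: \<delta>_def)
    fix \<D> S assume "\<D> division_of S \<and> S \<subseteq> {a..b} \<and> (\<Sum>K\<in>\<D>. measure lborel K) < \<delta>"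
    then have D: "\<D> division_of S" and S: "S \<subseteq> {a..b}" and m: "(\<Sum>K\<in>\<D>. measure lborel K) < \<delta>" by auto
    have pS: "p integrable_on S" by (rule integrable_on_subdivision[OF D p(1) S])
    have "\<bar>integral {a..Sup K} h - integral {a..Inf K} h\<bar> \<le> integral K p + real k * measure lborel K"
      if K: "K \<in> \<D>" for K
    proof -
      obtain u v where uv: "K = cbox u v" "K \<noteq> {}" "K \<subseteq> S" using division_ofD(2-4)[OF D K] by metis
      then have K': "K = {u..v}" "u \<le> v" by auto
      moreover have "{u..v} \<subseteq> {a..b}" using S uv K'(1) by (metis subset_trans)
      ultimately have uv': "K = {u..v}" "u \<le> v" "a \<le> u" "v \<le> b" "{u..v} \<subseteq> {a..b}"
        unfolding atLeastatMost_subset_iff by auto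
      have "\<bar>integral {a..Sup K} h - integral {a..Inf K} h\<bar> = norm (integral {u..v} h)"
        using uv' integral_diff_real[OF hi uv'(3,2,4)] by simp
      also have "\<dots> \<le> integral {u..v} (\<lambda>x. p x + real k)"
        using uv' p by (intro integral_norm_bound_integral integrable_add)
          (auto intro: integrable_subinterval_real[OF hi] integrable_subinterval_real[OF p(1)])
      also have "\<dots> = integral {u..v} p + integral {u..v} (\<lambda>x. real k)"
        using uv' by (intro integral_add) (auto intro: integrable_subinterval_real[OF p(1)])
      finally show ?thesis using uv' by (simp add: mult.commute)
    qed
    then have "(\<Sum>K\<in>\<D>. \<bar>integral {a..Sup K} h - integral {a..Inf K} h\<bar>)
      \<le> (\<Sum>K\<in>\<D>. integral K p + real k * measure lborel K)" by (rule sum_mono)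
    also have "\<dots> = integral S p + real k * (\<Sum>K\<in>\<D>. measure lborel K)"
      using integral_combine_division_topdown[OF pS D] by (simp add: sum.distrib sum_distrib_left)
    also have "\<dots> \<le> integral {a..b} p + real k * \<delta>"
      using m p pS S by (intro add_mono mult_left_mono integral_subset_le) auto
    also have "real k * \<delta> \<le> \<epsilon> / 2" using \<open>\<epsilon> > 0\<close> by (simp add: \<delta>_def field_simps)
    finally show "(\<Sum>K\<in>\<D>. \<bar>integral {a..Sup K} h - integral {a..Inf K} h\<bar>) < \<epsilon>" using pk by simp
  qed
qed

text \<open>Lebesgue differentiation in the form \<open>integrable_ccontinuous_explicit\<close> concerns averages over cubes
  with the point in a corner, on the real line the derivative from the right; applied to the reflected
  function it gives the derivative from the left.\<close>

lemma integral_has_real_derivative_ae: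
  fixes h :: "real \<Rightarrow> real"
  assumes h: "\<And>T. T \<ge> 0 \<Longrightarrow> h integrable_on {0..T}"
  obtains N where "negligible N"
    "\<And>t. t \<ge> 0 \<Longrightarrow> t \<notin> N \<Longrightarrow> ((\<lambda>t. integral {0..t} h) has_real_derivative h t) (at t within {0..})"
proof -
  define g where "g = (\<lambda>t. if t \<in> {0..} then h t else 0)"
  have g: "g integrable_on cbox a b" for a b
  proof -
    have "(\<lambda>t. if t \<in> {0..} then h t else 0) integrable_on {a..b} \<longleftrightarrow> h integrable_on {a..b} \<inter> {0..}"
      by (simp only: integrable_restrict_Int Int_commute)
    moreover have "{a..b} \<inter> {0..} = {max a 0..b}" by auto
    moreover have "h integrable_on {max a 0..b}"
      using integrable_subinterval_real[OF h[of "max b 0"], of "max a 0" b] by auto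
    ultimately show ?thesis by (simp add: g_def cbox_interval)
  qed
  have g': "(\<lambda>t. g (- t)) integrable_on cbox a b" for a b
    using g[of "-b" "-a"] Henstock_Kurzweil_Integration.integrable_reflect_real[where f=g and a="-b" and b="-a"] by (simp add: cbox_interval)
  obtain N1 where N1: "negligible N1" "\<And>x e. x \<notin> N1 \<Longrightarrow> 0 < e \<Longrightarrow> \<exists>d>0. \<forall>r. 0 < r \<and> r < d \<longrightarrow>
      \<bar>integral {x..x + r} g / r - g x\<bar> < e"
    using integrable_ccontinuous_explicit[OF g] by (simp add: cbox_interval divide_inverse mult.commute) metis
  obtain N2 where N2: "negligible N2" "\<And>x e. x \<notin> N2 \<Longrightarrow> 0 < e \<Longrightarrow> \<exists>d>0. \<forall>r. 0 < r \<and> r < d \<longrightarrow>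
      \<bar>integral {x..x + r} (\<lambda>t. g (- t)) / r - g (- x)\<bar> < e"
    using integrable_ccontinuous_explicit[OF g'] by (simp add: cbox_interval divide_inverse mult.commute) metis
  define N where "N = N1 \<union> uminus ` N2 \<union> {0}"
  have "negligible (uminus ` N2)"
    using N2(1) by (intro negligible_differentiable_image_negligible) (auto intro: derivative_intros)
  then have N: "negligible N" using N1(1) by (simp add: N_def negligible_Un_eq)
  have "((\<lambda>t. integral {0..t} h) has_real_derivative h x) (at x within {0..})" if x: "x \<ge> 0" "x \<notin> N" for x
  proof -
    have x0: "x > 0" "x \<notin> N1" "- x \<notin> N2" using x by (force simp: N_def)+
    have diff: "integral {0..t} h - integral {0..s} h = integral {s..t} g" if "0 \<le> s" "s \<le> t" for s t
    proof -
      have "integral {s..t} h = integral {s..t} g" by (rule integral_cong) (use that in \<open>auto simp: g_def\<close>)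
      then show ?thesis using integral_diff_real[OF h[of t] that(1,2)] that by simp
    qed
    show ?thesis
      unfolding has_field_derivative_iff Lim_within
    proof (intro allI impI)
      fix e :: real assume "e > 0"
      obtain d1 where d1: "d1 > 0" "\<And>r. 0 < r \<Longrightarrow> r < d1 \<Longrightarrow> \<bar>integral {x..x + r} g / r - g x\<bar> < e"
        using N1(2)[OF x0(2) \<open>e > 0\<close>] by auto
      obtain d2 where d2: "d2 > 0" "\<And>r. 0 < r \<Longrightarrow> r < d2 \<Longrightarrow> \<bar>integral {-x..-x + r} (\<lambda>t. g (- t)) / r - g x\<bar> < e"
        using N2(2)[OF x0(3) \<open>e > 0\<close>] by auto
      have "dist ((integral {0..y} h - integral {0..x} h) / (y - x)) (h x) < e"
        if y: "y \<ge> 0" "0 < dist y x" "dist y x < min d1 d2" for y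
      proof (cases "y > x")
        case True
        then show ?thesis using d1(2)[of "y - x"] diff[of x y] x y by (auto simp: dist_real_def g_def)
      next
        case False
        then have "y < x" using y by auto
        moreover have "integral {-x..-y} (\<lambda>t. g (- t)) = integral {y..x} g" by (rule Henstock_Kurzweil_Integration.integral_reflect_real)
        moreover have "(integral {0..y} h - integral {0..x} h) / (y - x) = (integral {0..x} h - integral {0..y} h) / (x - y)"
          using \<open>y < x\<close> by (simp add: divide_simps) (simp add: algebra_simps)
        ultimately show ?thesis using d2(2)[of "x - y"] diff[of y x] x y by (auto simp: dist_real_def g_def)
      qed
      then show "\<exists>d>0. \<forall>y\<in>{0..}. 0 < dist y x \<and> dist y x < d \<longrightarrow>
          dist ((integral {0..y} h - integral {0..x} h) / (y - x)) (h x) < e"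
        using d1(1) d2(1) by (intro exI[of _ "min d1 d2"]) auto
    qed
  qed
  then show ?thesis using that[OF N] by blast
qed

section \<open>Linear differential equations with measurable coefficients\<close>

text \<open>The terms of the Picard series of the linear differential equation
  \<open>x' = M x + f\<close>, \<open>x 0 = 0\<close>; the partial sums of the series are the Picard iterates.\<close>

primrec picard_term :: "nat \<Rightarrow> (real \<Rightarrow> nat \<Rightarrow> nat \<Rightarrow> real) \<Rightarrow> (real \<Rightarrow> nat \<Rightarrow> real) \<Rightarrow>
    nat \<Rightarrow> nat \<Rightarrow> real \<Rightarrow> real" where
  "picard_term n M f 0 = (\<lambda>i t. integral {0..t} (\<lambda>s. f s i))"
| "picard_term n M f (Suc k) = (\<lambda>i t. integral {0..t} (\<lambda>s. \<Sum>j<n. M s i j * picard_term n M f k j s))"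

text \<open>Each Picard term is bounded by a multiple of \<open>2 powi (-k) * exp (2 c t)\<close>, where \<open>c\<close> bounds the
  coefficient matrix: the exponential weight turns the integral operator into a contraction on every
  compact interval. The sum of the series therefore solves the integral equation, and differentiating
  an indefinite integral almost everywhere gives the differential equation.\<close>

lemma linear_ode_solution_exists:
  fixes M :: "real \<Rightarrow> nat \<Rightarrow> nat \<Rightarrow> real" and f :: "real \<Rightarrow> nat \<Rightarrow> real"
  assumes M: "\<And>i j T. i < n \<Longrightarrow> j < n \<Longrightarrow> (\<lambda>t. M t i j) \<in> borel_measurable (lebesgue_on {0..T})"
    and L: "\<And>i j t. i < n \<Longrightarrow> j < n \<Longrightarrow> t \<ge> 0 \<Longrightarrow> \<bar>M t i j\<bar> \<le> L"
    and f: "\<And>i T. i < n \<Longrightarrow> (\<lambda>t. f t i) absolutely_integrable_on {0..T}"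
  obtains x N where "\<And>i. x i 0 = 0"
    "\<And>i T. i < n \<Longrightarrow> abs_continuous_on {0..T} (x i)"
    "negligible N"
    "\<And>i t. i < n \<Longrightarrow> t \<ge> 0 \<Longrightarrow> t \<notin> N \<Longrightarrow>
       (x i has_real_derivative (\<Sum>j<n. M t i j * x j t) + f t i) (at t within {0..})"
proof -
  define d where "d = picard_term n M f"
  define c where "c = real n * \<bar>L\<bar> + 1"
  \<comment> \<open>The summand 1 keeps the exponent of the weight positive when \<open>n = 0\<close> or \<open>L = 0\<close>.\<close>
  have c: "c > 0" by (simp add: c_def add_nonneg_pos)
  have d0: "d 0 i t = integral {0..t} (\<lambda>s. f s i)" for i t by (simp add: d_def)
  have dSuc: "d (Suc k) i t = integral {0..t} (\<lambda>s. \<Sum>j<n. M s i j * d k j s)" for k i t by (simp add: d_def)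
  have Mint: "(\<lambda>s. \<Sum>j<n. M s i j * y j s) absolutely_integrable_on {0..T}"
    if "i < n" and y: "\<And>j. j < n \<Longrightarrow> continuous_on {0..T} (y j)" for y :: "nat \<Rightarrow> real \<Rightarrow> real" and i T
  proof (intro absolutely_integrable_sum)
    fix j assume "j \<in> {..<n}"
    then have j: "j < n" by simp
    show "(\<lambda>s. M s i j * y j s) absolutely_integrable_on {0..T}"
    proof (rule absolutely_integrable_bounded_measurable_product_real)
      show "(\<lambda>t. M t i j) \<in> borel_measurable (lebesgue_on {0..T})" using M \<open>i < n\<close> j by blast
      show "bounded ((\<lambda>t. M t i j) ` {0..T})"
        unfolding bounded_iff by (rule exI[of _ L]) (use L \<open>i < n\<close> j in auto)
      show "y j absolutely_integrable_on {0..T}"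
        by (rule absolutely_integrable_continuous_real[OF y[OF j]])
    qed auto
  qed auto
  have fint: "(\<lambda>t. f t i) integrable_on {0..T}" if "i < n" for i T
    using f[OF that] set_lebesgue_integral_eq_integral(1) by blast
  have dcont: "i < n \<Longrightarrow> continuous_on {0..T} (d k i)" for i k T
  proof (induction k arbitrary: i)
    case 0
    then show ?case unfolding d0 by (intro indefinite_integral_continuous_1 fint)
  next
    case (Suc k)
    then show ?case unfolding dSuc
      by (intro indefinite_integral_continuous_1 set_lebesgue_integral_eq_integral(1) Mint)
  qed
  have Mbound: "\<bar>\<Sum>j<n. M s i j * y j\<bar> \<le> c * B"
    if "i < n" "s \<ge> 0" "\<And>j. j < n \<Longrightarrow> \<bar>y j\<bar> \<le> B" "B \<ge> 0" for i s y B
  proof -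
    have "\<bar>\<Sum>j<n. M s i j * y j\<bar> \<le> (\<Sum>j<n. \<bar>M s i j * y j\<bar>)" by (rule sum_abs)
    also have "\<dots> \<le> (\<Sum>j<n. \<bar>L\<bar> * B)"
    proof (rule sum_mono)
      fix j assume "j \<in> {..<n}"
      then have "\<bar>M s i j\<bar> \<le> \<bar>L\<bar>" "\<bar>y j\<bar> \<le> B" using L[of i j s] that by auto
      then show "\<bar>M s i j * y j\<bar> \<le> \<bar>L\<bar> * B" unfolding abs_mult by (intro mult_mono) auto
    qed
    also have "\<dots> \<le> c * B" using that(4) by (simp add: c_def algebra_simps)
    finally show ?thesis .
  qed
  have bound: "\<exists>C\<ge>0. \<forall>i<n. \<forall>k. \<forall>t\<in>{0..T}. \<bar>d k i t\<bar> \<le> C * (1/2)^k" if "T \<ge> 0" for T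
  proof -
    have "\<exists>B. \<forall>t\<in>{0..T}. \<bar>d 0 i t\<bar> \<le> B" if "i < n" for i
      using compact_imp_bounded[OF compact_continuous_image[OF dcont[OF that] compact_Icc]]
      unfolding bounded_iff by (metis image_eqI real_norm_def)
    then obtain B where B: "\<And>i t. i < n \<Longrightarrow> t \<in> {0..T} \<Longrightarrow> \<bar>d 0 i t\<bar> \<le> B i" by metis
    define C where "C = (\<Sum>i<n. \<bar>B i\<bar>)"
    have C: "C \<ge> 0" "\<bar>d 0 i t\<bar> \<le> C" if "i < n" "t \<in> {0..T}" for i t
    proof -
      show "C \<ge> 0" by (simp add: C_def sum_nonneg)
      have "\<bar>B i\<bar> \<le> C" unfolding C_def using that by (intro member_le_sum) auto
      then show "\<bar>d 0 i t\<bar> \<le> C" using B[OF that] by linarith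
    qed
    have C0: "C \<ge> 0" by (simp add: C_def sum_nonneg)
    have step: "i < n \<Longrightarrow> t \<in> {0..T} \<Longrightarrow> \<bar>d k i t\<bar> \<le> C * (1/2)^k * exp (2 * c * t)" for i k t
    proof (induction k arbitrary: i t)
      case 0
      have "1 \<le> exp (2 * c * t)" using c 0 by simp
      then have "C * 1 \<le> C * exp (2 * c * t)" using C0 by (intro mult_left_mono)
      then show ?case using C(2)[OF 0] by simp
    next
      case (Suc k)
      let ?E = "\<lambda>s. c * (C * (1/2)^k * exp (2 * c * s))"
      have E: "(?E has_integral (C * (1/2)^Suc k * exp (2 * c * t) - C * (1/2)^Suc k * exp (2 * c * 0))) {0..t}"
        using Suc.prems
        by (intro fundamental_theorem_of_calculus)
           (auto intro!: derivative_eq_intros simp flip: has_real_derivative_iff_has_vector_derivative)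
      have "\<bar>d (Suc k) i t\<bar> = norm (integral {0..t} (\<lambda>s. \<Sum>j<n. M s i j * d k j s))" by (simp add: dSuc)
      also have "\<dots> \<le> integral {0..t} ?E"
      proof (rule integral_norm_bound_integral)
        show "(\<lambda>s. \<Sum>j<n. M s i j * d k j s) integrable_on {0..t}"
          using Suc.prems by (intro set_lebesgue_integral_eq_integral(1) Mint dcont) auto
        show "?E integrable_on {0..t}" using E by blast
        show "norm (\<Sum>j<n. M s i j * d k j s) \<le> ?E s" if "s \<in> {0..t}" for s
          unfolding real_norm_def using that Suc C0 by (intro Mbound) auto
      qed
      also have "\<dots> = C * (1/2)^Suc k * exp (2 * c * t) - C * (1/2)^Suc k" unfolding integral_unique[OF E] by simp
      also have "\<dots> \<le> C * (1/2)^Suc k * exp (2 * c * t)" using C0 by simp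
      finally show ?case .
    qed
    have "\<bar>d k i t\<bar> \<le> C * exp (2 * c * T) * (1/2)^k" if "i < n" "t \<in> {0..T}" for i k t
    proof -
      have "C * (1/2)^k * exp (2 * c * t) \<le> C * (1/2)^k * exp (2 * c * T)"
        using that c C0 by (intro mult_left_mono) auto
      then show ?thesis using step[OF that, of k] by (simp add: mult_ac)
    qed
    then show ?thesis using C0 by (intro exI[of _ "C * exp (2 * c * T)"]) auto
  qed
  define x where "x = (\<lambda>i t. \<Sum>k. d k i t)"
  define h where "h = (\<lambda>i s. \<Sum>j<n. M s i j * x j s)"
  have key: "h i absolutely_integrable_on {0..T}" "x i T = integral {0..T} (\<lambda>s. h i s + f s i)"
    if i: "i < n" and T: "T \<ge> 0" for i T
  proof -
    obtain C where C: "C \<ge> 0" "\<And>i k t. i < n \<Longrightarrow> t \<in> {0..T} \<Longrightarrow> \<bar>d k i t\<bar> \<le> C * (1/2)^k"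
      using bound[OF T] by blast
    have geo: "summable (\<lambda>k. C * (1/2::real)^k)" "(\<Sum>k. C * (1/2::real)^k) = 2 * C"
      by (simp_all add: summable_geometric suminf_mult suminf_geometric)
    have summ: "summable (\<lambda>k. d k j t)" if "j < n" "t \<in> {0..T}" for j t
      by (rule summable_comparison_test'[OF geo(1), of 0]) (use C(2) that in auto)
    have part: "\<bar>\<Sum>k<m. d k j t\<bar> \<le> 2 * C" if "j < n" "t \<in> {0..T}" for j t m
    proof -
      have "\<bar>\<Sum>k<m. d k j t\<bar> \<le> (\<Sum>k<m. C * (1/2)^k)"
        by (rule order_trans[OF sum_abs sum_mono]) (use C(2) that in auto)
      also have "\<dots> \<le> (\<Sum>k. C * (1/2)^k)" by (rule sum_le_suminf[OF geo(1)]) (use C(1) in auto)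
      finally show ?thesis using geo(2) by simp
    qed
    have lim: "(\<lambda>m. \<Sum>k<m. d k j t) \<longlonglongrightarrow> x j t" if "j < n" "t \<in> {0..T}" for j t
      using summable_LIMSEQ[OF summ[OF that]] by (simp add: x_def)
    let ?S = "\<lambda>m s. \<Sum>j<n. M s i j * (\<Sum>k<m. d k j s)"
    have Sint: "?S m integrable_on {0..T}" for m
      using i by (intro set_lebesgue_integral_eq_integral(1) Mint continuous_on_sum dcont) auto
    have Sb: "norm (?S m s) \<le> c * (2 * C)" if "s \<in> {0..T}" for m s
      unfolding real_norm_def using i that C(1) part by (intro Mbound) auto
    have Slim: "(\<lambda>m. ?S m s) \<longlonglongrightarrow> h i s" if "s \<in> {0..T}" for s
      unfolding h_def using that by (intro tendsto_sum tendsto_mult_left lim) auto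
    note dc = dominated_convergence[OF Sint integrable_const_ivl Sb Slim]
    have hb: "norm (h i s) \<le> c * (2 * C)" if "s \<in> {0..T}" for s
      using Lim_bounded[OF tendsto_norm[OF Slim[OF that]], of 0 "c * (2 * C)"] Sb[OF that] by auto
    show "h i absolutely_integrable_on {0..T}"
      by (rule absolutely_integrable_integrable_bound[OF hb dc(1) integrable_const_ivl])
    have "(\<lambda>m. integral {0..T} (?S m)) = (\<lambda>m. \<Sum>k<m. d (Suc k) i T)"
    proof
      fix m
      have "?S m = (\<lambda>s. \<Sum>k<m. \<Sum>j<n. M s i j * d k j s)"
        by (subst sum.swap) (simp add: sum_distrib_left)
      moreover have "integral {0..T} \<dots> = (\<Sum>k<m. integral {0..T} (\<lambda>s. \<Sum>j<n. M s i j * d k j s))"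
        using i by (intro integral_sum set_lebesgue_integral_eq_integral(1) Mint dcont) auto
      ultimately show "integral {0..T} (?S m) = (\<Sum>k<m. d (Suc k) i T)" by (simp add: dSuc)
    qed
    then have "(\<lambda>k. d (Suc k) i T) sums integral {0..T} (h i)" using dc(2) by (simp add: sums_def)
    then have "(\<lambda>k. d k i T) sums (integral {0..T} (h i) + d 0 i T)" by (rule sums_Suc)
    then have "x i T = integral {0..T} (h i) + integral {0..T} (\<lambda>s. f s i)"
      by (simp add: x_def sums_iff d0)
    then show "x i T = integral {0..T} (\<lambda>s. h i s + f s i)"
      using integral_add[OF dc(1) fint[OF i]] by simp
  qed
  have abs_int: "(\<lambda>s. h i s + f s i) absolutely_integrable_on {0..T}" if "i < n" "T \<ge> 0" for i T
    using key(1)[OF that] f[OF that(1), of T] by (rule set_integral_add(1))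
  have "\<exists>N. negligible N \<and> (\<forall>t\<ge>0. t \<notin> N \<longrightarrow>
      ((\<lambda>t. integral {0..t} (\<lambda>s. h i s + f s i)) has_real_derivative h i t + f t i) (at t within {0..}))"
    if "i < n" for i
    by (rule integral_has_real_derivative_ae[of "\<lambda>s. h i s + f s i"])
       (use abs_int[OF that] set_lebesgue_integral_eq_integral(1) in blast)+
  then obtain N where N: "\<And>i. i < n \<Longrightarrow> negligible (N i)"
    "\<And>i t. i < n \<Longrightarrow> t \<ge> 0 \<Longrightarrow> t \<notin> N i \<Longrightarrow>
      ((\<lambda>t. integral {0..t} (\<lambda>s. h i s + f s i)) has_real_derivative h i t + f t i) (at t within {0..})"
    by metis
  define X where "X = (\<lambda>i t. if i < n then integral {0..t} (\<lambda>s. h i s + f s i) else 0)"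
  have X: "X j t = x j t" if "j < n" "t \<ge> 0" for j t using key(2)[OF that] that by (simp add: X_def)
  show ?thesis
  proof (rule that[of X "\<Union>i<n. N i"])
    show "X i 0 = 0" for i by (simp add: X_def)
    show "negligible (\<Union>i<n. N i)" using N(1) by (intro negligible_Union) auto
    show "abs_continuous_on {0..T} (X i)" if "i < n" for i T
    proof (cases "T \<ge> 0")
      case True
      then show ?thesis using abs_continuous_on_integral[OF abs_int[OF that True]] that by (simp add: X_def)
    next
      case False
      then show ?thesis using abs_continuous_on_const[of "{}"] by (auto simp: abs_continuous_on_def)
    qed
    show "(X i has_real_derivative (\<Sum>j<n. M t i j * X j t) + f t i) (at t within {0..})"
      if "i < n" "t \<ge> 0" "t \<notin> (\<Union>i<n. N i)" for i t
    proof -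
      have "(\<Sum>j<n. M t i j * X j t) = h i t" unfolding h_def using that by (intro sum.cong) (auto simp: X)
      then show ?thesis using N(2)[of i t] that by (simp add: X_def)
    qed
  qed
qed

section \<open>The energy of one truncation step\<close>

definition linear_field :: "nat \<Rightarrow> nat \<Rightarrow> (nat \<Rightarrow> nat \<Rightarrow> real) \<Rightarrow> (nat \<Rightarrow> nat \<Rightarrow> real) \<Rightarrow>
    (nat \<Rightarrow> real) \<Rightarrow> (nat \<Rightarrow> real) \<Rightarrow> nat \<Rightarrow> real" where
  "linear_field n m A B x u i = (\<Sum>j<n. A i j * x j) + (\<Sum>l<m. B i l * u l)"

lemma linear_field_diff:
  "linear_field n m A B (\<lambda>i. x i - y i) (\<lambda>l. u l - v l) i = linear_field n m A B x u i - linear_field n m A B y v i"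
  by (simp add: linear_field_def right_diff_distrib sum_subtractf)

lemma linear_field_add:
  "linear_field n m A B (\<lambda>i. x i + y i) (\<lambda>l. u l + v l) i = linear_field n m A B x u i + linear_field n m A B y v i"
  by (simp add: linear_field_def distrib_left sum.distrib)

text \<open>The Lyapunov function for one truncation step compares a state \<open>x\<close> of the system with \<open>k + 1\<close>
  components with a state \<open>y\<close> of the system with \<open>k\<close> components: the difference is measured by the
  observability grammian and the sum by the inverse of the controllability grammian.\<close>

definition step_energy :: "nat \<Rightarrow> (nat \<Rightarrow> real) \<Rightarrow> nat \<Rightarrow> (nat \<Rightarrow> real) \<Rightarrow> (nat \<Rightarrow> real) \<Rightarrow> real" where
  "step_energy n s k x y = (\<Sum>i<n. s i * (x i - y i)\<^sup>2 + (s k)\<^sup>2 * (x i + y i)\<^sup>2 / s i)"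

definition step_energy_deriv :: "nat \<Rightarrow> (nat \<Rightarrow> real) \<Rightarrow> nat \<Rightarrow> (nat \<Rightarrow> real) \<Rightarrow> (nat \<Rightarrow> real) \<Rightarrow>
    (nat \<Rightarrow> real) \<Rightarrow> (nat \<Rightarrow> real) \<Rightarrow> real" where
  "step_energy_deriv n s k x y x' y' =
     (\<Sum>i<n. 2 * (s i * ((x i - y i) * (x' i - y' i)) + (s k)\<^sup>2 * ((x i + y i) * (x' i + y' i)) / s i))"

definition truncated_field :: "nat \<Rightarrow> (nat \<Rightarrow> real) \<Rightarrow> nat \<Rightarrow> real" where
  "truncated_field k v = (\<lambda>i. if i < k then v i else 0)"

text \<open>Truncation perturbs the dynamics only in component \<open>k\<close>, by the same amount with opposite signs
  for the difference and for the sum. In that component the difference and the sum of the states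
  coincide, because \<open>y k = 0\<close>, and the weights \<open>s k\<close> and \<open>(s k)\<^sup>2 / s k\<close> are equal: the two
  perturbations of the energy cancel.\<close>

lemma step_energy_deriv_le:
  fixes n m :: nat and A B C s u
  defines "F \<equiv> linear_field n m A B"
  assumes s: "\<And>i. i < n \<Longrightarrow> s i > 0" and k: "k < n"
    and obs: "\<And>x. 2 * (\<Sum>i<n. s i * (x i * F x (\<lambda>_. 0) i)) + (\<Sum>l<p. (\<Sum>j<n. C l j * x j)\<^sup>2) \<le> 0"
    and ctr: "\<And>x u. 2 * (\<Sum>i<n. x i * F x u i / s i) \<le> (\<Sum>l<m. (u l)\<^sup>2)"
    and x: "\<And>i. i \<ge> Suc k \<Longrightarrow> i < n \<Longrightarrow> x i = 0" and y: "\<And>i. i \<ge> k \<Longrightarrow> i < n \<Longrightarrow> y i = 0"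
  shows "step_energy_deriv n s k x y (truncated_field (Suc k) (F x u)) (truncated_field k (F y u))
    \<le> - (\<Sum>l<p. (\<Sum>j<n. C l j * (x j - y j))\<^sup>2) + 4 * (s k)\<^sup>2 * (\<Sum>l<m. (u l)\<^sup>2)"
proof -
  let ?z = "\<lambda>i. x i - y i" and ?w = "\<lambda>i. x i + y i"
  have Fz: "F ?z (\<lambda>_. 0) i = F x u i - F y u i" for i
    unfolding F_def using linear_field_diff[of n m A B x y u u i] by simp
  have Fw: "F ?w (\<lambda>l. 2 * u l) i = F x u i + F y u i" for i
    unfolding F_def using linear_field_add[of n m A B x y u u i] by simp
  have split: "(\<Sum>i<n. 2 * (P i + c * Q i)) = 2 * (\<Sum>i<n. P i) + c * (2 * (\<Sum>i<n. Q i))"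
    for P Q :: "nat \<Rightarrow> real" and c
    by (simp add: sum.distrib distrib_left mult.left_commute flip: sum_distrib_left)
  have eq: "s i * (?z i * (truncated_field (Suc k) (F x u) i - truncated_field k (F y u) i))
      + (s k)\<^sup>2 * (?w i * (truncated_field (Suc k) (F x u) i + truncated_field k (F y u) i)) / s i
    = s i * (?z i * F ?z (\<lambda>_. 0) i) + (s k)\<^sup>2 * (?w i * F ?w (\<lambda>l. 2 * u l) i / s i)" if "i < n" for i
  proof -
    consider "i < k" | "i = k" | "i > k" by linarith
    then show ?thesis
    proof cases
      case 1
      then show ?thesis by (simp add: Fz Fw truncated_field_def)
    next
      case 2
      then show ?thesis unfolding Fz Fw using y[of k] s[OF k] k
        by (simp add: truncated_field_def power2_eq_square field_simps)
    next
      case 3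
      then show ?thesis using x[of i] y[of i] that by (simp add: truncated_field_def)
    qed
  qed
  have "step_energy_deriv n s k x y (truncated_field (Suc k) (F x u)) (truncated_field k (F y u))
    = (\<Sum>i<n. 2 * (s i * (?z i * F ?z (\<lambda>_. 0) i) + (s k)\<^sup>2 * (?w i * F ?w (\<lambda>l. 2 * u l) i / s i)))"
    unfolding step_energy_deriv_def using eq by (intro sum.cong) auto
  also have "\<dots> = 2 * (\<Sum>i<n. s i * (?z i * F ?z (\<lambda>_. 0) i))
      + (s k)\<^sup>2 * (2 * (\<Sum>i<n. ?w i * F ?w (\<lambda>l. 2 * u l) i / s i))"
    by (rule split)
  also have "\<dots> \<le> - (\<Sum>l<p. (\<Sum>j<n. C l j * ?z j)\<^sup>2) + (s k)\<^sup>2 * (\<Sum>l<m. (2 * u l)\<^sup>2)"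
    using obs[of ?z] by (intro add_mono mult_left_mono ctr) auto
  also have "(\<Sum>l<m. (2 * u l)\<^sup>2) = 4 * (\<Sum>l<m. (u l)\<^sup>2)"
    by (simp add: sum_distrib_left power_mult_distrib)
  finally show ?thesis by (simp add: mult_ac)
qed

text \<open>In discrete time the perturbation contributes in component \<open>k\<close> through the parallelogram
  identity, which makes the new energy at most the energy without truncation.\<close>

lemma step_energy_next_le:
  fixes n m :: nat and A B C s u
  defines "F \<equiv> linear_field n m A B"
  assumes s: "\<And>i. i < n \<Longrightarrow> s i > 0" and k: "k < n"
    and obs: "\<And>x. (\<Sum>i<n. s i * (F x (\<lambda>_. 0) i)\<^sup>2) + (\<Sum>l<p. (\<Sum>j<n. C l j * x j)\<^sup>2) \<le> (\<Sum>i<n. s i * (x i)\<^sup>2)"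
    and ctr: "\<And>x u. (\<Sum>i<n. (F x u i)\<^sup>2 / s i) \<le> (\<Sum>i<n. (x i)\<^sup>2 / s i) + (\<Sum>l<m. (u l)\<^sup>2)"
  shows "step_energy n s k (truncated_field (Suc k) (F x u)) (truncated_field k (F y u)) - step_energy n s k x y
    \<le> - (\<Sum>l<p. (\<Sum>j<n. C l j * (x j - y j))\<^sup>2) + 4 * (s k)\<^sup>2 * (\<Sum>l<m. (u l)\<^sup>2)"
proof -
  let ?z = "\<lambda>i. x i - y i" and ?w = "\<lambda>i. x i + y i"
  let ?x' = "truncated_field (Suc k) (F x u)" and ?y' = "truncated_field k (F y u)"
  have Fz: "F ?z (\<lambda>_. 0) i = F x u i - F y u i" for i
    unfolding F_def using linear_field_diff[of n m A B x y u u i] by simp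
  have Fw: "F ?w (\<lambda>l. 2 * u l) i = F x u i + F y u i" for i
    unfolding F_def using linear_field_add[of n m A B x y u u i] by simp
  have le: "s i * (?x' i - ?y' i)\<^sup>2 + (s k)\<^sup>2 * (?x' i + ?y' i)\<^sup>2 / s i
    \<le> s i * (F ?z (\<lambda>_. 0) i)\<^sup>2 + (s k)\<^sup>2 * ((F ?w (\<lambda>l. 2 * u l) i)\<^sup>2 / s i)" if "i < n" for i
  proof -
    consider "i < k" | "i = k" | "i > k" by linarith
    then show ?thesis
    proof cases
      case 1
      then show ?thesis by (simp add: Fz Fw truncated_field_def)
    next
      case 2
      let ?c = "F x u k" and ?a = "F y u k"
      have "s k * ?c\<^sup>2 + s k * ?c\<^sup>2 \<le> s k * (?c - ?a)\<^sup>2 + s k * (?c + ?a)\<^sup>2"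
        using s[OF k] by (simp add: power2_eq_square algebra_simps)
      then show ?thesis using 2 s[OF k] by (simp add: Fz Fw truncated_field_def power2_eq_square)
    next
      case 3
      then show ?thesis using s[OF that] by (simp add: truncated_field_def)
    qed
  qed
  have "step_energy n s k ?x' ?y'
    \<le> (\<Sum>i<n. s i * (F ?z (\<lambda>_. 0) i)\<^sup>2 + (s k)\<^sup>2 * ((F ?w (\<lambda>l. 2 * u l) i)\<^sup>2 / s i))"
    unfolding step_energy_def by (intro sum_mono le) auto
  also have "\<dots> = (\<Sum>i<n. s i * (F ?z (\<lambda>_. 0) i)\<^sup>2) + (s k)\<^sup>2 * (\<Sum>i<n. (F ?w (\<lambda>l. 2 * u l) i)\<^sup>2 / s i)"
    by (simp add: sum.distrib sum_distrib_left)
  also have "\<dots> \<le> ((\<Sum>i<n. s i * (?z i)\<^sup>2) - (\<Sum>l<p. (\<Sum>j<n. C l j * ?z j)\<^sup>2))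
      + (s k)\<^sup>2 * ((\<Sum>i<n. (?w i)\<^sup>2 / s i) + (\<Sum>l<m. (2 * u l)\<^sup>2))"
    using obs[of ?z] by (intro add_mono mult_left_mono ctr) auto
  also have "(\<Sum>l<m. (2 * u l)\<^sup>2) = 4 * (\<Sum>l<m. (u l)\<^sup>2)"
    by (simp add: sum_distrib_left power_mult_distrib)
  finally show ?thesis
    unfolding step_energy_def by (simp add: sum.distrib sum_distrib_left algebra_simps)
qed

text \<open>The errors of the single steps are added with the weights \<open>1 / s k\<close>. By the Cauchy-Schwarz
  inequality this dissipates the square of the total error, with the sum of the gains \<open>2 s k\<close> as
  gain.\<close>

lemma weighted_sum_of_steps_le:
  fixes s :: "nat \<Rightarrow> real" and D :: "nat \<Rightarrow> real" and a :: "nat \<Rightarrow> nat \<Rightarrow> real"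
  assumes J: "finite J" and s: "\<And>k. k \<in> J \<Longrightarrow> s k > 0"
    and D: "\<And>k. k \<in> J \<Longrightarrow> D k \<le> - (\<Sum>l<p. (a k l)\<^sup>2) + 4 * (s k)\<^sup>2 * U"
  shows "(\<Sum>k\<in>J. sum s J / s k * D k) \<le> - (\<Sum>l<p. (\<Sum>k\<in>J. a k l)\<^sup>2) + (2 * sum s J)\<^sup>2 * U"
proof -
  have S: "sum s J \<ge> 0" using s by (intro sum_nonneg) (simp add: less_imp_le)
  have cs: "(\<Sum>k\<in>J. a k l)\<^sup>2 \<le> sum s J * (\<Sum>k\<in>J. (a k l)\<^sup>2 / s k)" for l
  proof -
    have "(\<Sum>k\<in>J. a k l)\<^sup>2 = (\<Sum>k\<in>J. sqrt (s k) * (a k l / sqrt (s k)))\<^sup>2"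
    proof -
      have "a k l = sqrt (s k) * (a k l / sqrt (s k))" if "k \<in> J" for k using s[OF that] by simp
      then show ?thesis by (metis (no_types, lifting) sum.cong)
    qed
    also have "\<dots> \<le> (\<Sum>k\<in>J. (sqrt (s k))\<^sup>2) * (\<Sum>k\<in>J. (a k l / sqrt (s k))\<^sup>2)"
      by (rule Cauchy_Schwarz_ineq_sum)
    also have "\<dots> = sum s J * (\<Sum>k\<in>J. (a k l)\<^sup>2 / s k)"
      using s by (intro arg_cong2[of _ _ _ _ "(*)"] sum.cong) (auto simp: power_divide less_imp_le)
    finally show ?thesis .
  qed
  have "(\<Sum>k\<in>J. sum s J / s k * D k) \<le> (\<Sum>k\<in>J. sum s J / s k * (- (\<Sum>l<p. (a k l)\<^sup>2) + 4 * (s k)\<^sup>2 * U))"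
    using S s D by (intro sum_mono mult_left_mono) (auto simp: less_imp_le)
  also have "\<dots> = (\<Sum>k\<in>J. - (sum s J * ((\<Sum>l<p. (a k l)\<^sup>2) / s k)) + 4 * sum s J * U * s k)"
  proof (rule sum.cong[OF refl])
    fix k assume "k \<in> J"
    then have "s k \<noteq> 0" using s by force
    then show "sum s J / s k * (- (\<Sum>l<p. (a k l)\<^sup>2) + 4 * (s k)\<^sup>2 * U)
        = - (sum s J * ((\<Sum>l<p. (a k l)\<^sup>2) / s k)) + 4 * sum s J * U * s k"
      by (simp add: field_simps power2_eq_square)
  qed
  also have "\<dots> = - (\<Sum>k\<in>J. sum s J * ((\<Sum>l<p. (a k l)\<^sup>2) / s k)) + 4 * sum s J * U * sum s J"
    by (simp only: sum.distrib sum_negf sum_distrib_left)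
  also have "(\<Sum>k\<in>J. sum s J * ((\<Sum>l<p. (a k l)\<^sup>2) / s k)) = (\<Sum>l<p. sum s J * (\<Sum>k\<in>J. (a k l)\<^sup>2 / s k))"
    unfolding sum_divide_distrib sum_distrib_left by (rule sum.swap)
  also have "- \<dots> \<le> - (\<Sum>l<p. (\<Sum>k\<in>J. a k l)\<^sup>2)"
    using cs by (intro le_imp_neg_le sum_mono)
  finally show ?thesis by (simp add: power2_eq_square mult_ac)
qed

lemma weighted_sum_of_telescoping_steps_le:
  fixes s :: "nat \<Rightarrow> real" and D :: "nat \<Rightarrow> real" and X :: "nat \<Rightarrow> nat \<Rightarrow> real" and p :: nat
  assumes "r \<le> n" and s: "\<And>k. k < n \<Longrightarrow> s k > 0"
    and D: "\<And>k. r \<le> k \<Longrightarrow> k < n \<Longrightarrow> D k \<le> - (\<Sum>l<p. (\<Sum>j<n. C l j * (X (Suc k) j - X k j))\<^sup>2) + 4 * (s k)\<^sup>2 * U"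
  shows "(\<Sum>k=r..<n. (\<Sum>k=r..<n. s k) / s k * D k)
    \<le> - (\<Sum>l<p. ((\<Sum>j<n. C l j * X n j) - (\<Sum>j<n. C l j * X r j))\<^sup>2) + (2 * (\<Sum>k=r..<n. s k))\<^sup>2 * U"
proof -
  have tel: "(\<Sum>k=r..<n. \<Sum>j<n. C l j * (X (Suc k) j - X k j)) = (\<Sum>j<n. C l j * X n j) - (\<Sum>j<n. C l j * X r j)" for l
    using sum_Suc_diff'[OF \<open>r \<le> n\<close>, of "\<lambda>k. \<Sum>j<n. C l j * X k j"]
    by (simp add: right_diff_distrib sum_subtractf)
  show ?thesis
    using weighted_sum_of_steps_le[where J = "{r..<n}" and s = s and D = D and p = p and U = U
      and a = "\<lambda>k l. \<Sum>j<n. C l j * (X (Suc k) j - X k j)"] s D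
    by (simp add: tel)
qed

section \<open>Grammians in balanced coordinates\<close>

lemma scalar_prod_self_eq_sum:
  fixes v :: "real Matrix.vec"
  assumes "v \<in> carrier_vec n"
  shows "v \<bullet> v = (\<Sum>i<n. (v $ i)\<^sup>2)"
  using assms by (auto simp: scalar_prod_def power2_eq_square atLeast0LessThan intro!: sum.cong)

lemma mult_mat_vec_index_eq_sum:
  fixes M :: "real mat"
  assumes "M \<in> carrier_mat k n" "i < k"
  shows "(M *\<^sub>v Matrix.vec n x) $ i = (\<Sum>j<n. M $$ (i, j) * x j)"
  using assms by (auto simp: scalar_prod_def atLeast0LessThan intro!: sum.cong)

lemma mat_diag_mult_vec_index:
  fixes v :: "real Matrix.vec"
  assumes "v \<in> carrier_vec n" "i < n"
  shows "(mat_diag n f *\<^sub>v v) $ i = f i * v $ i"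
proof -
  have "(mat_diag n f *\<^sub>v v) $ i = (\<Sum>j\<in>{0..<n}. (if i = j then f j else 0) * v $ j)"
    using assms by (auto simp: mat_diag_def scalar_prod_def intro!: sum.cong)
  also have "\<dots> = (\<Sum>j\<in>{0..<n}. if i = j then f i * v $ i else 0)" by (rule sum.cong) auto
  also have "\<dots> = f i * v $ i" using assms by simp
  finally show ?thesis .
qed

lemma inverts_mat_carrier:
  assumes "inverts_mat A B" "inverts_mat B A" "A \<in> carrier_mat n n"
  shows "B \<in> carrier_mat n n" "A * B = 1\<^sub>m n" "B * A = 1\<^sub>m n"
proof -
  have *: "A * B = 1\<^sub>m n" "B * A = 1\<^sub>m (dim_row B)" using assms by (auto simp: inverts_mat_def)
  have "dim_col B = n" using arg_cong[OF *(1), of dim_col] by simp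
  moreover have "dim_row B = n" using arg_cong[OF *(2), of dim_col] assms(3) by simp
  ultimately show "B \<in> carrier_mat n n" "A * B = 1\<^sub>m n" "B * A = 1\<^sub>m n" using * by auto
qed

text \<open>In the new coordinates \<open>T x\<close> both grammians become the same diagonal matrix: \<open>P\<close> turns
  into \<open>T P T\<^sup>T\<close> and \<open>R\<close> into \<open>W\<^sup>T R W\<close>, where \<open>W\<close> is the inverse of \<open>T\<close>. Both are stated as
  bilinear forms.\<close>

lemma balanced_truncation_coordinates:
  assumes bt: "balanced_truncation S P R r \<sigma> S'" and n: "state_dim S = n"
    and PR: "P \<in> carrier_mat n n" "R \<in> carrier_mat n n"
  obtains T W where "T \<in> carrier_mat n n" "W \<in> carrier_mat n n" "T * W = 1\<^sub>m n" "W * T = 1\<^sub>m n"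
    "S' = truncate_lss r (transform_lss T W S)"
    "\<And>x a. x \<in> carrier_vec n \<Longrightarrow> a \<in> carrier_vec n \<Longrightarrow>
       (W *\<^sub>v x) \<bullet> (R *\<^sub>v (W *\<^sub>v a)) = (\<Sum>i<n. \<sigma> (Suc i) * (x $ i * a $ i))"
    "\<And>x a. x \<in> carrier_vec n \<Longrightarrow> a \<in> carrier_vec n \<Longrightarrow>
       (T\<^sup>T *\<^sub>v x) \<bullet> (P *\<^sub>v (T\<^sup>T *\<^sub>v a)) = (\<Sum>i<n. \<sigma> (Suc i) * (x $ i * a $ i))"
proof -
  define L where "L = mat_diag n (\<lambda>i. \<sigma> (Suc i))"
  define D where "D = mat_diag n (\<lambda>i. sqrt (\<sigma> (Suc i)))"
  have LD: "L \<in> carrier_mat n n" "D \<in> carrier_mat n n" by (simp_all add: L_def D_def)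
  have Dt: "D\<^sup>T = D" by (auto simp: D_def mat_diag_def)
  from bt n obtain U Uinv K T W where U: "U \<in> carrier_mat n n" "P = U * U\<^sup>T"
    and K: "K \<in> carrier_mat n n" "K\<^sup>T * K = 1\<^sub>m n" and URU: "U\<^sup>T * R * U = K * (L ^\<^sub>m 2) * K\<^sup>T"
    and Uinv: "inverts_mat U Uinv" "inverts_mat Uinv U"
    and T: "T = D * K\<^sup>T * Uinv" and W: "inverts_mat T W" "inverts_mat W T"
    and S': "S' = truncate_lss r (transform_lss T W S)"
    and pos: "\<forall>i\<in>{1..n}. \<sigma> i > 0"
    unfolding balanced_truncation_def Let_def L_def D_def by blast
  have s: "\<sigma> (Suc i) > 0" if "i < n" for i using pos that by auto
  note Ui = inverts_mat_carrier[OF Uinv U(1)]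
  have Tc: "T \<in> carrier_mat n n" using LD K Ui T by simp
  note Wi = inverts_mat_carrier[OF W Tc]
  have KK: "K * K\<^sup>T = 1\<^sub>m n" using mat_mult_left_right_inverse[of "K\<^sup>T" n K] K by simp
  have L2: "L ^\<^sub>m 2 = mat_diag n (\<lambda>i. (\<sigma> (Suc i))\<^sup>2)"
    using LD by (simp add: numeral_2_eq_2 L_def power2_eq_square)
  note c = U(1) K(1) Ui(1) Tc Wi(1) LD PR
  have KKv: "K *\<^sub>v (K\<^sup>T *\<^sub>v v) = v" "K\<^sup>T *\<^sub>v (K *\<^sub>v v) = v" if "v \<in> carrier_vec n" for v
    using KK K that assoc_mult_mat_vec[of K n n "K\<^sup>T" n v] assoc_mult_mat_vec[of "K\<^sup>T" n n K n v] by auto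
  have "(W *\<^sub>v x) \<bullet> (R *\<^sub>v (W *\<^sub>v a)) = (\<Sum>i<n. \<sigma> (Suc i) * (x $ i * a $ i))"
    if x: "x \<in> carrier_vec n" and a: "a \<in> carrier_vec n" for x a
  proof -
    \<comment> \<open>Here \<open>e v\<close> is \<open>v\<close> divided componentwise by \<open>sqrt (\<sigma> (Suc i))\<close>, since \<open>T\<close> is \<open>D K\<^sup>T\<close> times the
      inverse of \<open>U\<close>; so \<open>W v = U K (e v)\<close> and the form becomes that of \<open>L\<^sup>2\<close> at \<open>e x\<close>, \<open>e a\<close>.\<close>
    define e where "e = (\<lambda>v. K\<^sup>T *\<^sub>v (Uinv *\<^sub>v (W *\<^sub>v v)))"
    have e: "e v \<in> carrier_vec n" "W *\<^sub>v v = U *\<^sub>v (K *\<^sub>v e v)"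
      "\<And>i. i < n \<Longrightarrow> sqrt (\<sigma> (Suc i)) * e v $ i = v $ i" if v: "v \<in> carrier_vec n" for v
    proof -
      show ev: "e v \<in> carrier_vec n" using c v by (auto simp: e_def)
      have "K *\<^sub>v e v = Uinv *\<^sub>v (W *\<^sub>v v)" unfolding e_def using c v by (intro KKv) auto
      then have "U *\<^sub>v (K *\<^sub>v e v) = (U * Uinv) *\<^sub>v (W *\<^sub>v v)" using c v by (simp add: assoc_mult_mat_vec[of _ n n _ n])
      also have "\<dots> = W *\<^sub>v v" unfolding Ui(2) using c v by (intro one_mult_mat_vec) auto
      finally show "W *\<^sub>v v = U *\<^sub>v (K *\<^sub>v e v)" by simp
      have "v = (T * W) *\<^sub>v v" using Wi(2) v by simp
      also have "\<dots> = D *\<^sub>v e v" unfolding T e_def using c v by (simp add: assoc_mult_mat_vec[of _ n n _ n])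
      finally show "sqrt (\<sigma> (Suc i)) * e v $ i = v $ i" if "i < n" for i
        using mat_diag_mult_vec_index[OF ev that, of "\<lambda>i. sqrt (\<sigma> (Suc i))"] by (simp add: D_def)
    qed
    have "(W *\<^sub>v x) \<bullet> (R *\<^sub>v (W *\<^sub>v a)) = (U *\<^sub>v (K *\<^sub>v e x)) \<bullet> (R *\<^sub>v (U *\<^sub>v (K *\<^sub>v e a)))"
      using e(2)[OF x] e(2)[OF a] by simp
    also have "\<dots> = (U\<^sup>T *\<^sub>v (R *\<^sub>v (U *\<^sub>v (K *\<^sub>v e a)))) \<bullet> (K *\<^sub>v e x)"
      using c e(1)[OF x] e(1)[OF a]
      by (subst transpose_vec_mult_scalar[of U n n]) (auto intro!: comm_scalar_prod[of _ n])
    also have "U\<^sup>T *\<^sub>v (R *\<^sub>v (U *\<^sub>v (K *\<^sub>v e a))) = (U\<^sup>T * R * U) *\<^sub>v (K *\<^sub>v e a)"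
      using c e(1)[OF a] by (simp add: assoc_mult_mat_vec[of _ n n _ n])
    also have "\<dots> = K *\<^sub>v ((L ^\<^sub>m 2) *\<^sub>v e a)"
      unfolding URU L2 using c e(1)[OF a] by (simp add: assoc_mult_mat_vec[of _ n n _ n] KKv)
    also have "(K *\<^sub>v ((L ^\<^sub>m 2) *\<^sub>v e a)) \<bullet> (K *\<^sub>v e x) = (K\<^sup>T *\<^sub>v (K *\<^sub>v ((L ^\<^sub>m 2) *\<^sub>v e a))) \<bullet> e x"
      unfolding L2 using c e(1)[OF x] e(1)[OF a] by (subst transpose_vec_mult_scalar[of K n n]) (auto intro!: mult_mat_vec_carrier[of _ n n])
    also have "K\<^sup>T *\<^sub>v (K *\<^sub>v ((L ^\<^sub>m 2) *\<^sub>v e a)) = (L ^\<^sub>m 2) *\<^sub>v e a"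
      unfolding L2 using e(1)[OF a] by (intro KKv mult_mat_vec_carrier[of _ n n]) auto
    also have "((L ^\<^sub>m 2) *\<^sub>v e a) \<bullet> e x = (\<Sum>i<n. (\<sigma> (Suc i))\<^sup>2 * e a $ i * e x $ i)"
      unfolding L2 using e(1)[OF x] e(1)[OF a]
      by (auto simp: scalar_prod_def atLeast0LessThan mat_diag_mult_vec_index carrier_matD[OF mat_diag_dim] simp del: index_mult_mat_vec intro!: sum.cong)
    also have "\<dots> = (\<Sum>i<n. \<sigma> (Suc i) * (x $ i * a $ i))"
    proof (rule sum.cong[OF refl])
      fix i assume "i \<in> {..<n}"
      then have i: "i < n" by simp
      have "x $ i * a $ i = (sqrt (\<sigma> (Suc i)) * sqrt (\<sigma> (Suc i))) * (e x $ i * e a $ i)"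
        unfolding e(3)[OF x i, symmetric] e(3)[OF a i, symmetric] by (simp add: mult_ac)
      also have "sqrt (\<sigma> (Suc i)) * sqrt (\<sigma> (Suc i)) = \<sigma> (Suc i)" using s[OF i] by simp
      finally show "(\<sigma> (Suc i))\<^sup>2 * e a $ i * e x $ i = \<sigma> (Suc i) * (x $ i * a $ i)"
        by (simp add: power2_eq_square mult_ac)
    qed
    finally show ?thesis .
  qed
  moreover have "(T\<^sup>T *\<^sub>v x) \<bullet> (P *\<^sub>v (T\<^sup>T *\<^sub>v a)) = (\<Sum>i<n. \<sigma> (Suc i) * (x $ i * a $ i))"
    if x: "x \<in> carrier_vec n" and a: "a \<in> carrier_vec n" for x a
  proof -
    have "T * U = D * K\<^sup>T"
      unfolding T using c Ui(3) by (simp add: assoc_mult_mat[of _ n n _ n _ n])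
    then have "(T * U)\<^sup>T = K * D" using c Dt by (simp add: transpose_mult[of _ n n _ n])
    then have UT: "U\<^sup>T * T\<^sup>T = K * D" using c by (simp add: transpose_mult[of _ n n _ n])
    have UTv: "U\<^sup>T *\<^sub>v (T\<^sup>T *\<^sub>v v) = K *\<^sub>v (D *\<^sub>v v)" if "v \<in> carrier_vec n" for v
      using arg_cong[OF UT, of "\<lambda>M. M *\<^sub>v v"] c that by (simp add: assoc_mult_mat_vec[of _ n n _ n])
    have "(T\<^sup>T *\<^sub>v x) \<bullet> (P *\<^sub>v (T\<^sup>T *\<^sub>v a)) = (T\<^sup>T *\<^sub>v x) \<bullet> (U *\<^sub>v (U\<^sup>T *\<^sub>v (T\<^sup>T *\<^sub>v a)))"
      unfolding U(2) using c a by (simp add: assoc_mult_mat_vec[of _ n n _ n])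
    also have "\<dots> = (U\<^sup>T *\<^sub>v (T\<^sup>T *\<^sub>v x)) \<bullet> (U\<^sup>T *\<^sub>v (T\<^sup>T *\<^sub>v a))"
      using c x a by (subst transpose_vec_mult_scalar[of U n n]) auto
    also have "\<dots> = (K *\<^sub>v (D *\<^sub>v x)) \<bullet> (K *\<^sub>v (D *\<^sub>v a))" using UTv x a by simp
    also have "\<dots> = (K\<^sup>T *\<^sub>v (K *\<^sub>v (D *\<^sub>v x))) \<bullet> (D *\<^sub>v a)"
      using c x a by (subst transpose_vec_mult_scalar[of K n n]) (auto intro!: mult_mat_vec_carrier[of _ n n])
    also have "K\<^sup>T *\<^sub>v (K *\<^sub>v (D *\<^sub>v x)) = D *\<^sub>v x" using c x by (intro KKv) auto
    also have "(D *\<^sub>v x) \<bullet> (D *\<^sub>v a) = (\<Sum>i<n. (sqrt (\<sigma> (Suc i)) * x $ i) * (sqrt (\<sigma> (Suc i)) * a $ i))"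
      unfolding D_def using x a
      by (auto simp: scalar_prod_def atLeast0LessThan mat_diag_mult_vec_index carrier_matD[OF mat_diag_dim] simp del: index_mult_mat_vec intro!: sum.cong)
    also have "\<dots> = (\<Sum>i<n. \<sigma> (Suc i) * (x $ i * a $ i))"
    proof (rule sum.cong[OF refl])
      fix i assume "i \<in> {..<n}"
      then have "sqrt (\<sigma> (Suc i)) * sqrt (\<sigma> (Suc i)) = \<sigma> (Suc i)" using s[of i] by simp
      then show "(sqrt (\<sigma> (Suc i)) * x $ i) * (sqrt (\<sigma> (Suc i)) * a $ i) = \<sigma> (Suc i) * (x $ i * a $ i)"
        by (metis mult.assoc mult.left_commute)
    qed
    finally show ?thesis .
  qed
  ultimately show ?thesis using that Tc Wi S' by blast
qed

lemma conjugated_mult_vec: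
  fixes A T W :: "real mat"
  assumes "A \<in> carrier_mat n n" "T \<in> carrier_mat n n" "W \<in> carrier_mat n n" "W * T = 1\<^sub>m n" "v \<in> carrier_vec n"
  shows "A *\<^sub>v (W *\<^sub>v v) = W *\<^sub>v ((T * A * W) *\<^sub>v v)"
proof -
  have "W *\<^sub>v ((T * A * W) *\<^sub>v v) = W *\<^sub>v (T *\<^sub>v (A *\<^sub>v (W *\<^sub>v v)))"
    using assms by (simp add: assoc_mult_mat_vec[of _ n n _ n])
  also have "\<dots> = (W * T) *\<^sub>v (A *\<^sub>v (W *\<^sub>v v))"
    using assms by (subst assoc_mult_mat_vec[of W n n T n]) auto
  also have "\<dots> = A *\<^sub>v (W *\<^sub>v v)" unfolding assms(4) using assms by (intro one_mult_mat_vec) auto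
  finally show ?thesis by simp
qed

text \<open>The two lemmas below are applied to the system with \<open>R\<close> as the grammian and also, with \<open>A\<^sup>T\<close>,
  \<open>B\<^sup>T\<close>, \<open>P\<close> in place of \<open>A\<close>, \<open>C\<close>, \<open>R\<close>, to the dual system, whose coordinates are changed by
  \<open>W\<^sup>T\<close> with inverse \<open>T\<^sup>T\<close>.\<close>

lemma ct_grammian_inequality_in_coordinates:
  fixes A C R T W :: "real mat" and s :: "nat \<Rightarrow> real"
  assumes c: "A \<in> carrier_mat n n" "C \<in> carrier_mat p n" "R \<in> carrier_mat n n" "R\<^sup>T = R"
    "T \<in> carrier_mat n n" "W \<in> carrier_mat n n" "W * T = 1\<^sub>m n"
    and neg: "neg_semidefinite n (A\<^sup>T * R + R * A + C\<^sup>T * C)"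
    and diag: "\<And>x a. x \<in> carrier_vec n \<Longrightarrow> a \<in> carrier_vec n \<Longrightarrow>
       (W *\<^sub>v x) \<bullet> (R *\<^sub>v (W *\<^sub>v a)) = (\<Sum>i<n. s i * (x $ i * a $ i))"
  shows "2 * (\<Sum>i<n. s i * (x i * (\<Sum>j<n. (T * A * W) $$ (i, j) * x j)))
    + (\<Sum>l<p. (\<Sum>j<n. (C * W) $$ (l, j) * x j)\<^sup>2) \<le> 0"
proof -
  define v where "v = Matrix.vec n x"
  have v: "v \<in> carrier_vec n" by (simp add: v_def)
  define y where "y = W *\<^sub>v v"
  have y: "y \<in> carrier_vec n" "A *\<^sub>v y \<in> carrier_vec n" "R *\<^sub>v y \<in> carrier_vec n" "C *\<^sub>v y \<in> carrier_vec p"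
    using c v by (auto simp: y_def)
  have Ay: "A *\<^sub>v y = W *\<^sub>v ((T * A * W) *\<^sub>v v)" unfolding y_def using c v by (intro conjugated_mult_vec)
  have taw: "T * A * W \<in> carrier_mat n n" and cw: "C * W \<in> carrier_mat p n" using c by auto
  have wv: "(T * A * W) *\<^sub>v v \<in> carrier_vec n"
    using c v by (intro mult_mat_vec_carrier[of _ n n] mult_carrier_mat[of _ n n])
  have Cy: "C *\<^sub>v y = (C * W) *\<^sub>v v" unfolding y_def using c v by (simp add: assoc_mult_mat_vec[of _ p n _ n])
  have "(A\<^sup>T * R + R * A + C\<^sup>T * C) *\<^sub>v y = A\<^sup>T *\<^sub>v (R *\<^sub>v y) + R *\<^sub>v (A *\<^sub>v y) + C\<^sup>T *\<^sub>v (C *\<^sub>v y)"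
  proof -
    have "(A\<^sup>T * R + R * A + C\<^sup>T * C) *\<^sub>v y = (A\<^sup>T * R + R * A) *\<^sub>v y + (C\<^sup>T * C) *\<^sub>v y"
      by (rule add_mult_distrib_mat_vec[of _ n n]) (use c y in auto)
    also have "(A\<^sup>T * R + R * A) *\<^sub>v y = (A\<^sup>T * R) *\<^sub>v y + (R * A) *\<^sub>v y"
      by (rule add_mult_distrib_mat_vec[of _ n n]) (use c y in auto)
    also have "(A\<^sup>T * R) *\<^sub>v y = A\<^sup>T *\<^sub>v (R *\<^sub>v y)" using c y by (intro assoc_mult_mat_vec[of _ n n _ n]) auto
    also have "(R * A) *\<^sub>v y = R *\<^sub>v (A *\<^sub>v y)" using c y by (intro assoc_mult_mat_vec[of _ n n _ n]) auto
    also have "(C\<^sup>T * C) *\<^sub>v y = C\<^sup>T *\<^sub>v (C *\<^sub>v y)" using c y by (intro assoc_mult_mat_vec[of _ n p _ n]) auto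
    finally show ?thesis .
  qed
  then have "y \<bullet> ((A\<^sup>T * R + R * A + C\<^sup>T * C) *\<^sub>v y)
      = y \<bullet> (A\<^sup>T *\<^sub>v (R *\<^sub>v y)) + y \<bullet> (R *\<^sub>v (A *\<^sub>v y)) + y \<bullet> (C\<^sup>T *\<^sub>v (C *\<^sub>v y))"
    using c y by (simp add: scalar_prod_add_distrib[of _ n])
  also have "y \<bullet> (A\<^sup>T *\<^sub>v (R *\<^sub>v y)) = (R *\<^sub>v y) \<bullet> (A *\<^sub>v y)"
    using c y transpose_vec_mult_scalar[of A n n y "R *\<^sub>v y"] by (simp add: comm_scalar_prod[of y n "A\<^sup>T *\<^sub>v (R *\<^sub>v y)"])
  also have "(R *\<^sub>v y) \<bullet> (A *\<^sub>v y) = y \<bullet> (R *\<^sub>v (A *\<^sub>v y))"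
    using c y transpose_vec_mult_scalar[of R n n "A *\<^sub>v y" y] by simp
  also have "y \<bullet> (C\<^sup>T *\<^sub>v (C *\<^sub>v y)) = (C *\<^sub>v y) \<bullet> (C *\<^sub>v y)"
    using c y transpose_vec_mult_scalar[of C p n y "C *\<^sub>v y"] by (simp add: comm_scalar_prod[of y n "C\<^sup>T *\<^sub>v (C *\<^sub>v y)"])
  also have "y \<bullet> (R *\<^sub>v (A *\<^sub>v y)) = (\<Sum>i<n. s i * (x i * (\<Sum>j<n. (T * A * W) $$ (i, j) * x j)))"
  proof -
    have "y \<bullet> (R *\<^sub>v (A *\<^sub>v y)) = (\<Sum>i<n. s i * (v $ i * ((T * A * W) *\<^sub>v v) $ i))"
      unfolding Ay unfolding y_def by (rule diag[OF v wv])
    also have "\<dots> = (\<Sum>i<n. s i * (x i * (\<Sum>j<n. (T * A * W) $$ (i, j) * x j)))"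
      unfolding v_def by (intro sum.cong refl) (simp only: lessThan_iff mult_mat_vec_index_eq_sum[OF taw] index_vec)
    finally show ?thesis .
  qed
  also have "(C *\<^sub>v y) \<bullet> (C *\<^sub>v y) = (\<Sum>l<p. (\<Sum>j<n. (C * W) $$ (l, j) * x j)\<^sup>2)"
    unfolding scalar_prod_self_eq_sum[OF y(4)] unfolding Cy v_def
    by (intro sum.cong refl) (simp only: lessThan_iff mult_mat_vec_index_eq_sum[OF cw])
  finally have "y \<bullet> ((A\<^sup>T * R + R * A + C\<^sup>T * C) *\<^sub>v y)
      = 2 * (\<Sum>i<n. s i * (x i * (\<Sum>j<n. (T * A * W) $$ (i, j) * x j)))
        + (\<Sum>l<p. (\<Sum>j<n. (C * W) $$ (l, j) * x j)\<^sup>2)" by simp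
  moreover have "y \<bullet> ((A\<^sup>T * R + R * A + C\<^sup>T * C) *\<^sub>v y) \<le> 0"
    using neg y(1) unfolding neg_semidefinite_def by blast
  ultimately show ?thesis by simp
qed

lemma dt_grammian_inequality_in_coordinates:
  fixes A C R T W :: "real mat" and s :: "nat \<Rightarrow> real"
  assumes c: "A \<in> carrier_mat n n" "C \<in> carrier_mat p n" "R \<in> carrier_mat n n"
    "T \<in> carrier_mat n n" "W \<in> carrier_mat n n" "W * T = 1\<^sub>m n"
    and neg: "neg_semidefinite n (A\<^sup>T * R * A + C\<^sup>T * C - R)"
    and diag: "\<And>x a. x \<in> carrier_vec n \<Longrightarrow> a \<in> carrier_vec n \<Longrightarrow>
       (W *\<^sub>v x) \<bullet> (R *\<^sub>v (W *\<^sub>v a)) = (\<Sum>i<n. s i * (x $ i * a $ i))"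
  shows "(\<Sum>i<n. s i * (\<Sum>j<n. (T * A * W) $$ (i, j) * x j)\<^sup>2)
    + (\<Sum>l<p. (\<Sum>j<n. (C * W) $$ (l, j) * x j)\<^sup>2) \<le> (\<Sum>i<n. s i * (x i)\<^sup>2)"
proof -
  define v where "v = Matrix.vec n x"
  have v: "v \<in> carrier_vec n" by (simp add: v_def)
  define y where "y = W *\<^sub>v v"
  have y: "y \<in> carrier_vec n" "A *\<^sub>v y \<in> carrier_vec n" "R *\<^sub>v y \<in> carrier_vec n" "C *\<^sub>v y \<in> carrier_vec p"
    using c v by (auto simp: y_def)
  have Ay: "A *\<^sub>v y = W *\<^sub>v ((T * A * W) *\<^sub>v v)" unfolding y_def using c v by (intro conjugated_mult_vec)
  have taw: "T * A * W \<in> carrier_mat n n" and cw: "C * W \<in> carrier_mat p n" using c by auto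
  have wv: "(T * A * W) *\<^sub>v v \<in> carrier_vec n"
    using c v by (intro mult_mat_vec_carrier[of _ n n] mult_carrier_mat[of _ n n])
  have Cy: "C *\<^sub>v y = (C * W) *\<^sub>v v" unfolding y_def using c v by (simp add: assoc_mult_mat_vec[of _ p n _ n])
  have "(A\<^sup>T * R * A + C\<^sup>T * C - R) *\<^sub>v y = A\<^sup>T *\<^sub>v (R *\<^sub>v (A *\<^sub>v y)) + C\<^sup>T *\<^sub>v (C *\<^sub>v y) - R *\<^sub>v y"
  proof -
    have "(A\<^sup>T * R * A + C\<^sup>T * C - R) *\<^sub>v y = (A\<^sup>T * R * A + C\<^sup>T * C) *\<^sub>v y - R *\<^sub>v y"
      by (rule minus_mult_distrib_mat_vec[of _ n n]) (use c y in auto)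
    also have "(A\<^sup>T * R * A + C\<^sup>T * C) *\<^sub>v y = (A\<^sup>T * R * A) *\<^sub>v y + (C\<^sup>T * C) *\<^sub>v y"
      by (rule add_mult_distrib_mat_vec[of _ n n]) (use c y in auto)
    also have "(A\<^sup>T * R * A) *\<^sub>v y = A\<^sup>T *\<^sub>v (R *\<^sub>v (A *\<^sub>v y))"
      using c y by (simp add: assoc_mult_mat_vec[of _ n n _ n])
    also have "(C\<^sup>T * C) *\<^sub>v y = C\<^sup>T *\<^sub>v (C *\<^sub>v y)" using c y by (intro assoc_mult_mat_vec[of _ n p _ n]) auto
    finally show ?thesis .
  qed
  then have "y \<bullet> ((A\<^sup>T * R * A + C\<^sup>T * C - R) *\<^sub>v y)
      = y \<bullet> (A\<^sup>T *\<^sub>v (R *\<^sub>v (A *\<^sub>v y))) + y \<bullet> (C\<^sup>T *\<^sub>v (C *\<^sub>v y)) - y \<bullet> (R *\<^sub>v y)"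
    using c y by (simp add: scalar_prod_add_distrib[of _ n] scalar_prod_minus_distrib[of _ n])
  also have "y \<bullet> (A\<^sup>T *\<^sub>v (R *\<^sub>v (A *\<^sub>v y))) = (A *\<^sub>v y) \<bullet> (R *\<^sub>v (A *\<^sub>v y))"
    using c y transpose_vec_mult_scalar[of A n n y "R *\<^sub>v (A *\<^sub>v y)"]
    by (simp add: comm_scalar_prod[of y n "A\<^sup>T *\<^sub>v (R *\<^sub>v (A *\<^sub>v y))"] comm_scalar_prod[of "A *\<^sub>v y" n])
  also have "y \<bullet> (C\<^sup>T *\<^sub>v (C *\<^sub>v y)) = (C *\<^sub>v y) \<bullet> (C *\<^sub>v y)"
    using c y transpose_vec_mult_scalar[of C p n y "C *\<^sub>v y"] by (simp add: comm_scalar_prod[of y n "C\<^sup>T *\<^sub>v (C *\<^sub>v y)"])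
  also have "(A *\<^sub>v y) \<bullet> (R *\<^sub>v (A *\<^sub>v y)) = (\<Sum>i<n. s i * (\<Sum>j<n. (T * A * W) $$ (i, j) * x j)\<^sup>2)"
  proof -
    have "(A *\<^sub>v y) \<bullet> (R *\<^sub>v (A *\<^sub>v y)) = (\<Sum>i<n. s i * (((T * A * W) *\<^sub>v v) $ i * ((T * A * W) *\<^sub>v v) $ i))"
      unfolding Ay by (rule diag[OF wv wv])
    also have "\<dots> = (\<Sum>i<n. s i * (\<Sum>j<n. (T * A * W) $$ (i, j) * x j)\<^sup>2)"
      unfolding v_def power2_eq_square
      by (intro sum.cong refl) (simp only: lessThan_iff mult_mat_vec_index_eq_sum[OF taw])
    finally show ?thesis .
  qed
  also have "(C *\<^sub>v y) \<bullet> (C *\<^sub>v y) = (\<Sum>l<p. (\<Sum>j<n. (C * W) $$ (l, j) * x j)\<^sup>2)"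
    unfolding scalar_prod_self_eq_sum[OF y(4)] unfolding Cy v_def
    by (intro sum.cong refl) (simp only: lessThan_iff mult_mat_vec_index_eq_sum[OF cw])
  also have "y \<bullet> (R *\<^sub>v y) = (\<Sum>i<n. s i * (x i)\<^sup>2)"
    unfolding y_def using diag[OF v v] by (simp add: v_def power2_eq_square)
  finally have "y \<bullet> ((A\<^sup>T * R * A + C\<^sup>T * C - R) *\<^sub>v y)
      = (\<Sum>i<n. s i * (\<Sum>j<n. (T * A * W) $$ (i, j) * x j)\<^sup>2)
        + (\<Sum>l<p. (\<Sum>j<n. (C * W) $$ (l, j) * x j)\<^sup>2) - (\<Sum>i<n. s i * (x i)\<^sup>2)" .
  moreover have "y \<bullet> ((A\<^sup>T * R * A + C\<^sup>T * C - R) *\<^sub>v y) \<le> 0"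
    using neg y(1) unfolding neg_semidefinite_def by blast
  ultimately show ?thesis by simp
qed

lemma sum_swap_bilinear:
  fixes a :: "nat \<Rightarrow> nat \<Rightarrow> real"
  shows "(\<Sum>i<n. x i * (\<Sum>j<m. a j i * y j)) = (\<Sum>j<m. y j * (\<Sum>i<n. a j i * x i))"
  unfolding sum_distrib_left by (subst sum.swap) (simp add: mult_ac)

lemma two_mult_le_add_squares: "2 * (a * b) \<le> a\<^sup>2 + (b::real)\<^sup>2"
  using zero_le_power2[of "a - b"] by (simp add: power2_eq_square algebra_simps)

text \<open>The controllability inequality of the system, from the inequality of the dual system: the bound
  on \<open>B\<^sup>T y\<close> at \<open>y i = x i / s i\<close> absorbs the input by completing the square.\<close>

lemma ct_controllability_from_dual:
  assumes s: "\<And>i. i < n \<Longrightarrow> s i > (0::real)"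
    and dual: "\<And>y. 2 * (\<Sum>i<n. s i * (y i * (\<Sum>j<n. A j i * y j))) + (\<Sum>l<m. (\<Sum>j<n. B j l * y j)\<^sup>2) \<le> 0"
  shows "2 * (\<Sum>i<n. x i * linear_field n m A B x u i / s i) \<le> (\<Sum>l<m. (u l)\<^sup>2)"
proof -
  define y where "y = (\<lambda>i. x i / s i)"
  have "2 * (\<Sum>i<n. x i * linear_field n m A B x u i / s i)
    = 2 * (\<Sum>i<n. y i * (\<Sum>j<n. A i j * x j)) + 2 * (\<Sum>i<n. y i * (\<Sum>l<m. B i l * u l))"
    by (simp add: y_def linear_field_def distrib_left add_divide_distrib sum.distrib)
  also have "(\<Sum>i<n. y i * (\<Sum>j<n. A i j * x j)) = (\<Sum>i<n. x i * (\<Sum>j<n. A j i * y j))"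
    by (rule sum_swap_bilinear[symmetric])
  also have "\<dots> = (\<Sum>i<n. s i * (y i * (\<Sum>j<n. A j i * y j)))"
  proof (rule sum.cong[OF refl])
    fix i assume "i \<in> {..<n}"
    then have "x i = s i * y i" using s[of i] by (simp add: y_def)
    then show "x i * (\<Sum>j<n. A j i * y j) = s i * (y i * (\<Sum>j<n. A j i * y j))" by (simp add: mult.assoc)
  qed
  also have "2 * (\<Sum>i<n. y i * (\<Sum>l<m. B i l * u l)) = (\<Sum>l<m. 2 * (u l * (\<Sum>i<n. B i l * y i)))"
    by (subst sum_swap_bilinear[symmetric]) (simp add: sum_distrib_left)
  also have "\<dots> \<le> (\<Sum>l<m. (u l)\<^sup>2 + (\<Sum>i<n. B i l * y i)\<^sup>2)"
    by (intro sum_mono two_mult_le_add_squares)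
  finally show ?thesis using dual[of y] by (simp add: sum.distrib)
qed

text \<open>In discrete time \<open>v\<close> is the next state and \<open>y i = v i / s i\<close>. Twice the next energy is
  \<open>2 (y \<bullet> v)\<close>; splitting \<open>v\<close> into the contributions of \<open>x\<close> and \<open>u\<close> and completing squares bounds it by
  the old energy, the input energy, and the left-hand side of the dual inequality, which is at most
  the next energy.\<close>

lemma dt_controllability_from_dual:
  assumes s: "\<And>i. i < n \<Longrightarrow> s i > (0::real)"
    and dual: "\<And>y. (\<Sum>i<n. s i * (\<Sum>j<n. A j i * y j)\<^sup>2) + (\<Sum>l<m. (\<Sum>j<n. B j l * y j)\<^sup>2) \<le> (\<Sum>i<n. s i * (y i)\<^sup>2)"
  shows "(\<Sum>i<n. (linear_field n m A B x u i)\<^sup>2 / s i) \<le> (\<Sum>i<n. (x i)\<^sup>2 / s i) + (\<Sum>l<m. (u l)\<^sup>2)"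
proof -
  define v where "v = linear_field n m A B x u"
  define y where "y = (\<lambda>i. v i / s i)"
  have vy: "(\<Sum>i<n. s i * (y i)\<^sup>2) = (\<Sum>i<n. (v i)\<^sup>2 / s i)"
  proof (rule sum.cong[OF refl])
    fix i assume "i \<in> {..<n}"
    then show "s i * (y i)\<^sup>2 = (v i)\<^sup>2 / s i" using s[of i] by (simp add: y_def power2_eq_square)
  qed
  have "2 * (\<Sum>i<n. (v i)\<^sup>2 / s i) = 2 * (\<Sum>i<n. y i * v i)" by (simp add: y_def power2_eq_square)
  also have "\<dots> = 2 * (\<Sum>i<n. y i * (\<Sum>j<n. A i j * x j)) + 2 * (\<Sum>i<n. y i * (\<Sum>l<m. B i l * u l))"
    by (simp add: v_def linear_field_def distrib_left sum.distrib)
  also have "2 * (\<Sum>i<n. y i * (\<Sum>j<n. A i j * x j)) = (\<Sum>i<n. 2 * (x i * (\<Sum>j<n. A j i * y j)))"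
    by (subst sum_swap_bilinear[symmetric]) (simp add: sum_distrib_left)
  also have "\<dots> \<le> (\<Sum>i<n. (x i)\<^sup>2 / s i + s i * (\<Sum>j<n. A j i * y j)\<^sup>2)"
  proof (rule sum_mono)
    fix i assume "i \<in> {..<n}"
    then have i: "s i > 0" using s by simp
    then have "2 * (x i / sqrt (s i) * (sqrt (s i) * (\<Sum>j<n. A j i * y j)))
        \<le> (x i / sqrt (s i))\<^sup>2 + (sqrt (s i) * (\<Sum>j<n. A j i * y j))\<^sup>2" by (intro two_mult_le_add_squares)
    then show "2 * (x i * (\<Sum>j<n. A j i * y j)) \<le> (x i)\<^sup>2 / s i + s i * (\<Sum>j<n. A j i * y j)\<^sup>2"
      using i by (simp add: power_divide power_mult_distrib)
  qed
  also have "2 * (\<Sum>i<n. y i * (\<Sum>l<m. B i l * u l)) = (\<Sum>l<m. 2 * (u l * (\<Sum>i<n. B i l * y i)))"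
    by (subst sum_swap_bilinear[symmetric]) (simp add: sum_distrib_left)
  also have "\<dots> \<le> (\<Sum>l<m. (u l)\<^sup>2 + (\<Sum>i<n. B i l * y i)\<^sup>2)"
    by (intro sum_mono two_mult_le_add_squares)
  finally show ?thesis using dual[of y] vy by (simp add: sum.distrib v_def)
qed

section \<open>Truncated systems in balanced coordinates\<close>

lemma mult_mat_vec_index_eq_sum':
  fixes M :: "real mat"
  assumes "M \<in> carrier_mat k n" "v \<in> carrier_vec n" "i < k"
  shows "(M *\<^sub>v v) $ i = (\<Sum>j<n. M $$ (i, j) * v $ j)"
  using assms by (auto simp: scalar_prod_def atLeast0LessThan intro!: sum.cong)

lemma vector_field_in_coordinates:
  fixes A B T W :: "real mat"
  assumes c: "A \<in> carrier_mat n n" "B \<in> carrier_mat n m" "T \<in> carrier_mat n n" "W \<in> carrier_mat n n"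
    "W * T = 1\<^sub>m n" "x \<in> carrier_vec n" "u \<in> carrier_vec m" and i: "i < n"
  shows "(T *\<^sub>v (A *\<^sub>v x + B *\<^sub>v u)) $ i
    = linear_field n m (\<lambda>i j. (T * A * W) $$ (i, j)) (\<lambda>i l. (T * B) $$ (i, l)) (\<lambda>j. (T *\<^sub>v x) $ j) (\<lambda>l. u $ l) i"
proof -
  have Tx: "T *\<^sub>v x \<in> carrier_vec n" using c by (intro mult_mat_vec_carrier[of _ n n])
  have taw: "T * A * W \<in> carrier_mat n n" and tb: "T * B \<in> carrier_mat n m" using c by auto
  have "(T * A * W) *\<^sub>v (T *\<^sub>v x) = (T * A) *\<^sub>v (W *\<^sub>v (T *\<^sub>v x))"
    using c Tx by (intro assoc_mult_mat_vec[of _ n n _ n]) auto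
  also have "W *\<^sub>v (T *\<^sub>v x) = (W * T) *\<^sub>v x" using c by (intro assoc_mult_mat_vec[of _ n n _ n, symmetric])
  also have "\<dots> = x" unfolding c(5) using c by simp
  also have "(T * A) *\<^sub>v x = T *\<^sub>v (A *\<^sub>v x)" using c by (intro assoc_mult_mat_vec[of _ n n _ n])
  finally have A: "(T * A * W) *\<^sub>v (T *\<^sub>v x) = T *\<^sub>v (A *\<^sub>v x)" .
  have B: "(T * B) *\<^sub>v u = T *\<^sub>v (B *\<^sub>v u)" using c by (intro assoc_mult_mat_vec[of _ n n _ m])
  have "T *\<^sub>v (A *\<^sub>v x + B *\<^sub>v u) = T *\<^sub>v (A *\<^sub>v x) + T *\<^sub>v (B *\<^sub>v u)"
    using c by (intro mult_add_distrib_mat_vec[of _ n n] mult_mat_vec_carrier[of _ n n] mult_mat_vec_carrier[of _ n m])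
  also have "\<dots> = (T * A * W) *\<^sub>v (T *\<^sub>v x) + (T * B) *\<^sub>v u" using A B by simp
  also have "\<dots> $ i = ((T * A * W) *\<^sub>v (T *\<^sub>v x)) $ i + ((T * B) *\<^sub>v u) $ i"
    using c i by (intro index_add_vec) simp
  also have "\<dots> = (\<Sum>j<n. (T * A * W) $$ (i, j) * (T *\<^sub>v x) $ j) + (\<Sum>l<m. (T * B) $$ (i, l) * u $ l)"
    using mult_mat_vec_index_eq_sum'[OF taw Tx i] mult_mat_vec_index_eq_sum'[OF tb c(7) i] by simp
  finally show ?thesis by (simp add: linear_field_def)
qed

lemma output_in_coordinates:
  fixes C T W :: "real mat"
  assumes c: "C \<in> carrier_mat p n" "T \<in> carrier_mat n n" "W \<in> carrier_mat n n" "W * T = 1\<^sub>m n" "x \<in> carrier_vec n"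
    and l: "l < p"
  shows "(C *\<^sub>v x) $ l = (\<Sum>j<n. (C * W) $$ (l, j) * (T *\<^sub>v x) $ j)"
proof -
  have Tx: "T *\<^sub>v x \<in> carrier_vec n" using c by (intro mult_mat_vec_carrier[of _ n n])
  have cw: "C * W \<in> carrier_mat p n" using c by auto
  have "(C * W) *\<^sub>v (T *\<^sub>v x) = C *\<^sub>v (W *\<^sub>v (T *\<^sub>v x))" using c Tx by (intro assoc_mult_mat_vec[of _ p n _ n])
  also have "W *\<^sub>v (T *\<^sub>v x) = (W * T) *\<^sub>v x" using c by (intro assoc_mult_mat_vec[of _ n n _ n, symmetric])
  also have "\<dots> = x" unfolding c(4) using c by simp
  finally show ?thesis using mult_mat_vec_index_eq_sum'[OF cw Tx l] by simp
qed

lemma sum_zero_padding: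
  fixes g h :: "nat \<Rightarrow> real"
  assumes "r \<le> n"
  shows "(\<Sum>j<n. g j * (if j < r then h j else 0)) = (\<Sum>j<r. g j * h j)"
proof -
  have "(\<Sum>j<n. g j * (if j < r then h j else 0)) = (\<Sum>j<r. g j * (if j < r then h j else 0))"
    using assms by (intro sum.mono_neutral_right) auto
  then show ?thesis by simp
qed

lemma upper_left_block_carrier: "upper_left_block k l M \<in> carrier_mat k l"
  by (simp add: upper_left_block_def)

lemma upper_left_block_mult_vec_index:
  assumes "v \<in> carrier_vec l" "i < k"
  shows "(upper_left_block k l M *\<^sub>v v) $ i = (\<Sum>j<l. M $$ (i, j) * v $ j)"
proof -
  have "upper_left_block k l M \<in> carrier_mat k l" by (simp add: upper_left_block_def)
  then show ?thesis using mult_mat_vec_index_eq_sum'[OF _ assms, of "upper_left_block k l M"] assms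
    by (simp add: upper_left_block_def)
qed

lemma truncated_vector_field_in_coordinates:
  assumes "r \<le> n" "x \<in> carrier_vec r" "u \<in> carrier_vec m" "i < r"
  shows "(upper_left_block r r A *\<^sub>v x + upper_left_block r m B *\<^sub>v u) $ i
    = linear_field n m (\<lambda>i j. A $$ (i, j)) (\<lambda>i l. B $$ (i, l)) (\<lambda>j. if j < r then x $ j else 0) (\<lambda>l. u $ l) i"
  using assms upper_left_block_mult_vec_index[of x r i r A] upper_left_block_mult_vec_index[of u m i r B]
  by (simp add: linear_field_def sum_zero_padding upper_left_block_def)

lemma truncated_output_in_coordinates:
  assumes "r \<le> n" "x \<in> carrier_vec r" "l < p"
  shows "(upper_left_block p r C *\<^sub>v x) $ l = (\<Sum>j<n. C $$ (l, j) * (if j < r then x $ j else 0))"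
  using upper_left_block_mult_vec_index[OF assms(2,3)] sum_zero_padding[OF assms(1)] by simp

text \<open>Matrices of mode \<open>q\<close> become functions of two indices: with zero padding, the states of the
  truncated systems of all dimensions then live on one index set.\<close>

definition coord_A :: "real mat \<Rightarrow> real mat \<Rightarrow> lss \<Rightarrow> nat \<Rightarrow> nat \<Rightarrow> nat \<Rightarrow> real" where
  "coord_A T W S q = (\<lambda>i j. (T * Amat S q * W) $$ (i, j))"
definition coord_B :: "real mat \<Rightarrow> lss \<Rightarrow> nat \<Rightarrow> nat \<Rightarrow> nat \<Rightarrow> real" where
  "coord_B T S q = (\<lambda>i l. (T * Bmat S q) $$ (i, l))"
definition coord_C :: "real mat \<Rightarrow> lss \<Rightarrow> nat \<Rightarrow> nat \<Rightarrow> nat \<Rightarrow> real" where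
  "coord_C W S q = (\<lambda>l j. (Cmat S q * W) $$ (l, j))"

text \<open>The outcome of the procedure: \<open>W\<close> is the inverse of \<open>T\<close>, and the counting of singular values
  starts at 0, so that \<open>s i\<close> belongs to component \<open>i\<close> of the state.\<close>

locale balanced_lss =
  fixes S :: lss and P R :: "real mat" and r :: nat and S' :: lss
    and n m p :: nat and T W :: "real mat" and s :: "nat \<Rightarrow> real"
  assumes lss: "is_lss S" and dims: "state_dim S = n" "input_dim S = m" "output_dim S = p"
    and r: "r < n"
    and TW: "T \<in> carrier_mat n n" "W \<in> carrier_mat n n" "T * W = 1\<^sub>m n" "W * T = 1\<^sub>m n"
    and S': "S' = truncate_lss r (transform_lss T W S)"
    and s_pos: "\<And>i. i < n \<Longrightarrow> s i > 0"
    and PR: "P \<in> carrier_mat n n" "P\<^sup>T = P" "R \<in> carrier_mat n n" "R\<^sup>T = R"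
    and R_diag: "\<And>x a. x \<in> carrier_vec n \<Longrightarrow> a \<in> carrier_vec n \<Longrightarrow>
       (W *\<^sub>v x) \<bullet> (R *\<^sub>v (W *\<^sub>v a)) = (\<Sum>i<n. s i * (x $ i * a $ i))"
    and P_diag: "\<And>x a. x \<in> carrier_vec n \<Longrightarrow> a \<in> carrier_vec n \<Longrightarrow>
       (T\<^sup>T *\<^sub>v x) \<bullet> (P *\<^sub>v (T\<^sup>T *\<^sub>v a)) = (\<Sum>i<n. s i * (x $ i * a $ i))"
begin

abbreviation "A \<equiv> coord_A T W S"
abbreviation "B \<equiv> coord_B T S"
abbreviation "C \<equiv> coord_C W S"
abbreviation "bound \<equiv> 2 * (\<Sum>k=r..<n. s k)"

lemma mats:
  assumes "q \<in> modes S"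
  shows "Amat S q \<in> carrier_mat n n" "Bmat S q \<in> carrier_mat n m" "Cmat S q \<in> carrier_mat p n"
  using lss assms dims by (auto simp: is_lss_def)

lemma S'_simps:
  "state_dim S' = r" "input_dim S' = m" "output_dim S' = p" "modes S' = modes S"
  "Amat S' q = upper_left_block r r (T * Amat S q * W)"
  "Bmat S' q = upper_left_block r m (T * Bmat S q)"
  "Cmat S' q = upper_left_block p r (Cmat S q * W)"
  using dims by (auto simp: S' truncate_lss_def transform_lss_def modes_def)

lemma bound_pos: "bound > 0"
  using r s_pos by (auto intro!: sum_pos)

lemma dual_transform:
  assumes "q \<in> modes S" "i < n" "j < n"
  shows "(W\<^sup>T * (Amat S q)\<^sup>T * T\<^sup>T) $$ (i, j) = A q j i"
proof -
  note M = mats[OF assms(1)]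
  have "(T * Amat S q * W)\<^sup>T = W\<^sup>T * (T * Amat S q)\<^sup>T" using M TW by (intro transpose_mult[of _ n n _ n]) auto
  also have "(T * Amat S q)\<^sup>T = (Amat S q)\<^sup>T * T\<^sup>T" using M TW by (intro transpose_mult[of _ n n _ n])
  also have "W\<^sup>T * ((Amat S q)\<^sup>T * T\<^sup>T) = W\<^sup>T * (Amat S q)\<^sup>T * T\<^sup>T"
    using M TW by (intro assoc_mult_mat[of _ n n _ n _ n, symmetric]) auto
  finally have "W\<^sup>T * (Amat S q)\<^sup>T * T\<^sup>T = (T * Amat S q * W)\<^sup>T" by simp
  then show ?thesis using M TW assms by (simp add: coord_A_def)
qed

lemma dual_transform_B:
  assumes "q \<in> modes S" "l < m" "j < n"
  shows "((Bmat S q)\<^sup>T * T\<^sup>T) $$ (l, j) = B q j l"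
proof -
  note M = mats[OF assms(1)]
  have "(T * Bmat S q)\<^sup>T = (Bmat S q)\<^sup>T * T\<^sup>T" using M TW by (intro transpose_mult[of _ n n _ m])
  then have "((Bmat S q)\<^sup>T * T\<^sup>T) $$ (l, j) = (T * Bmat S q)\<^sup>T $$ (l, j)" by simp
  then show ?thesis using M TW assms by (simp add: coord_B_def)
qed

lemma TW_transpose: "T\<^sup>T * W\<^sup>T = 1\<^sub>m n"
  using transpose_mult[OF TW(2,1)] TW(4) by simp

lemma ct_inequalities:
  assumes q: "q \<in> modes S" and gr: "ct_controllability_grammian S P" "ct_observability_grammian S R"
  shows "2 * (\<Sum>i<n. s i * (x i * linear_field n m (A q) (B q) x (\<lambda>_. 0) i)) + (\<Sum>l<p. (\<Sum>j<n. C q l j * x j)\<^sup>2) \<le> 0"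
    and "2 * (\<Sum>i<n. x i * linear_field n m (A q) (B q) x u i / s i) \<le> (\<Sum>l<m. (u l)\<^sup>2)"
proof -
  note M = mats[OF q]
  have o: "neg_semidefinite n ((Amat S q)\<^sup>T * R + R * Amat S q + (Cmat S q)\<^sup>T * Cmat S q)"
    and c: "neg_semidefinite n (Amat S q * P + P * (Amat S q)\<^sup>T + Bmat S q * (Bmat S q)\<^sup>T)"
    using gr q dims by (auto simp: ct_controllability_grammian_def ct_observability_grammian_def)
  show "2 * (\<Sum>i<n. s i * (x i * linear_field n m (A q) (B q) x (\<lambda>_. 0) i)) + (\<Sum>l<p. (\<Sum>j<n. C q l j * x j)\<^sup>2) \<le> 0"
    using ct_grammian_inequality_in_coordinates[OF M(1,3) PR(3,4) TW(1,2,4) o R_diag, of x]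
    by (simp add: linear_field_def coord_A_def coord_C_def)
  have dual: "2 * (\<Sum>i<n. s i * (y i * (\<Sum>j<n. A q j i * y j))) + (\<Sum>l<m. (\<Sum>j<n. B q j l * y j)\<^sup>2) \<le> 0" for y
  proof -
    have "2 * (\<Sum>i<n. s i * (y i * (\<Sum>j<n. (W\<^sup>T * (Amat S q)\<^sup>T * T\<^sup>T) $$ (i, j) * y j)))
        + (\<Sum>l<m. (\<Sum>j<n. ((Bmat S q)\<^sup>T * T\<^sup>T) $$ (l, j) * y j)\<^sup>2) \<le> 0"
      using M TW PR c P_diag TW_transpose
      by (intro ct_grammian_inequality_in_coordinates[where R = P]) (auto simp: transpose_transpose)
    then show ?thesis using dual_transform[OF q] dual_transform_B[OF q] by (simp cong: sum.cong_simp)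
  qed
  show "2 * (\<Sum>i<n. x i * linear_field n m (A q) (B q) x u i / s i) \<le> (\<Sum>l<m. (u l)\<^sup>2)"
    using ct_controllability_from_dual[where n = n and s = s and A = "A q" and m = m and B = "B q" and x = x and u = u] s_pos dual by blast
qed

lemma dt_inequalities:
  assumes q: "q \<in> modes S" and gr: "dt_controllability_grammian S P" "dt_observability_grammian S R"
  shows "(\<Sum>i<n. s i * (linear_field n m (A q) (B q) x (\<lambda>_. 0) i)\<^sup>2) + (\<Sum>l<p. (\<Sum>j<n. C q l j * x j)\<^sup>2) \<le> (\<Sum>i<n. s i * (x i)\<^sup>2)"
    and "(\<Sum>i<n. (linear_field n m (A q) (B q) x u i)\<^sup>2 / s i) \<le> (\<Sum>i<n. (x i)\<^sup>2 / s i) + (\<Sum>l<m. (u l)\<^sup>2)"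
proof -
  note M = mats[OF q]
  have o: "neg_semidefinite n ((Amat S q)\<^sup>T * R * Amat S q + (Cmat S q)\<^sup>T * Cmat S q - R)"
    and c: "neg_semidefinite n (Amat S q * P * (Amat S q)\<^sup>T + Bmat S q * (Bmat S q)\<^sup>T - P)"
    using gr q dims by (auto simp: dt_controllability_grammian_def dt_observability_grammian_def)
  show "(\<Sum>i<n. s i * (linear_field n m (A q) (B q) x (\<lambda>_. 0) i)\<^sup>2) + (\<Sum>l<p. (\<Sum>j<n. C q l j * x j)\<^sup>2) \<le> (\<Sum>i<n. s i * (x i)\<^sup>2)"
    using dt_grammian_inequality_in_coordinates[OF M(1,3) PR(3) TW(1,2,4) o R_diag, of x]
    by (simp add: linear_field_def coord_A_def coord_C_def)
  have dual: "(\<Sum>i<n. s i * (\<Sum>j<n. A q j i * y j)\<^sup>2) + (\<Sum>l<m. (\<Sum>j<n. B q j l * y j)\<^sup>2) \<le> (\<Sum>i<n. s i * (y i)\<^sup>2)" for y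
  proof -
    have "(\<Sum>i<n. s i * (\<Sum>j<n. (W\<^sup>T * (Amat S q)\<^sup>T * T\<^sup>T) $$ (i, j) * y j)\<^sup>2)
        + (\<Sum>l<m. (\<Sum>j<n. ((Bmat S q)\<^sup>T * T\<^sup>T) $$ (l, j) * y j)\<^sup>2) \<le> (\<Sum>i<n. s i * (y i)\<^sup>2)"
      using M TW PR c P_diag TW_transpose
      by (intro dt_grammian_inequality_in_coordinates[where R = P]) (auto simp: transpose_transpose)
    then show ?thesis using dual_transform[OF q] dual_transform_B[OF q] by (simp cong: sum.cong_simp)
  qed
  show "(\<Sum>i<n. (linear_field n m (A q) (B q) x u i)\<^sup>2 / s i) \<le> (\<Sum>i<n. (x i)\<^sup>2 / s i) + (\<Sum>l<m. (u l)\<^sup>2)"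
    using dt_controllability_from_dual[where n = n and s = s and A = "A q" and m = m and B = "B q" and x = x and u = u] s_pos dual by blast
qed

end

lemma step_energy_nonneg:
  assumes "\<And>i. i < n \<Longrightarrow> s i > 0"
  shows "step_energy n s k x y \<ge> 0"
  unfolding step_energy_def using assms
  by (intro sum_nonneg add_nonneg_nonneg mult_nonneg_nonneg divide_nonneg_nonneg) (auto simp: less_imp_le)

lemma gain_norm_le:
  assumes "\<gamma> > 0" and "\<And>u q. u \<in> U \<Longrightarrow> q \<in> Q \<Longrightarrow> f u q \<in> Y"
    and "\<And>u q. u \<in> U \<Longrightarrow> q \<in> Q \<Longrightarrow> ny (f u q) \<le> \<gamma> * nu u"
  shows "gain_norm U nu Q Y ny f \<le> ereal \<gamma>"
  unfolding gain_norm_def using assms by (intro Inf_lower) (auto intro!: SUP_least)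

section \<open>The error bound in discrete time\<close>

context balanced_lss
begin

text \<open>The states of the truncated systems of all dimensions \<open>k\<close>. Setting the components from \<open>k\<close> on
  to zero after every step keeps the padding, and it turns the full dynamics into those of the
  truncated system.\<close>

primrec dt_level :: "(nat \<Rightarrow> real Matrix.vec) \<Rightarrow> (nat \<Rightarrow> nat) \<Rightarrow> nat \<Rightarrow> nat \<Rightarrow> nat \<Rightarrow> real" where
  "dt_level u q k 0 = (\<lambda>_. 0)"
| "dt_level u q k (Suc t) = truncated_field k
     (linear_field n m (A (q t)) (B (q t)) (dt_level u q k t) (\<lambda>l. u t $ l))"

lemma dt_state_level:
  assumes u: "u \<in> dt_l2 m" and q: "q \<in> dt_switching (modes S)"
  shows "dt_state S u q t \<in> carrier_vec n \<and> (\<forall>i<n. (T *\<^sub>v dt_state S u q t) $ i = dt_level u q n t i)"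
proof (induction t)
  case 0
  then show ?case using dims TW by simp
next
  case (Suc t)
  have qt: "q t \<in> modes S" and ut: "u t \<in> carrier_vec m"
    using u q by (auto simp: dt_l2_def dt_switching_def)
  note M = mats[OF qt]
  have "(T *\<^sub>v dt_state S u q (Suc t)) $ i = dt_level u q n (Suc t) i" if i: "i < n" for i
  proof -
    have "(T *\<^sub>v dt_state S u q (Suc t)) $ i
      = linear_field n m (A (q t)) (B (q t)) (\<lambda>j. (T *\<^sub>v dt_state S u q t) $ j) (\<lambda>l. u t $ l) i"
      using vector_field_in_coordinates[OF M(1,2) TW(1,2,4) _ ut i] Suc
      by (simp add: vector_field_def coord_A_def coord_B_def)
    also have "\<dots> = linear_field n m (A (q t)) (B (q t)) (dt_level u q n t) (\<lambda>l. u t $ l) i"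
      using Suc by (simp add: linear_field_def del: index_mult_mat_vec)
    finally show ?thesis using i by (simp add: truncated_field_def)
  qed
  moreover have "dt_state S u q (Suc t) \<in> carrier_vec n"
    using M ut Suc by (auto simp: vector_field_def intro!: mult_mat_vec_carrier[of _ n m])
  ultimately show ?case by blast
qed

lemma dt_state_S'_level:
  assumes u: "u \<in> dt_l2 m" and q: "q \<in> dt_switching (modes S)"
  shows "dt_state S' u q t \<in> carrier_vec r \<and>
    (\<forall>i<n. (if i < r then dt_state S' u q t $ i else 0) = dt_level u q r t i)"
proof (induction t)
  case 0
  then show ?case using S'_simps by simp
next
  case (Suc t)
  have ut: "u t \<in> carrier_vec m" using u by (auto simp: dt_l2_def)
  have "dt_state S' u q (Suc t) $ i = dt_level u q r (Suc t) i" if i: "i < r" for i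
  proof -
    have "dt_state S' u q (Suc t) $ i
      = linear_field n m (A (q t)) (B (q t)) (\<lambda>j. if j < r then dt_state S' u q t $ j else 0) (\<lambda>l. u t $ l) i"
      using truncated_vector_field_in_coordinates[OF less_imp_le[OF r] _ ut i] Suc
      by (simp add: vector_field_def coord_A_def coord_B_def S'_simps)
    also have "\<dots> = linear_field n m (A (q t)) (B (q t)) (dt_level u q r t) (\<lambda>l. u t $ l) i"
      using Suc by (simp add: linear_field_def)
    finally show ?thesis using i by (simp add: truncated_field_def)
  qed
  moreover have "dt_state S' u q (Suc t) \<in> carrier_vec r"
    using ut Suc unfolding dt_state.simps vector_field_def S'_simps
    by (intro add_carrier_vec mult_mat_vec_carrier[OF upper_left_block_carrier]) auto
  ultimately show ?case using r by (auto simp: truncated_field_def)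
qed

lemma dt_error_output:
  fixes t :: nat
  assumes u: "u \<in> dt_l2 m" and q: "q \<in> dt_switching (modes S)"
  defines "e \<equiv> dt_io_map S u q t - dt_io_map S' u q t"
  shows "e \<in> carrier_vec p"
    and "e \<bullet> e = (\<Sum>l<p. ((\<Sum>j<n. C (q t) l j * dt_level u q n t j) - (\<Sum>j<n. C (q t) l j * dt_level u q r t j))\<^sup>2)"
proof -
  have qt: "q t \<in> modes S" using q by (auto simp: dt_switching_def)
  note M = mats[OF qt]
  note X = dt_state_level[OF u q, of t] and X' = dt_state_S'_level[OF u q, of t]
  have c: "dt_io_map S u q t \<in> carrier_vec p" "dt_io_map S' u q t \<in> carrier_vec p"
    unfolding dt_io_map_def S'_simps using X X'
    by (auto intro!: mult_mat_vec_carrier[OF M(3)] mult_mat_vec_carrier[OF upper_left_block_carrier])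
  then show e: "e \<in> carrier_vec p" by (simp add: e_def)
  have "e $ l = (\<Sum>j<n. C (q t) l j * dt_level u q n t j) - (\<Sum>j<n. C (q t) l j * dt_level u q r t j)" if l: "l < p" for l
  proof -
    have "dt_io_map S u q t $ l = (\<Sum>j<n. C (q t) l j * dt_level u q n t j)"
      using output_in_coordinates[OF M(3) TW(1,2,4) _ l] X by (simp add: dt_io_map_def coord_C_def del: index_mult_mat_vec)
    moreover have "dt_io_map S' u q t $ l = (\<Sum>j<n. C (q t) l j * dt_level u q r t j)"
      using truncated_output_in_coordinates[OF less_imp_le[OF r] _ l, of "dt_state S' u q t" "Cmat S (q t) * W"] X'
      by (simp add: dt_io_map_def coord_C_def S'_simps del: index_mult_mat_vec)
    ultimately show ?thesis using c l by (simp add: e_def)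
  qed
  then show "e \<bullet> e = (\<Sum>l<p. ((\<Sum>j<n. C (q t) l j * dt_level u q n t j) - (\<Sum>j<n. C (q t) l j * dt_level u q r t j))\<^sup>2)"
    unfolding scalar_prod_self_eq_sum[OF e] by (intro sum.cong) auto
qed

lemma dt_error_bound:
  assumes gr: "dt_controllability_grammian S P" "dt_observability_grammian S R"
  shows "dt_L2_norm m (modes S) p (\<lambda>u q t. dt_io_map S u q t - dt_io_map S' u q t) \<le> ereal bound"
proof -
  let ?e = "\<lambda>u q t. dt_io_map S u q t - dt_io_map S' u q t"
  have main: "summable (\<lambda>t. ?e u q t \<bullet> ?e u q t) \<and> (\<Sum>t. ?e u q t \<bullet> ?e u q t) \<le> bound\<^sup>2 * (\<Sum>t. u t \<bullet> u t)"
    if u: "u \<in> dt_l2 m" and q: "q \<in> dt_switching (modes S)" for u q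
  proof -
    define X where "X = dt_level u q"
    define E where "E = (\<lambda>t. \<Sum>k=r..<n. (\<Sum>k=r..<n. s k) / s k * step_energy n s k (X (Suc k) t) (X k t))"
    have uu: "u t \<bullet> u t = (\<Sum>l<m. (u t $ l)\<^sup>2)" for t
      using u by (intro scalar_prod_self_eq_sum) (simp add: dt_l2_def)
    have sS: "(\<Sum>k=r..<n. s k) \<ge> 0" using bound_pos by simp
    have E0: "E 0 = 0" by (simp add: E_def X_def step_energy_def)
    have E_nonneg: "E t \<ge> 0" for t
      unfolding E_def using sS s_pos
      by (intro sum_nonneg mult_nonneg_nonneg divide_nonneg_nonneg step_energy_nonneg) (auto simp: less_imp_le)
    have step: "E (Suc t) - E t \<le> - (?e u q t \<bullet> ?e u q t) + bound\<^sup>2 * (u t \<bullet> u t)" for t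
    proof -
      have qt: "q t \<in> modes S" using q by (auto simp: dt_switching_def)
      have "E (Suc t) - E t = (\<Sum>k=r..<n. (\<Sum>k=r..<n. s k) / s k *
          (step_energy n s k (X (Suc k) (Suc t)) (X k (Suc t)) - step_energy n s k (X (Suc k) t) (X k t)))"
        by (simp add: E_def sum_subtractf right_diff_distrib)
      also have "\<dots> \<le> - (\<Sum>l<p. ((\<Sum>j<n. C (q t) l j * X n t j) - (\<Sum>j<n. C (q t) l j * X r t j))\<^sup>2)
          + bound\<^sup>2 * (\<Sum>l<m. (u t $ l)\<^sup>2)"
        using r s_pos
      proof (intro weighted_sum_of_telescoping_steps_le)
        fix k assume "r \<le> k" "k < n"
        then show "step_energy n s k (X (Suc k) (Suc t)) (X k (Suc t)) - step_energy n s k (X (Suc k) t) (X k t)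
          \<le> - (\<Sum>l<p. (\<Sum>j<n. C (q t) l j * (X (Suc k) t j - X k t j))\<^sup>2) + 4 * (s k)\<^sup>2 * (\<Sum>l<m. (u t $ l)\<^sup>2)"
          unfolding X_def dt_level.simps
          using s_pos dt_inequalities[OF qt gr] by (intro step_energy_next_le)
      qed auto
      finally show ?thesis unfolding uu dt_error_output(2)[OF u q] X_def .
    qed
    have su: "summable (\<lambda>t. u t \<bullet> u t)" using u by (simp add: dt_l2_def)
    have en: "?e u q t \<bullet> ?e u q t \<ge> 0" for t unfolding dt_error_output(2)[OF u q] by (intro sum_nonneg) simp
    have un: "u t \<bullet> u t \<ge> 0" for t unfolding uu by (intro sum_nonneg) simp
    have part: "(\<Sum>t<N. ?e u q t \<bullet> ?e u q t) \<le> bound\<^sup>2 * (\<Sum>t. u t \<bullet> u t)" for N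
    proof -
      have "E N - E 0 = (\<Sum>t<N. E (Suc t) - E t)" by (simp add: sum_lessThan_telescope)
      also have "\<dots> \<le> (\<Sum>t<N. - (?e u q t \<bullet> ?e u q t) + bound\<^sup>2 * (u t \<bullet> u t))" by (intro sum_mono step)
      also have "\<dots> = - (\<Sum>t<N. ?e u q t \<bullet> ?e u q t) + bound\<^sup>2 * (\<Sum>t<N. u t \<bullet> u t)"
        by (simp only: sum.distrib sum_negf sum_distrib_left)
      finally have "(\<Sum>t<N. ?e u q t \<bullet> ?e u q t) \<le> bound\<^sup>2 * (\<Sum>t<N. u t \<bullet> u t)" using E0 E_nonneg[of N] by linarith
      also have "\<dots> \<le> bound\<^sup>2 * (\<Sum>t. u t \<bullet> u t)"
        using sum_le_suminf[OF su, of "{..<N}"] un by (intro mult_left_mono) auto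
      finally show ?thesis .
    qed
    have "summable (\<lambda>t. ?e u q t \<bullet> ?e u q t)" 
      using part[of "Suc _"] unfolding lessThan_Suc_atMost by (rule bounded_imp_summable[OF en])
    moreover have "(\<Sum>t. ?e u q t \<bullet> ?e u q t) \<le> bound\<^sup>2 * (\<Sum>t. u t \<bullet> u t)"
      by (rule suminf_le_const[OF calculation part])
    ultimately show ?thesis by blast
  qed
  show ?thesis
    unfolding dt_L2_norm_def
  proof (rule gain_norm_le[OF bound_pos])
    fix u q assume u: "u \<in> dt_l2 m" and q: "q \<in> dt_switching (modes S)"
    show "?e u q \<in> dt_l2 p" using main[OF u q] dt_error_output(1)[OF u q] by (simp add: dt_l2_def)
    have "dt_norm2 (?e u q) \<le> sqrt (bound\<^sup>2 * (\<Sum>t. u t \<bullet> u t))"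
      unfolding dt_norm2_def using main[OF u q] by (intro real_sqrt_le_mono) blast
    also have "\<dots> = bound * dt_norm2 u"
      using bound_pos by (simp add: dt_norm2_def real_sqrt_mult)
    finally show "dt_norm2 (?e u q) \<le> bound * dt_norm2 u" .
  qed
qed

end

section \<open>Trajectories in continuous time\<close>

lemma AE_half_line_iff_negligible:
  "(AE t in lebesgue_on {0..}. Q t) \<longleftrightarrow> (\<exists>N. negligible N \<and> (\<forall>t::real\<ge>0. t \<notin> N \<longrightarrow> Q t))"
proof -
  have "(AE t in lebesgue_on {0..}. Q t) \<longleftrightarrow> (AE t in lebesgue. t \<in> {0::real..} \<longrightarrow> Q t)"
    by (rule AE_restrict_space_iff) simp
  also have "\<dots> \<longleftrightarrow> (\<exists>N\<in>null_sets lebesgue. {t \<in> space lebesgue. \<not> (t \<in> {0::real..} \<longrightarrow> Q t)} \<subseteq> N)"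
    by (rule eventually_ae_filter)
  also have "\<dots> \<longleftrightarrow> (\<exists>N. negligible N \<and> (\<forall>t\<ge>0. t \<notin> N \<longrightarrow> Q t))"
    unfolding negligible_iff_null_sets by (auto simp: subset_iff)
  finally show ?thesis .
qed

text \<open>A piecewise continuous signal has countably many discontinuities, and every function on the
  discrete space of modes preserves continuity.\<close>

lemma switching_measurable:
  fixes c :: "nat \<Rightarrow> real"
  assumes q: "q \<in> ct_switching Q"
  shows "(\<lambda>t. c (q t)) \<in> borel_measurable (lebesgue_on {0..})"
proof -
  define D where "D = {t \<in> {0..}. \<not> continuous (at t within {0..}) q}"
  have "D = (\<Union>k. {t \<in> {0..real k}. \<not> continuous (at t within {0..}) q})"
    using real_arch_simple by (auto simp: D_def)
  moreover have "finite {t \<in> {0..real k}. \<not> continuous (at t within {0..}) q}" for k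
    using q by (simp add: ct_switching_def)
  then have "countable (\<Union>k. {t \<in> {0..real k}. \<not> continuous (at t within {0..}) q})"
    by (rule countable_UN[OF countableI_type countable_finite])
  ultimately have D: "countable D" by simp
  have "continuous (at t within {0..}) (\<lambda>t. c (q t))" if "t \<in> {0..} - D" for t
    using that by (intro continuous_within_compose3[where g = c and f = q]) (auto simp: D_def isCont_def at_discrete)
  then have "continuous_on ({0..} - D) (\<lambda>t. c (q t))"
    unfolding continuous_on_eq_continuous_within by (meson Diff_subset continuous_within_subset)
  moreover have Ds: "{0..} - D \<in> sets borel"
    using countable_imp_null_set_lborel[OF D] by (intro sets.Diff) (auto simp: null_sets_def)
  ultimately have "(\<lambda>t. c (q t)) \<in> borel_measurable (restrict_space borel ({0..} - D))"
    by (intro borel_measurable_continuous_on_restrict)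
  then have "(\<lambda>t. if t \<in> {0..} - D then c (q t) else 0) \<in> borel_measurable borel"
    using Ds by (subst (asm) measurable_restrict_space_iff[where c = 0]) auto
  then have "(\<lambda>t. if t \<in> {0..} then c (q t) else 0) \<in> borel_measurable borel"
    by (rule measurable_discrete_difference[OF _ D]) auto
  then have "(\<lambda>t. if t \<in> {0..} then c (q t) else 0) \<in> borel_measurable lebesgue"
    by (simp add: measurable_completion)
  then show ?thesis
    by (subst measurable_restrict_space_iff[where c = 0]) auto
qed

lemma ct_L2_integrable:
  assumes u: "u \<in> ct_L2 m"
  shows "\<And>l. l < m \<Longrightarrow> (\<lambda>t. u t $ l) absolutely_integrable_on {0..T}"
    and "(\<lambda>t. \<Sum>l<m. (u t $ l)\<^sup>2) integrable_on {0..}"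
    and "integral {0..} (\<lambda>t. \<Sum>l<m. (u t $ l)\<^sup>2) = (ct_norm2 u)\<^sup>2"
proof -
  have uu: "u t \<bullet> u t = (\<Sum>l<m. (u t $ l)\<^sup>2)" if "t \<ge> 0" for t
    using u that by (intro scalar_prod_self_eq_sum) (simp add: ct_L2_def)
  have i: "integrable (lebesgue_on {0..}) (\<lambda>t. u t \<bullet> u t)" using u by (simp add: ct_L2_def)
  have "(\<lambda>t. u t \<bullet> u t) integrable_on {0..}" by (rule integrable_on_lebesgue_on[OF i]) simp
  moreover have "(\<lambda>t. u t \<bullet> u t) integrable_on {0..} \<longleftrightarrow> (\<lambda>t. \<Sum>l<m. (u t $ l)\<^sup>2) integrable_on {0..}"
    by (rule integrable_cong) (simp add: uu)
  ultimately show int: "(\<lambda>t. \<Sum>l<m. (u t $ l)\<^sup>2) integrable_on {0..}" by blast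
  have "integral\<^sup>L (lebesgue_on {0..}) (\<lambda>t. u t \<bullet> u t) = integral {0..} (\<lambda>t. u t \<bullet> u t)"
    by (rule lebesgue_integral_eq_integral[OF i]) simp
  also have e: "\<dots> = integral {0..} (\<lambda>t. \<Sum>l<m. (u t $ l)\<^sup>2)" by (rule integral_cong) (simp add: uu)
  finally have "integral\<^sup>L (lebesgue_on {0..}) (\<lambda>t. u t \<bullet> u t) = integral {0..} (\<lambda>t. \<Sum>l<m. (u t $ l)\<^sup>2)" .
  moreover have "integral {0..} (\<lambda>t. \<Sum>l<m. (u t $ l)\<^sup>2) \<ge> 0"
    by (rule integral_nonneg[OF int]) (simp add: sum_nonneg)
  ultimately show "integral {0..} (\<lambda>t. \<Sum>l<m. (u t $ l)\<^sup>2) = (ct_norm2 u)\<^sup>2" by (simp add: ct_norm2_def)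
  have intT: "(\<lambda>t. \<Sum>l<m. (u t $ l)\<^sup>2) integrable_on {0..T}"
    by (rule integrable_on_subinterval[OF int]) auto
  show "(\<lambda>t. u t $ l) absolutely_integrable_on {0..T}" if l: "l < m" for l
  proof (rule measurable_bounded_by_integrable_imp_absolutely_integrable)
    have "(\<lambda>t. u t $ l) \<in> borel_measurable (lebesgue_on {0..})" using u l by (simp add: ct_L2_def)
    then show "(\<lambda>t. u t $ l) \<in> borel_measurable (lebesgue_on {0..T})" by (rule measurable_restrict_mono) auto
    show "(\<lambda>t. 1 + (\<Sum>l<m. (u t $ l)\<^sup>2)) integrable_on {0..T}"
      by (intro integrable_add integrable_const_ivl intT)
    fix t assume "t \<in> {0..T}"
    have "(u t $ l)\<^sup>2 \<le> (\<Sum>l<m. (u t $ l)\<^sup>2)" using l by (intro member_le_sum) auto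
    moreover have "\<bar>u t $ l\<bar> \<le> 1 + (u t $ l)\<^sup>2"
      using zero_le_power2[of "\<bar>u t $ l\<bar> - 1"] by (simp add: power2_eq_square algebra_simps)
    ultimately show "norm (u t $ l) \<le> 1 + (\<Sum>l<m. (u t $ l)\<^sup>2)" by simp
  qed simp
qed

lemma coefficient_bound:
  fixes c :: "nat \<Rightarrow> nat \<Rightarrow> nat \<Rightarrow> real"
  assumes "finite Q"
  obtains L where "\<And>q i j. q \<in> Q \<Longrightarrow> i < n \<Longrightarrow> j < m \<Longrightarrow> \<bar>c q i j\<bar> \<le> L"
proof -
  have "finite ((\<lambda>(q, i, j). c q i j) ` (Q \<times> {..<n} \<times> {..<m}))" using assms by blast
  then obtain L where "\<forall>x\<in>(\<lambda>(q, i, j). c q i j) ` (Q \<times> {..<n} \<times> {..<m}). norm x \<le> L"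
    using finite_imp_bounded bounded_iff by metis
  then show ?thesis by (intro that[of L]) force
qed

lemma finite_modes: "finite (modes V)"
  by (simp add: modes_def)

text \<open>The state \<open>ct_state\<close> is chosen among all trajectories, so existence is what makes it satisfy the
  differential equation.\<close>

lemma ct_trajectory_exists:
  assumes V: "is_lss V" and u: "u \<in> ct_L2 (input_dim V)" and q: "q \<in> ct_switching (modes V)"
  shows "\<exists>x. ct_trajectory V u q x"
proof -
  define n m where "n = state_dim V" and "m = input_dim V"
  have mats: "Amat V (q t) \<in> carrier_mat n n" "Bmat V (q t) \<in> carrier_mat n m" "q t \<in> modes V" "u t \<in> carrier_vec m"
    if "t \<ge> 0" for t
    using V q u that by (auto simp: is_lss_def ct_switching_def n_def m_def ct_L2_def)
  obtain L where L: "\<And>q i j. q \<in> modes V \<Longrightarrow> i < n \<Longrightarrow> j < n \<Longrightarrow> \<bar>Amat V q $$ (i, j)\<bar> \<le> L"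
    using coefficient_bound[OF finite_modes, of V n n "\<lambda>q i j. Amat V q $$ (i, j)"] by blast
  obtain L' where L': "\<And>q i j. q \<in> modes V \<Longrightarrow> i < n \<Longrightarrow> j < m \<Longrightarrow> \<bar>Bmat V q $$ (i, j)\<bar> \<le> L'"
    using coefficient_bound[OF finite_modes, of V n m "\<lambda>q i j. Bmat V q $$ (i, j)"] by blast
  have meas: "(\<lambda>t. c (q t)) \<in> borel_measurable (lebesgue_on {0..T})" for c :: "nat \<Rightarrow> real" and T
    by (rule measurable_restrict_mono[OF switching_measurable[OF q]]) auto
  have f: "(\<lambda>t. \<Sum>l<m. Bmat V (q t) $$ (i, l) * u t $ l) absolutely_integrable_on {0..T}" if i: "i < n" for i T
  proof (intro absolutely_integrable_sum)
    fix l assume "l \<in> {..<m}"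
    then have l: "l < m" by simp
    show "(\<lambda>t. Bmat V (q t) $$ (i, l) * u t $ l) absolutely_integrable_on {0..T}"
    proof (rule absolutely_integrable_bounded_measurable_product_real)
      show "(\<lambda>t. Bmat V (q t) $$ (i, l)) \<in> borel_measurable (lebesgue_on {0..T})" by (rule meas)
      show "bounded ((\<lambda>t. Bmat V (q t) $$ (i, l)) ` {0..T})"
        unfolding bounded_iff using L' i l mats(3) by (intro exI[of _ L']) auto
      show "(\<lambda>t. u t $ l) absolutely_integrable_on {0..T}" using ct_L2_integrable(1)[OF u] l by (simp add: m_def)
    qed simp
  qed simp
  have Mm: "(\<lambda>t. Amat V (q t) $$ (i, j)) \<in> borel_measurable (lebesgue_on {0..T})"
    if "i < n" "j < n" for i j T by (rule meas)
  have LM: "\<bar>Amat V (q t) $$ (i, j)\<bar> \<le> L" if "i < n" "j < n" "t \<ge> 0" for i j t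
    using L[OF mats(3)] that by blast
  obtain x N where x0: "\<And>i. x i 0 = 0" and xac: "\<And>i T. i < n \<Longrightarrow> abs_continuous_on {0..T} (x i)"
    and N: "negligible N" and der: "\<And>i t. i < n \<Longrightarrow> t \<ge> 0 \<Longrightarrow> t \<notin> N \<Longrightarrow>
      (x i has_real_derivative (\<Sum>j<n. Amat V (q t) $$ (i, j) * x j t) + (\<Sum>l<m. Bmat V (q t) $$ (i, l) * u t $ l))
        (at t within {0..})"
    by (rule linear_ode_solution_exists[where n = n and M = "\<lambda>t i j. Amat V (q t) $$ (i, j)"
          and f = "\<lambda>t i. \<Sum>l<m. Bmat V (q t) $$ (i, l) * u t $ l" and L = L, OF Mm LM f]) (assumption | rule that)+
  define y where "y = (\<lambda>t. Matrix.vec n (\<lambda>i. x i t))"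
  have y: "y t $ i = x i t" "y t \<in> carrier_vec n" if "i < n" for t i using that by (auto simp: y_def)
  have yc: "y t \<in> carrier_vec n" for t by (simp add: y_def)
  have yfun: "(\<lambda>s. y s $ i) = x i" if "i < n" for i using y that by auto
  have field: "vector_field V (q t) (y t) (u t) $ i
      = (\<Sum>j<n. Amat V (q t) $$ (i, j) * x j t) + (\<Sum>l<m. Bmat V (q t) $$ (i, l) * u t $ l)"
    if "i < n" "t \<ge> 0" for i t
  proof -
    have "vector_field V (q t) (y t) (u t) $ i = (Amat V (q t) *\<^sub>v y t) $ i + (Bmat V (q t) *\<^sub>v u t) $ i"
      unfolding vector_field_def using mats[OF that(2)] that(1) by (intro index_add_vec) simp
    then show ?thesis
      using mult_mat_vec_index_eq_sum'[OF mats(1)[OF that(2)] yc that(1), of t]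
        mult_mat_vec_index_eq_sum'[OF mats(2,4)[OF that(2)] that(1)] y that by simp
  qed
  have "ct_trajectory V u q y"
    unfolding ct_trajectory_def AE_half_line_iff_negligible n_def[symmetric]
  proof (intro conjI allI impI exI)
    show "y t \<in> carrier_vec n" for t by (rule yc)
    show "y 0 = 0\<^sub>v n" using x0 by (auto simp: y_def)
    show "abs_continuous_on {0..T} (\<lambda>t. y t $ i)" if "i < n" for i T using xac[OF that] by (simp add: yfun that)
    show "negligible N" by (rule N)
    show "((\<lambda>s. y s $ i) has_real_derivative vector_field V (q t) (y t) (u t) $ i) (at t within {0..})"
      if "t \<ge> 0" "t \<notin> N" "i < n" for i t
      using der[of i t] field that by (simp add: yfun)
  qed
  then show ?thesis by blast
qed

lemma ct_state_trajectory:
  assumes "is_lss V" "u \<in> ct_L2 (input_dim V)" "q \<in> ct_switching (modes V)"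
  shows "ct_trajectory V u q (ct_state V u q)"
  unfolding ct_state_def using someI_ex[OF ct_trajectory_exists[OF assms]] .

section \<open>The error bound in continuous time\<close>

text \<open>Monotone convergence, applied to the restrictions of \<open>g\<close> to the intervals from 0 to \<open>k\<close>.\<close>

lemma integrable_half_line_of_bounded_integrals:
  fixes g :: "real \<Rightarrow> real"
  assumes int: "\<And>T. T \<ge> 0 \<Longrightarrow> g integrable_on {0..T}" and nonneg: "\<And>t. t \<ge> 0 \<Longrightarrow> g t \<ge> 0"
    and le: "\<And>T. T \<ge> 0 \<Longrightarrow> integral {0..T} g \<le> K"
  shows "integrable (lebesgue_on {0..}) g" "integral\<^sup>L (lebesgue_on {0..}) g \<le> K"
proof -
  let ?f = "\<lambda>k t. if t \<in> {0..real k} then g t else 0"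
  have set: "{0..real k} \<inter> {0..} = {0..real k}" for k by auto
  have f: "?f k integrable_on {0..}" "integral {0..} (?f k) = integral {0..real k} g" for k
    using int[of "real k"] by (simp_all only: integrable_restrict_Int integral_restrict_Int set)
  have "g integrable_on {0..} \<and> (\<lambda>k. integral {0..} (?f k)) \<longlonglongrightarrow> integral {0..} g"
  proof (rule monotone_convergence_increasing)
    show "?f k integrable_on {0..}" for k by (rule f(1))
    show "?f k t \<le> ?f (Suc k) t" if "t \<in> {0..}" for k t using nonneg that by auto
    show "(\<lambda>k. ?f k t) \<longlonglongrightarrow> g t" if "t \<in> {0..}" for t
    proof (rule tendsto_eventually)
      obtain k0 where "t \<le> real k0" using real_arch_simple by blast
      then show "eventually (\<lambda>k. ?f k t = g t) sequentially"
        using that by (intro eventually_sequentiallyI[of k0]) auto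
    qed
    have "\<bar>integral {0..} (?f k)\<bar> \<le> K" for k
      unfolding f(2) using le[of "real k"] integral_nonneg[OF int[of "real k"]] nonneg by auto
    then show "bounded (range (\<lambda>k. integral {0..} (?f k)))" unfolding bounded_iff by auto
  qed
  then have g: "g integrable_on {0..}" and lim: "(\<lambda>k. integral {0..} (?f k)) \<longlonglongrightarrow> integral {0..} g" by auto
  show i: "integrable (lebesgue_on {0..}) g"
    using nonnegative_absolutely_integrable_1[OF g] nonneg by (intro absolutely_integrable_imp_integrable) auto
  have "integral {0..} g \<le> K"
    by (rule LIMSEQ_le_const2[OF lim]) (unfold f(2), use le in auto)
  then show "integral\<^sup>L (lebesgue_on {0..}) g \<le> K"
    using lebesgue_integral_eq_integral[OF i] by simp
qed

context balanced_lss
begin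

text \<open>The counterpart of \<open>dt_level\<close> is a predicate, because trajectories are specified by a differential
  equation: \<open>\<xi>\<close> is any zero-padded trajectory of the truncated system with \<open>k\<close> components.\<close>

definition ct_level :: "(real \<Rightarrow> real Matrix.vec) \<Rightarrow> (real \<Rightarrow> nat) \<Rightarrow> nat \<Rightarrow> (nat \<Rightarrow> real \<Rightarrow> real) \<Rightarrow> bool" where
  "ct_level u q k \<xi> \<longleftrightarrow> (\<forall>i<n. \<xi> i 0 = 0) \<and> (\<forall>i<n. \<forall>t\<ge>0. k \<le> i \<longrightarrow> \<xi> i t = 0) \<and>
     (\<forall>i<n. \<forall>T0\<ge>0. abs_continuous_on {0..T0} (\<xi> i)) \<and>
     (\<exists>N. negligible N \<and> (\<forall>t\<ge>0. t \<notin> N \<longrightarrow> (\<forall>i<n. (\<xi> i has_real_derivative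
        truncated_field k (linear_field n m (A (q t)) (B (q t)) (\<lambda>j. \<xi> j t) (\<lambda>l. u t $ l)) i) (at t within {0..}))))"

text \<open>At the top level the system itself is described, in balanced coordinates. Its state is the
  original one multiplied by \<open>T\<close>, written out as a sum.\<close>

lemma ct_level_full:
  assumes u: "u \<in> ct_L2 m" and q: "q \<in> ct_switching (modes S)" and x: "ct_trajectory S u q x"
  shows "ct_level u q n (\<lambda>i t. \<Sum>j<n. T $$ (i, j) * x t $ j)"
proof -
  have xc: "x t \<in> carrier_vec n" if "t \<ge> 0" for t using x that dims by (simp add: ct_trajectory_def)
  have x0: "x 0 = 0\<^sub>v n" and xac: "\<And>i T0. i < n \<Longrightarrow> T0 \<ge> 0 \<Longrightarrow> abs_continuous_on {0..T0} (\<lambda>t. x t $ i)"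
    using x dims by (auto simp: ct_trajectory_def)
  obtain N where N: "negligible N" and der: "\<And>t i. t \<ge> 0 \<Longrightarrow> t \<notin> N \<Longrightarrow> i < n \<Longrightarrow>
      ((\<lambda>s. x s $ i) has_real_derivative vector_field S (q t) (x t) (u t) $ i) (at t within {0..})"
    using x dims unfolding ct_trajectory_def AE_half_line_iff_negligible by auto
  have deriv: "((\<lambda>t. \<Sum>j<n. T $$ (i, j) * x t $ j) has_real_derivative
      truncated_field n (linear_field n m (A (q t)) (B (q t)) (\<lambda>i. \<Sum>j<n. T $$ (i, j) * x t $ j) (\<lambda>l. u t $ l)) i)
      (at t within {0..})" if t: "t \<ge> 0" "t \<notin> N" and i: "i < n" for t i
  proof -
    have qt: "q t \<in> modes S" and ut: "u t \<in> carrier_vec m" using q u t by (auto simp: ct_switching_def ct_L2_def)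
    note M = mats[OF qt]
    have vc: "vector_field S (q t) (x t) (u t) \<in> carrier_vec n"
      using M xc[OF t(1)] ut by (auto simp: vector_field_def intro!: mult_mat_vec_carrier[of _ n m])
    have "((\<lambda>t. \<Sum>j<n. T $$ (i, j) * x t $ j) has_real_derivative
        (\<Sum>j<n. T $$ (i, j) * vector_field S (q t) (x t) (u t) $ j)) (at t within {0..})"
      using der[OF t] by (intro DERIV_sum DERIV_cmult) auto
    also have "(\<Sum>j<n. T $$ (i, j) * vector_field S (q t) (x t) (u t) $ j) = (T *\<^sub>v vector_field S (q t) (x t) (u t)) $ i"
      by (rule mult_mat_vec_index_eq_sum'[OF TW(1) vc i, symmetric])
    also have "\<dots> = linear_field n m (A (q t)) (B (q t)) (\<lambda>j. (T *\<^sub>v x t) $ j) (\<lambda>l. u t $ l) i"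
      unfolding vector_field_def coord_A_def coord_B_def
      by (rule vector_field_in_coordinates[OF M(1,2) TW(1,2,4) xc[OF t(1)] ut i])
    also have "\<dots> = linear_field n m (A (q t)) (B (q t)) (\<lambda>i. \<Sum>j<n. T $$ (i, j) * x t $ j) (\<lambda>l. u t $ l) i"
      unfolding linear_field_def using mult_mat_vec_index_eq_sum'[OF TW(1) xc[OF t(1)]]
      by (simp del: index_mult_mat_vec)
    finally show ?thesis using i by (simp add: truncated_field_def)
  qed
  show ?thesis
    unfolding ct_level_def
    using N deriv xac x0 by (auto intro!: abs_continuous_on_sum abs_continuous_on_cmult)
qed

lemma truncated_lss_simps:
  defines "V k \<equiv> truncate_lss k (transform_lss T W S)"
  shows "state_dim (V k) = k" "input_dim (V k) = m" "modes (V k) = modes S"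
    "Amat (V k) q = upper_left_block k k (T * Amat S q * W)"
    "Bmat (V k) q = upper_left_block k m (T * Bmat S q)" "is_lss (V k)"
  using dims lss by (auto simp: V_def truncate_lss_def transform_lss_def modes_def is_lss_def upper_left_block_def)

lemma ct_level_truncated:
  assumes k: "k \<le> n" and u: "u \<in> ct_L2 m"
    and x: "ct_trajectory (truncate_lss k (transform_lss T W S)) u q x"
  shows "ct_level u q k (\<lambda>i t. if i < k then x t $ i else 0)"
proof -
  have xc: "x t \<in> carrier_vec k" if "t \<ge> 0" for t using x that by (simp add: ct_trajectory_def truncated_lss_simps)
  have x0: "x 0 = 0\<^sub>v k" and xac: "\<And>i T0. i < k \<Longrightarrow> T0 \<ge> 0 \<Longrightarrow> abs_continuous_on {0..T0} (\<lambda>t. x t $ i)"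
    using x by (auto simp: ct_trajectory_def truncated_lss_simps)
  obtain N where N: "negligible N" and der: "\<And>t i. t \<ge> 0 \<Longrightarrow> t \<notin> N \<Longrightarrow> i < k \<Longrightarrow>
      ((\<lambda>s. x s $ i) has_real_derivative vector_field (truncate_lss k (transform_lss T W S)) (q t) (x t) (u t) $ i)
        (at t within {0..})"
    using x unfolding ct_trajectory_def AE_half_line_iff_negligible truncated_lss_simps by auto
  have deriv: "((\<lambda>t. if i < k then x t $ i else 0) has_real_derivative
      truncated_field k (linear_field n m (A (q t)) (B (q t)) (\<lambda>i. if i < k then x t $ i else 0) (\<lambda>l. u t $ l)) i)
      (at t within {0..})" if t: "t \<ge> 0" "t \<notin> N" for t i
  proof (cases "i < k")
    case True
    have ut: "u t \<in> carrier_vec m" using u t by (auto simp: ct_L2_def)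
    have "vector_field (truncate_lss k (transform_lss T W S)) (q t) (x t) (u t) $ i
        = linear_field n m (A (q t)) (B (q t)) (\<lambda>i. if i < k then x t $ i else 0) (\<lambda>l. u t $ l) i"
      unfolding vector_field_def truncated_lss_simps coord_A_def coord_B_def
      by (rule truncated_vector_field_in_coordinates[OF k xc[OF t(1)] ut True])
    then show ?thesis using der[OF t True] True by (simp add: truncated_field_def)
  qed (simp add: truncated_field_def)
  have ac: "abs_continuous_on {0..T0} (\<lambda>t. if i < k then x t $ i else 0)" if "T0 \<ge> 0" for T0 i
    using xac[of i T0] that abs_continuous_on_const[of "{0..T0}" 0] by (cases "i < k") auto
  show ?thesis
    unfolding ct_level_def using N deriv ac x0 by auto
qed

text \<open>The total energy of the chain of truncations starts at 0, stays nonnegative, and is absolutely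
  continuous with derivative at most \<open>- e2 + bound\<^sup>2 * U\<close> almost everywhere, where \<open>U\<close> is the squared
  norm of the input. Integrating this bound on the derivative needs \<open>e2\<close> to be integrable, which holds
  because the output matrices are bounded and measurable in time and the states are continuous.\<close>

lemma ct_energy_bound:
  assumes gr: "ct_controllability_grammian S P" "ct_observability_grammian S R"
    and u: "u \<in> ct_L2 m" and q: "q \<in> ct_switching (modes S)"
    and X: "\<And>k. r \<le> k \<Longrightarrow> k \<le> n \<Longrightarrow> ct_level u q k (X k)" and T0: "T0 \<ge> 0"
  defines "e2 \<equiv> \<lambda>t. \<Sum>l<p. ((\<Sum>j<n. C (q t) l j * X n j t) - (\<Sum>j<n. C (q t) l j * X r j t))\<^sup>2"
  shows "e2 integrable_on {0..T0}" "integral {0..T0} e2 \<le> bound\<^sup>2 * (ct_norm2 u)\<^sup>2"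
proof -
  have qm: "q t \<in> modes S" if "t \<ge> 0" for t using q that by (simp add: ct_switching_def)
  have ac: "abs_continuous_on {0..T0} (X k i)" if "r \<le> k" "k \<le> n" "i < n" for k i
    using X[OF that(1,2)] that(3) T0 by (auto simp: ct_level_def)
  have meas: "(\<lambda>t. c (q t)) \<in> borel_measurable (lebesgue_on {0..T0})" for c :: "nat \<Rightarrow> real"
    by (rule measurable_restrict_mono[OF switching_measurable[OF q]]) auto
  obtain L where L: "\<And>q l j. q \<in> modes S \<Longrightarrow> l < p \<Longrightarrow> j < n \<Longrightarrow> \<bar>C q l j\<bar> \<le> L"
    using coefficient_bound[OF finite_modes, of S p n C] by blast
  define Y where "Y = (\<lambda>j t. X n j t - X r j t)"
  define e where "e = (\<lambda>l t. \<Sum>j<n. C (q t) l j * Y j t)"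
  have e2: "e2 = (\<lambda>t. \<Sum>l<p. e l t * e l t)"
    by (simp add: e2_def e_def Y_def right_diff_distrib sum_subtractf power2_eq_square)
  have Ycont: "continuous_on {0..T0} (Y j)" if "j < n" for j
    unfolding Y_def using r that by (intro continuous_on_diff abs_continuous_on_imp_continuous_on ac) auto
  have CY: "(\<lambda>t. C (q t) l j * f t) absolutely_integrable_on {0..T0}"
    if "l < p" "j < n" "f absolutely_integrable_on {0..T0}" for l j f
  proof (rule absolutely_integrable_bounded_measurable_product_real)
    show "(\<lambda>t. C (q t) l j) \<in> borel_measurable (lebesgue_on {0..T0})" by (rule meas)
    show "bounded ((\<lambda>t. C (q t) l j) ` {0..T0})"
      unfolding bounded_iff using L qm that by (intro exI[of _ L]) auto
  qed (use that in auto)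
  have Yint: "Y j absolutely_integrable_on {0..T0}" if "j < n" for j
    by (rule absolutely_integrable_continuous_real[OF Ycont[OF that]])
  have eint: "e l absolutely_integrable_on {0..T0}" if "l < p" for l
    unfolding e_def using that by (intro absolutely_integrable_sum CY Yint) auto
  have "(\<lambda>t. e l t * e l t) absolutely_integrable_on {0..T0}" if l: "l < p" for l
  proof (rule absolutely_integrable_bounded_measurable_product_real[OF _ _ _ eint[OF l]])
    show "e l \<in> borel_measurable (lebesgue_on {0..T0})"
      by (rule absolutely_integrable_imp_borel_measurable[OF eint[OF l]]) simp
    have "\<exists>b. \<forall>t\<in>{0..T0}. \<bar>Y j t\<bar> \<le> b" if "j < n" for j
      using compact_imp_bounded[OF compact_continuous_image[OF Ycont[OF that] compact_Icc]]
      unfolding bounded_iff by (metis image_eqI real_norm_def)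
    then obtain b where b: "\<And>j t. j < n \<Longrightarrow> t \<in> {0..T0} \<Longrightarrow> \<bar>Y j t\<bar> \<le> b j" by metis
    have "\<bar>e l t\<bar> \<le> (\<Sum>j<n. L * b j)" if t: "t \<in> {0..T0}" for t
    proof -
      have "\<bar>e l t\<bar> \<le> (\<Sum>j<n. \<bar>C (q t) l j * Y j t\<bar>)" unfolding e_def by (rule sum_abs)
      also have "\<dots> \<le> (\<Sum>j<n. L * b j)"
      proof (rule sum_mono)
        fix j assume "j \<in> {..<n}"
        then have "\<bar>C (q t) l j\<bar> \<le> L" "\<bar>Y j t\<bar> \<le> b j" using L qm l b t by auto
        then show "\<bar>C (q t) l j * Y j t\<bar> \<le> L * b j" unfolding abs_mult by (intro mult_mono) auto
      qed
      finally show ?thesis .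
    qed
    then show "bounded (e l ` {0..T0})"
      unfolding bounded_iff by (intro exI[of _ "\<Sum>j<n. L * b j"]) auto
  qed simp
  then have "e2 absolutely_integrable_on {0..T0}" unfolding e2 by (intro absolutely_integrable_sum) auto
  then show e2int: "e2 integrable_on {0..T0}" using set_lebesgue_integral_eq_integral(1) by blast
  define U where "U = (\<lambda>t. \<Sum>l<m. (u t $ l)\<^sup>2)"
  have Uint: "U integrable_on {0..T0}" unfolding U_def
    by (rule integrable_on_subinterval[OF ct_L2_integrable(2)[OF u]]) auto
  define E where "E = (\<lambda>t. \<Sum>k=r..<n. (\<Sum>k=r..<n. s k) / s k * step_energy n s k (\<lambda>i. X (Suc k) i t) (\<lambda>i. X k i t))"
  have Eac: "abs_continuous_on {0..T0} E"
    unfolding E_def step_energy_def power2_eq_square times_divide_eq_left[symmetric] mult.assoc[symmetric]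
    by (intro abs_continuous_on_sum abs_continuous_on_cmult abs_continuous_on_add) 
       (auto simp: mult.assoc divide_inverse mult.left_commute intro!: abs_continuous_on_cmult abs_continuous_on_mult
        abs_continuous_on_add abs_continuous_on_diff ac)
  have "\<exists>N. \<forall>k\<in>{r..n}. negligible (N k) \<and> (\<forall>t\<ge>0. t \<notin> N k \<longrightarrow> (\<forall>i<n. (X k i has_real_derivative
        truncated_field k (linear_field n m (A (q t)) (B (q t)) (\<lambda>j. X k j t) (\<lambda>l. u t $ l)) i) (at t within {0..})))"
    by (rule bchoice) (use X in \<open>auto simp: ct_level_def\<close>)
  then obtain N where N: "\<And>k. k \<in> {r..n} \<Longrightarrow> negligible (N k)"
    and der: "\<And>k t i. k \<in> {r..n} \<Longrightarrow> t \<ge> 0 \<Longrightarrow> t \<notin> N k \<Longrightarrow> i < n \<Longrightarrow> (X k i has_real_derivative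
        truncated_field k (linear_field n m (A (q t)) (B (q t)) (\<lambda>j. X k j t) (\<lambda>l. u t $ l)) i) (at t within {0..})"
    by blast
  \<comment> \<open>Only finitely many levels occur, so their exceptional null sets have a common one.\<close>
  define NN where "NN = (\<Union>k\<in>{r..n}. N k)"
  have NN: "negligible NN" unfolding NN_def using N by (intro negligible_Union) auto
  define X' where "X' = (\<lambda>k i t. truncated_field k (linear_field n m (A (q t)) (B (q t)) (\<lambda>j. X k j t) (\<lambda>l. u t $ l)) i)"
  define E' where "E' = (\<lambda>t. \<Sum>k=r..<n. (\<Sum>k=r..<n. s k) / s k *
      step_energy_deriv n s k (\<lambda>i. X (Suc k) i t) (\<lambda>i. X k i t) (\<lambda>i. X' (Suc k) i t) (\<lambda>i. X' k i t))"
  have "E T0 - E 0 \<le> integral {0..T0} (\<lambda>t. - e2 t + bound\<^sup>2 * U t)"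
  proof (rule abs_continuous_increment_le[OF T0 Eac NN])
    fix t assume t: "t \<in> {0..T0} - NN"
    have d: "(X k i has_real_derivative X' k i t) (at t within {0..T0})" if "k \<in> {r..n}" "i < n" for k i
      unfolding X'_def by (rule DERIV_subset[OF der]) (use t that in \<open>auto simp: NN_def\<close>)
    have "((\<lambda>t. step_energy n s k (\<lambda>i. X (Suc k) i t) (\<lambda>i. X k i t)) has_real_derivative
        step_energy_deriv n s k (\<lambda>i. X (Suc k) i t) (\<lambda>i. X k i t) (\<lambda>i. X' (Suc k) i t) (\<lambda>i. X' k i t))
        (at t within {0..T0})" if k: "k \<in> {r..<n}" for k
      unfolding step_energy_def step_energy_deriv_def
    proof (rule DERIV_sum)
      fix i assume "i \<in> {..<n}"
      then have i: "i < n" by simp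
      then have si: "s i \<noteq> 0" using s_pos[OF i] by simp
      have "(X (Suc k) i has_real_derivative X' (Suc k) i t) (at t within {0..T0})"
        "(X k i has_real_derivative X' k i t) (at t within {0..T0})"
        using k i by (auto intro!: d)
      then show "((\<lambda>t. s i * (X (Suc k) i t - X k i t)\<^sup>2 + (s k)\<^sup>2 * (X (Suc k) i t + X k i t)\<^sup>2 / s i) has_real_derivative
          2 * (s i * ((X (Suc k) i t - X k i t) * (X' (Suc k) i t - X' k i t))
            + (s k)\<^sup>2 * ((X (Suc k) i t + X k i t) * (X' (Suc k) i t + X' k i t)) / s i)) (at t within {0..T0})"
        by (auto intro!: derivative_eq_intros simp: si field_simps)
    qed
    then show "(E has_real_derivative E' t) (at t within {0..T0})"
      unfolding E_def E'_def by (intro DERIV_sum DERIV_cmult)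
    have qt: "q t \<in> modes S" using qm t by simp
    have "E' t \<le> - (\<Sum>l<p. ((\<Sum>j<n. C (q t) l j * X n j t) - (\<Sum>j<n. C (q t) l j * X r j t))\<^sup>2) + bound\<^sup>2 * U t"
      unfolding E'_def using r s_pos
    proof (intro weighted_sum_of_telescoping_steps_le)
      fix k assume k: "r \<le> k" "k < n"
      show "step_energy_deriv n s k (\<lambda>i. X (Suc k) i t) (\<lambda>i. X k i t) (\<lambda>i. X' (Suc k) i t) (\<lambda>i. X' k i t)
        \<le> - (\<Sum>l<p. (\<Sum>j<n. C (q t) l j * (X (Suc k) j t - X k j t))\<^sup>2) + 4 * (s k)\<^sup>2 * U t"
        unfolding X'_def U_def
      proof (rule step_energy_deriv_le[OF s_pos k(2) ct_inequalities[OF qt gr]])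
        show "X (Suc k) i t = 0" if "Suc k \<le> i" "i < n" for i
          using X[of "Suc k"] k that t by (auto simp: ct_level_def)
        show "X k i t = 0" if "k \<le> i" "i < n" for i
          using X[of k] k that t by (auto simp: ct_level_def)
      qed
    qed auto
    then show "E' t \<le> - e2 t + bound\<^sup>2 * U t" by (simp add: e2_def)
  next
    show "(\<lambda>t. - e2 t + bound\<^sup>2 * U t) integrable_on {0..T0}"
      by (intro integrable_add integrable_neg integrable_on_mult_right e2int Uint)
  qed
  also have "\<dots> = - integral {0..T0} e2 + bound\<^sup>2 * integral {0..T0} U"
    using integral_add[OF integrable_neg[OF e2int] integrable_on_mult_right[OF Uint, of "bound\<^sup>2"]] by simp
  finally have "E T0 - E 0 \<le> - integral {0..T0} e2 + bound\<^sup>2 * integral {0..T0} U" .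
  moreover have "E 0 = 0"
  proof -
    have "X k i 0 = 0" if "r \<le> k" "k \<le> n" "i < n" for k i using X[OF that(1,2)] that(3) by (auto simp: ct_level_def)
    then show ?thesis by (simp add: E_def step_energy_def)
  qed
  moreover have "E T0 \<ge> 0"
    unfolding E_def using bound_pos s_pos
    by (intro sum_nonneg mult_nonneg_nonneg divide_nonneg_nonneg step_energy_nonneg) (auto simp: less_imp_le)
  moreover have "integral {0..T0} U \<le> (ct_norm2 u)\<^sup>2"
    unfolding ct_L2_integrable(3)[OF u, symmetric] U_def[symmetric]
    using Uint ct_L2_integrable(2)[OF u] by (intro integral_subset_le) (auto simp: U_def sum_nonneg)
  then have "bound\<^sup>2 * integral {0..T0} U \<le> bound\<^sup>2 * (ct_norm2 u)\<^sup>2" by (intro mult_left_mono) auto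
  ultimately show "integral {0..T0} e2 \<le> bound\<^sup>2 * (ct_norm2 u)\<^sup>2" by linarith
qed

lemma ct_error_bound:
  assumes gr: "ct_controllability_grammian S P" "ct_observability_grammian S R"
  shows "ct_L2_norm m (modes S) p (\<lambda>u q t. ct_io_map S u q t - ct_io_map S' u q t) \<le> ereal bound"
  unfolding ct_L2_norm_def
proof (rule gain_norm_le[OF bound_pos])
  fix u q assume u: "u \<in> ct_L2 m" and q: "q \<in> ct_switching (modes S)"
  define V where "V = (\<lambda>k. truncate_lss k (transform_lss T W S))"
  have traj: "ct_trajectory S u q (ct_state S u q)"
    using ct_state_trajectory[OF lss] u q dims by simp
  have trajV: "ct_trajectory (V k) u q (ct_state (V k) u q)" for k
    unfolding V_def using u q by (intro ct_state_trajectory) (simp_all add: truncated_lss_simps)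
  \<comment> \<open>Below level \<open>n\<close>, the states of the truncated systems of all dimensions serve as levels; level
    \<open>r\<close> is the reduced system and level \<open>n\<close> the given one.\<close>
  define X where "X = (\<lambda>k i t. if k < n then if i < k then ct_state (V k) u q t $ i else 0
      else \<Sum>j<n. T $$ (i, j) * ct_state S u q t $ j)"
  have X: "ct_level u q k (X k)" if "r \<le> k" "k \<le> n" for k
  proof (cases "k < n")
    case True
    then show ?thesis using ct_level_truncated[OF less_imp_le[OF True] u trajV[unfolded V_def]]
      unfolding X_def V_def by simp
  next
    case False
    then show ?thesis using ct_level_full[OF u q traj] that by (simp add: X_def)
  qed
  define e where "e = (\<lambda>t. ct_io_map S u q t - ct_io_map S' u q t)"
  have V_r: "V r = S'" by (simp add: V_def S')
  define el where "el = (\<lambda>l t. (\<Sum>j<n. C (q t) l j * X n j t) - (\<Sum>j<n. C (q t) l j * X r j t))"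
  have e: "e t \<in> carrier_vec p" "\<And>l. l < p \<Longrightarrow> e t $ l = el l t" if t: "t \<ge> 0" for t
  proof -
    have qt: "q t \<in> modes S" using q t by (simp add: ct_switching_def)
    note M = mats[OF qt]
    have xc: "ct_state S u q t \<in> carrier_vec n" using traj t dims by (simp add: ct_trajectory_def)
    have xc': "ct_state S' u q t \<in> carrier_vec r"
      using trajV[of r] t by (simp add: ct_trajectory_def V_def truncated_lss_simps S')
    have c: "ct_io_map S u q t \<in> carrier_vec p" "ct_io_map S' u q t \<in> carrier_vec p"
      unfolding ct_io_map_def S'_simps using xc xc'
      by (auto intro!: mult_mat_vec_carrier[OF M(3)] mult_mat_vec_carrier[OF upper_left_block_carrier])
    then show "e t \<in> carrier_vec p" by (simp add: e_def)
    show "e t $ l = el l t" if l: "l < p" for l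
    proof -
      have "ct_io_map S u q t $ l = (\<Sum>j<n. C (q t) l j * (T *\<^sub>v ct_state S u q t) $ j)"
        unfolding ct_io_map_def coord_C_def by (rule output_in_coordinates[OF M(3) TW(1,2,4) xc l])
      also have "\<dots> = (\<Sum>j<n. C (q t) l j * X n j t)"
        using mult_mat_vec_index_eq_sum'[OF TW(1) xc] by (simp add: X_def del: index_mult_mat_vec)
      finally have "ct_io_map S u q t $ l = (\<Sum>j<n. C (q t) l j * X n j t)" .
      moreover have "ct_io_map S' u q t $ l = (\<Sum>j<n. C (q t) l j * X r j t)"
        unfolding ct_io_map_def S'_simps
          truncated_output_in_coordinates[OF less_imp_le[OF r] xc' l, of "Cmat S (q t) * W"]
        unfolding X_def V_r coord_C_def using r by simp
      ultimately show ?thesis using c l by (simp add: e_def el_def)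
    qed
  qed
  have ee: "e t \<bullet> e t = (\<Sum>l<p. (el l t)\<^sup>2)" if "t \<ge> 0" for t
    unfolding scalar_prod_self_eq_sum[OF e(1)[OF that]] using e(2)[OF that] by simp
  have bnd: "(\<lambda>t. \<Sum>l<p. (el l t)\<^sup>2) integrable_on {0..T0}"
      "integral {0..T0} (\<lambda>t. \<Sum>l<p. (el l t)\<^sup>2) \<le> bound\<^sup>2 * (ct_norm2 u)\<^sup>2" if "T0 \<ge> 0" for T0
    unfolding el_def using ct_energy_bound[OF gr u q X that] by blast+
  have int: "integrable (lebesgue_on {0..}) (\<lambda>t. \<Sum>l<p. (el l t)\<^sup>2)"
    "integral\<^sup>L (lebesgue_on {0..}) (\<lambda>t. \<Sum>l<p. (el l t)\<^sup>2) \<le> bound\<^sup>2 * (ct_norm2 u)\<^sup>2"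
    by (rule integrable_half_line_of_bounded_integrals[OF bnd(1) _ bnd(2)]; simp add: sum_nonneg)+
  have Xmeas: "X k j \<in> borel_measurable (lebesgue_on {0..})" if "r \<le> k" "k \<le> n" "j < n" for k j
  proof (rule continuous_imp_measurable_on_sets_lebesgue)
    have "continuous_on {0..T0} (X k j)" if "T0 \<ge> 0" for T0
      using X[OF \<open>r \<le> k\<close> \<open>k \<le> n\<close>] \<open>j < n\<close> that
      by (intro abs_continuous_on_imp_continuous_on) (auto simp: ct_level_def)
    then have "continuous (at t within {0..}) (X k j)" if "t \<ge> 0" for t
    proof -
      have "continuous_on {0..t + 1} (X k j)" using \<open>\<And>T0. T0 \<ge> 0 \<Longrightarrow> continuous_on {0..T0} (X k j)\<close> that by simp
      then have "continuous (at t within {0..t + 1}) (X k j)"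
        using that by (simp add: continuous_on_eq_continuous_within)
      moreover have "at t within {0..t + 1} = at t within {0..}"
        by (rule at_within_nhd[of _ "{..<t + 1}"]) auto
      ultimately show ?thesis by simp
    qed
    then show "continuous_on {0..} (X k j)" by (simp add: continuous_on_eq_continuous_within)
  qed simp
  have elmeas: "el l \<in> borel_measurable (lebesgue_on {0..})" for l
    unfolding el_def using r
    by (intro borel_measurable_diff borel_measurable_sum borel_measurable_times Xmeas switching_measurable[OF q]) auto
  have "e \<in> ct_L2 p"
    unfolding ct_L2_def mem_Collect_eq
  proof (intro conjI allI impI)
    show "e t \<in> carrier_vec p" if "t \<ge> 0" for t by (rule e(1)[OF that])
    show "(\<lambda>t. e t $ l) \<in> borel_measurable (lebesgue_on {0..})" if "l < p" for l
      using elmeas[of l] e(2) that by (subst measurable_cong[where g = "el l"]) auto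
    show "integrable (lebesgue_on {0..}) (\<lambda>t. e t \<bullet> e t)"
      using int(1) ee by (subst Bochner_Integration.integrable_cong[OF refl, where g = "\<lambda>t. \<Sum>l<p. (el l t)\<^sup>2"]) auto
  qed
  then show "(\<lambda>t. ct_io_map S u q t - ct_io_map S' u q t) \<in> ct_L2 p" by (simp add: e_def)
  have "integral\<^sup>L (lebesgue_on {0..}) (\<lambda>t. e t \<bullet> e t) = integral\<^sup>L (lebesgue_on {0..}) (\<lambda>t. \<Sum>l<p. (el l t)\<^sup>2)"
    by (rule Bochner_Integration.integral_cong) (auto simp: ee)
  then have "ct_norm2 e \<le> sqrt (bound\<^sup>2 * (ct_norm2 u)\<^sup>2)"
    unfolding ct_norm2_def[of e] using int(2) by (intro real_sqrt_le_mono) simp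
  also have "\<dots> = bound * ct_norm2 u"
  proof -
    have "ct_norm2 u \<ge> 0"
      unfolding ct_norm2_def using u by (intro real_sqrt_ge_zero Bochner_Integration.integral_nonneg)
        (auto simp: ct_L2_def scalar_prod_def intro!: sum_nonneg)
    then show ?thesis using bound_pos by (simp add: real_sqrt_mult)
  qed
  finally show "ct_norm2 (\<lambda>t. ct_io_map S u q t - ct_io_map S' u q t) \<le> bound * ct_norm2 u" by (simp add: e_def)
qed

end

section \<open>The error bound for balanced truncation\<close>

theorem theorem6:
  fixes S S' :: lss and P R :: "real mat" and r :: nat and \<sigma> :: "nat \<Rightarrow> real"
  assumes "is_lss S"
    and "r < state_dim S"
    and "balanced_truncation S P R r \<sigma> S'"
  shows
    "(ct_controllability_grammian S P \<and> ct_observability_grammian S R \<longrightarrow>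
        ct_L2_norm (input_dim S) (modes S) (output_dim S)
          (\<lambda>u q t. ct_io_map S u q t - ct_io_map S' u q t)
        \<le> ereal (2 * (\<Sum>k=r+1..state_dim S. \<sigma> k)))
     \<and>
     (dt_controllability_grammian S P \<and> dt_observability_grammian S R \<longrightarrow>
        dt_L2_norm (input_dim S) (modes S) (output_dim S)
          (\<lambda>u q t. dt_io_map S u q t - dt_io_map S' u q t)
        \<le> ereal (2 * (\<Sum>k=r+1..state_dim S. \<sigma> k)))"
proof -
  let ?n = "state_dim S"
  have sum_eq: "(\<Sum>k=r+1..?n. \<sigma> k) = (\<Sum>k=r..<?n. \<sigma> (Suc k))"
    using sum.shift_bounds_Suc_ivl[of \<sigma> r ?n] by (simp add: atLeastLessThanSuc_atLeastAtMost)
  have pos: "\<sigma> (Suc i) > 0" if "i < ?n" for i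
    using assms(3) that by (auto simp: balanced_truncation_def Let_def)
  have bal: "\<exists>T W. balanced_lss S P R r S' ?n (input_dim S) (output_dim S) T W (\<lambda>i. \<sigma> (Suc i))"
    if "pos_definite ?n P" "pos_definite ?n R"
  proof -
    have PR: "P \<in> carrier_mat ?n ?n" "P\<^sup>T = P" "R \<in> carrier_mat ?n ?n" "R\<^sup>T = R"
      using that by (auto simp: pos_definite_def)
    show ?thesis
      by (rule balanced_truncation_coordinates[OF assms(3) refl PR(1,3)], intro exI, unfold_locales)
         (use assms pos PR in auto)
  qed
  show ?thesis
    unfolding sum_eq
  proof (intro conjI impI; elim conjE)
    assume gr: "ct_controllability_grammian S P" "ct_observability_grammian S R"
    then obtain T W where "balanced_lss S P R r S' ?n (input_dim S) (output_dim S) T W (\<lambda>i. \<sigma> (Suc i))"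
      using bal by (auto simp: ct_controllability_grammian_def ct_observability_grammian_def)
    from balanced_lss.ct_error_bound[OF this gr]
    show "ct_L2_norm (input_dim S) (modes S) (output_dim S) (\<lambda>u q t. ct_io_map S u q t - ct_io_map S' u q t)
      \<le> ereal (2 * (\<Sum>k=r..<?n. \<sigma> (Suc k)))" .
  next
    assume gr: "dt_controllability_grammian S P" "dt_observability_grammian S R"
    then obtain T W where "balanced_lss S P R r S' ?n (input_dim S) (output_dim S) T W (\<lambda>i. \<sigma> (Suc i))"
      using bal by (auto simp: dt_controllability_grammian_def dt_observability_grammian_def)
    from balanced_lss.dt_error_bound[OF this gr]
    show "dt_L2_norm (input_dim S) (modes S) (output_dim S) (\<lambda>u q t. dt_io_map S u q t - dt_io_map S' u q t)
      \<le> ereal (2 * (\<Sum>k=r..<?n. \<sigma> (Suc k)))" .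
  qed
qed

end
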